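(* Let $T\in(0,\infty)$. Consider two exponentially stable Ornstein-Uhlenbeck systems $(A,B,K,C)$ on $X$ and $(\widetilde A,\widetilde B,\widetilde K,\widetilde C)$ on $\widetilde X$ with the same control function $u\in L^2(\Omega_T,\mathbb R^m)$, the same output space $\mathcal H$, driven by the same $\mathbb R^d$-valued square-integrable mean-zero Lévy process, but with (possibly different) initial conditions $\xi:=\sum_{i=1}^k\langle v,\widehat e_i\rangle_{\mathbb R^k}\phi_i$ and $\widetilde\xi:=\sum_{i=1}^k\langle v,\widehat e_i\rangle_{\mathbb R^k}\widetilde\phi_i$, where $v\in\mathbb R^k$ and $(\phi_i)$ is the $L^2(\Omega,\mathcal F_0,X)$-orthonormal system of $B_{\operatorname{in}}$. Then the difference $\Delta(CZ^{\operatorname{ou}})=CZ^{\operatorname{ou}}-\widetilde C\widetilde Z^{\operatorname{ou}}$ of the outputs satisfies $$\frac{\|\Delta(CZ^{\operatorname{ou}})\|_{L^2(\Omega_T)}}{\sqrt T}\le\|\Delta(H^{\operatorname{ou}})\|_{\operatorname{TC}}\left(1+\frac{\|\xi\|_{L^2(\Omega)}+2\|u\|_{L^2(\Omega_T)}}{\sqrt T}\right).$$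
   Context: $(\Omega,\mathcal F,\mathbb P)$ is a fixed probability space; $X,\widetilde X,\mathcal H$ are (real) separable Hilbert spaces. $(M_t)_{t\ge0}$ is the driving $\mathbb R^d$-valued square-integrable mean-zero Lévy process with induced filtration $(\mathcal F_t)$. An Ornstein-Uhlenbeck system $(A,B,K,C)$ on $X$ consists of the generator $A$ of a $C_0$-semigroup $(T_t)_{t\ge0}$ on $X$ and bounded linear maps $B:\mathbb R^m\to X$, $K:\mathbb R^d\to X$, $C:X\to\mathcal H$; it is exponentially stable if $\|T_t\|\le\nu e^{-\omega t}$ for all $t\ge0$, for some $\omega>0,\nu\ge1$. With control $u$ and initial state $\xi$, $Z^{\operatorname{ou}}$ is the mild solution of $\mathrm dZ_t=AZ_t\,\mathrm dt+Bu_t\,\mathrm dt+K\,\mathrm dM_t$, $Z_0=\xi$, and the output is $$CZ^{\operatorname{ou}}_t=CT_t\xi+\int_0^tCT_{t-s}K\,\mathrm dM_s+\int_0^tCT_{t-s}Bu_s\,\mathrm ds.$$ $B_{\operatorname{in}}:\mathbb R^k\to X$, $B_{\operatorname{in}}v=\sum_{i=1}^k\langle v,\widehat e_i\rangle\phi_i$, with $(\widehat e_i)$ the standard basis of $\mathbb R^k$ and $(\phi_i)$ orthonormal in $L^2(\Omega,\mathcal F_0,X)$; since $\mathcal F_0$ is generated by $M_0=0$, the $\phi_i$ are regarded as deterministic vectors of $X$. Similarly $\widetilde B_{\operatorname{in}}v=\sum_{i=1}^k\langle v,\widehat e_i\rangle\widetilde\phi_i$ with $\widetilde\phi_i\in\widetilde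 X$. OU Hankel operator: $H^{\operatorname{ou}}:=W^{\operatorname{ou}}R^{\operatorname{ou}}:L^2((0,\infty),\mathbb R^m)\oplus\mathbb R^d\oplus\mathbb R^k\to L^2((0,\infty),\mathcal H)$, where $(W^{\operatorname{ou}}x)(t):=CT_tx$ and $$R^{\operatorname{ou}}(f,w,a):=\int_0^\infty T_sBf_s\,\mathrm ds+K\sqrt{\mathbb E(M_1M_1^* )}\,w+B_{\operatorname{in}}a.$$ $\Delta(\Xi)$ denotes the quantity $\Xi$ for the first system minus the same quantity for the second system. $\|\cdot\|_{\operatorname{TC}}$ is the trace norm (value $+\infty$ if not trace class). $\Omega_T:=\Omega\times(0,T)$, $\|f\|^2_{L^2(\Omega_T)}=\mathbb E\int_0^T\|f(t)\|^2\,\mathrm dt$. *)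

theory Defs
  imports "HOL-Probability.Probability"
begin

section \<open>Square-integrable functions\<close>

definition sq_integrable ::
  "'s measure \<Rightarrow> ('s \<Rightarrow> 'a::{real_inner, second_countable_topology}) \<Rightarrow> bool" where
  "sq_integrable N f \<longleftrightarrow> f \<in> borel_measurable N \<and> integrable N (\<lambda>x. (norm (f x))\<^sup>2)"

text \<open>
  The norm takes extended values, so that an inequality bounding it from above also asserts
  that the function is square-integrable as soon as the bound is finite.
\<close>

definition ennreal_sqrt :: "ennreal \<Rightarrow> ennreal" where
  "ennreal_sqrt x = (if x = \<infinity> then \<infinity> else ennreal (sqrt (enn2real x)))"

definition L2_norm :: "'s measure \<Rightarrow> ('s \<Rightarrow> 'a::real_normed_vector) \<Rightarrow> ennreal" where
  "L2_norm N f = ennreal_sqrt (\<integral>\<^sup>+x. ennreal ((norm (f x))\<^sup>2) \<partial>N)"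

lemma sq_integrable_zero: "sq_integrable N (\<lambda>_. 0)"
  by (simp add: sq_integrable_def)

lemma sq_integrable_scaleR: "sq_integrable N f \<Longrightarrow> sq_integrable N (\<lambda>x. c *\<^sub>R f x)"
  by (auto simp: sq_integrable_def power_mult_distrib intro: borel_measurable_scaleR)

lemma sq_integrable_add:
  assumes "sq_integrable N f" "sq_integrable N g"
  shows "sq_integrable N (\<lambda>x. f x + g x)"
proof -
  have [measurable]: "f \<in> borel_measurable N" "g \<in> borel_measurable N"
    using assms by (auto simp: sq_integrable_def)
  have le: "(norm (f x + g x))\<^sup>2 \<le> 2 * (norm (f x))\<^sup>2 + 2 * (norm (g x))\<^sup>2" for x
  proof -
    have "(norm (f x + g x))\<^sup>2 \<le> (norm (f x) + norm (g x))\<^sup>2"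
      by (intro power_mono norm_triangle_ineq) auto
    also have "\<dots> \<le> 2 * (norm (f x))\<^sup>2 + 2 * (norm (g x))\<^sup>2"
      using zero_le_power2[of "norm (f x) - norm (g x)"]
      by (simp add: power2_eq_square algebra_simps)
    finally show ?thesis .
  qed
  have "integrable N (\<lambda>x. (norm (f x + g x))\<^sup>2)"
    by (rule Bochner_Integration.integrable_bound
          [where f = "\<lambda>x. 2 * (norm (f x))\<^sup>2 + 2 * (norm (g x))\<^sup>2"])
       (use assms le in \<open>auto simp: sq_integrable_def\<close>)
  then show ?thesis by (simp add: sq_integrable_def)
qed

lemma sq_integrable_uminus: "sq_integrable N f \<Longrightarrow> sq_integrable N (\<lambda>x. - f x)"
  using sq_integrable_scaleR[of N f "-1"] by simp

lemma sq_integrable_diff: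
  "sq_integrable N f \<Longrightarrow> sq_integrable N g \<Longrightarrow> sq_integrable N (\<lambda>x. f x - g x)"
  using sq_integrable_add[of N f "\<lambda>x. - g x"] sq_integrable_uminus by auto

lemma sq_integrable_inner:
  assumes "sq_integrable N f" "sq_integrable N g"
  shows "integrable N (\<lambda>x. f x \<bullet> g x)"
proof -
  have [measurable]: "f \<in> borel_measurable N" "g \<in> borel_measurable N"
    using assms by (auto simp: sq_integrable_def)
  have le: "\<bar>f x \<bullet> g x\<bar> \<le> (norm (f x))\<^sup>2 + (norm (g x))\<^sup>2" for x
  proof -
    have "\<bar>f x \<bullet> g x\<bar> \<le> norm (f x) * norm (g x)"
      by (rule Cauchy_Schwarz_ineq2)
    also have "\<dots> \<le> (norm (f x))\<^sup>2 + (norm (g x))\<^sup>2"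
      using zero_le_power2[of "norm (f x) - norm (g x)"] mult_nonneg_nonneg[of "norm (f x)" "norm (g x)"]
      by (simp add: power2_eq_square algebra_simps del: mult_nonneg_nonneg)
    finally show ?thesis .
  qed
  show ?thesis
    by (rule Bochner_Integration.integrable_bound
          [where f = "\<lambda>x. (norm (f x))\<^sup>2 + (norm (g x))\<^sup>2"])
       (use assms le in \<open>auto simp: sq_integrable_def\<close>)
qed


section \<open>The inner product space of square-integrable functions on the half-line\<close>

abbreviation halfline :: "real measure" where
  "halfline \<equiv> restrict_space lborel {0<..}"

quotient_type (overloaded) 'a L2_halfline =
  "real \<Rightarrow> 'a::{real_inner, second_countable_topology}" / partial:
  "\<lambda>f g. sq_integrable halfline f \<and> sq_integrable halfline g \<and> (AE t in halfline. f t = g t)"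
proof (rule part_equivpI)
  show "\<exists>f::real \<Rightarrow> 'a. sq_integrable halfline f \<and> sq_integrable halfline f \<and>
      (AE t in halfline. f t = f t)"
    by (rule exI[of _ "\<lambda>_. 0"]) (simp add: sq_integrable_zero)
  show "symp (\<lambda>f g::real \<Rightarrow> 'a. sq_integrable halfline f \<and> sq_integrable halfline g \<and>
      (AE t in halfline. f t = g t))"
    by (rule sympI) (auto elim: AE_mp)
  show "transp (\<lambda>f g::real \<Rightarrow> 'a. sq_integrable halfline f \<and> sq_integrable halfline g \<and>
      (AE t in halfline. f t = g t))"
  proof (rule transpI, elim conjE, intro conjI)
    fix f g h :: "real \<Rightarrow> 'a"
    assume "AE t in halfline. f t = g t" "AE t in halfline. g t = h t"
    then show "AE t in halfline. f t = h t" by eventually_elim simp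
  qed
qed

instantiation L2_halfline :: ("{real_inner, second_countable_topology}") real_vector
begin

lift_definition zero_L2_halfline :: "'a L2_halfline" is "\<lambda>_. 0"
  by (simp add: sq_integrable_zero)

lift_definition plus_L2_halfline :: "'a L2_halfline \<Rightarrow> 'a L2_halfline \<Rightarrow> 'a L2_halfline"
  is "\<lambda>f g t. f t + g t"
  by (auto intro: sq_integrable_add elim: AE_mp)

lift_definition uminus_L2_halfline :: "'a L2_halfline \<Rightarrow> 'a L2_halfline"
  is "\<lambda>f t. - f t"
  by (auto intro: sq_integrable_uminus)

lift_definition minus_L2_halfline :: "'a L2_halfline \<Rightarrow> 'a L2_halfline \<Rightarrow> 'a L2_halfline"
  is "\<lambda>f g t. f t - g t"
  by (auto intro: sq_integrable_diff elim: AE_mp)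

lift_definition scaleR_L2_halfline :: "real \<Rightarrow> 'a L2_halfline \<Rightarrow> 'a L2_halfline"
  is "\<lambda>c f t. c *\<^sub>R f t"
  by (auto intro: sq_integrable_scaleR elim: AE_mp)

instance
proof
  fix f g h :: "'a L2_halfline" and a b :: real
  show "f + g + h = f + (g + h)"
    by transfer (auto intro: sq_integrable_add simp: add.assoc)
  show "f + g = g + f"
    by transfer (auto intro: sq_integrable_add simp: add.commute)
  show "0 + f = f"
    by transfer auto
  show "- f + f = 0"
    by transfer (auto intro: sq_integrable_zero)
  show "f - g = f + - g"
    by transfer (auto intro: sq_integrable_diff)
  show "a *\<^sub>R (f + g) = a *\<^sub>R f + a *\<^sub>R g"
    by transfer (auto intro: sq_integrable_add sq_integrable_scaleR simp: scaleR_add_right)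
  show "(a + b) *\<^sub>R f = a *\<^sub>R f + b *\<^sub>R f"
    by transfer (auto intro: sq_integrable_add sq_integrable_scaleR simp: scaleR_add_left)
  show "a *\<^sub>R b *\<^sub>R f = (a * b) *\<^sub>R f"
    by transfer (auto intro: sq_integrable_scaleR)
  show "1 *\<^sub>R f = f"
    by transfer auto
qed

end

instantiation L2_halfline :: ("{real_inner, second_countable_topology}") real_inner
begin

lift_definition inner_L2_halfline :: "'a L2_halfline \<Rightarrow> 'a L2_halfline \<Rightarrow> real"
  is "\<lambda>f g. \<integral>t. f t \<bullet> g t \<partial>halfline"
proof (elim conjE)
  fix f f' g g' :: "real \<Rightarrow> 'a"
  assume sq: "sq_integrable halfline f" "sq_integrable halfline f'"
      "sq_integrable halfline g" "sq_integrable halfline g'"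
    and ae: "AE t in halfline. f t = f' t" "AE t in halfline. g t = g' t"
  show "(\<integral>t. f t \<bullet> g t \<partial>halfline) = (\<integral>t. f' t \<bullet> g' t \<partial>halfline)"
  proof (rule integral_cong_AE)
    show "AE t in halfline. f t \<bullet> g t = f' t \<bullet> g' t"
      using ae by eventually_elim simp
  qed (use sq_integrable_inner sq in \<open>blast intro: borel_measurable_integrable\<close>)+
qed

definition norm_L2_halfline :: "'a L2_halfline \<Rightarrow> real" where
  "norm_L2_halfline f = sqrt (f \<bullet> f)"

definition sgn_L2_halfline :: "'a L2_halfline \<Rightarrow> 'a L2_halfline" where
  "sgn_L2_halfline f = f /\<^sub>R norm f"

definition dist_L2_halfline :: "'a L2_halfline \<Rightarrow> 'a L2_halfline \<Rightarrow> real" where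
  "dist_L2_halfline f g = norm (f - g)"

definition uniformity_L2_halfline :: "('a L2_halfline \<times> 'a L2_halfline) filter" where
  "uniformity_L2_halfline = (INF e\<in>{0<..}. principal {(x, y). dist x y < e})"

definition open_L2_halfline :: "'a L2_halfline set \<Rightarrow> bool" where
  "open_L2_halfline U \<longleftrightarrow> (\<forall>x\<in>U. eventually (\<lambda>(x', y). x' = x \<longrightarrow> y \<in> U) uniformity)"

instance
proof
  fix f g h :: "'a L2_halfline" and a b :: real and U :: "'a L2_halfline set"
  show "dist f g = norm (f - g)"
    by (rule dist_L2_halfline_def)
  show "sgn f = f /\<^sub>R norm f"
    by (rule sgn_L2_halfline_def)
  show "uniformity = (INF e\<in>{0<..}. principal {(x, y :: 'a L2_halfline). dist x y < e})"
    by (rule uniformity_L2_halfline_def)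
  show "open U \<longleftrightarrow> (\<forall>x\<in>U. eventually (\<lambda>(x', y). x' = x \<longrightarrow> y \<in> U) uniformity)"
    by (rule open_L2_halfline_def)
  show "f \<bullet> g = g \<bullet> f"
    by transfer (simp add: inner_commute)
  show "(f + g) \<bullet> h = f \<bullet> h + g \<bullet> h"
    by transfer (simp add: inner_add_left sq_integrable_inner)
  show "(a *\<^sub>R f) \<bullet> g = a * (f \<bullet> g)"
    by transfer simp
  show "0 \<le> f \<bullet> f"
    by transfer simp
  show "f \<bullet> f = 0 \<longleftrightarrow> f = 0"
  proof transfer
    fix f :: "real \<Rightarrow> 'a"
    assume "sq_integrable halfline f \<and> sq_integrable halfline f \<and> (AE t in halfline. f t = f t)"
    then have sq: "sq_integrable halfline f" by simp
    have "(\<integral>t. f t \<bullet> f t \<partial>halfline) = 0 \<longleftrightarrow> (AE t in halfline. f t \<bullet> f t = 0)"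
      by (rule integral_nonneg_eq_0_iff_AE) (use sq_integrable_inner[OF sq sq] in auto)
    then show "(\<integral>t. f t \<bullet> f t \<partial>halfline) = 0 \<longleftrightarrow>
        sq_integrable halfline f \<and> sq_integrable halfline (\<lambda>_. 0 :: 'a) \<and>
        (AE t in halfline. f t = 0)"
      using sq by (simp add: sq_integrable_zero)
  qed
  show "norm f = sqrt (f \<bullet> f)"
    by (rule norm_L2_halfline_def)
qed

end


section \<open>Trace norm\<close>

definition positive_operator :: "('a::real_inner \<Rightarrow> 'a) \<Rightarrow> bool" where
  "positive_operator S \<longleftrightarrow>
     bounded_linear S \<and> (\<forall>x y. S x \<bullet> y = x \<bullet> S y) \<and> (\<forall>x. 0 \<le> S x \<bullet> x)"

text \<open>On a Hilbert space a positive operator has exactly one positive square root.\<close>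

definition op_sqrt :: "('a::real_inner \<Rightarrow> 'a) \<Rightarrow> 'a \<Rightarrow> 'a" where
  "op_sqrt Q = (SOME S. positive_operator S \<and> S \<circ> S = Q)"

definition orthonormal_basis :: "'a::real_inner set \<Rightarrow> bool" where
  "orthonormal_basis E \<longleftrightarrow>
     pairwise orthogonal E \<and> (\<forall>e\<in>E. norm e = 1) \<and> closure (span E) = UNIV"

text \<open>
  The trace of a positive operator on a Hilbert space does not depend on the orthonormal basis.
  The trace norm is the trace of \<open>\<bar>F\<bar> = sqrt (F\<^sup>* F)\<close>.
\<close>

definition positive_trace :: "('a::real_inner \<Rightarrow> 'a) \<Rightarrow> ennreal" where
  "positive_trace S = (\<Sum>\<^sub>\<infinity>e\<in>(SOME E. orthonormal_basis E). ennreal (S e \<bullet> e))"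

definition trace_norm :: "('a::real_inner \<Rightarrow> 'b::real_inner) \<Rightarrow> ennreal" where
  "trace_norm F =
     (if bounded_linear F then positive_trace (op_sqrt (adjoint F \<circ> F)) else \<infinity>)"


section \<open>Semigroups and their generators\<close>

definition C0_semigroup :: "(real \<Rightarrow> 'x::real_normed_vector \<Rightarrow>\<^sub>L 'x) \<Rightarrow> bool" where
  "C0_semigroup T \<longleftrightarrow>
     T 0 = id_blinfun \<and>
     (\<forall>s\<ge>0. \<forall>t\<ge>0. T (s + t) = T s o\<^sub>L T t) \<and>
     (\<forall>x. ((\<lambda>t. T t x) \<longlongrightarrow> x) (at_right 0))"

text \<open>An unbounded operator is represented by its graph.\<close>

definition generates ::
  "('x \<times> 'x) set \<Rightarrow> (real \<Rightarrow> 'x::real_normed_vector \<Rightarrow>\<^sub>L 'x) \<Rightarrow> bool" where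
  "generates A T \<longleftrightarrow> C0_semigroup T \<and>
     A = {(x, y). ((\<lambda>h. (T h x - x) /\<^sub>R h) \<longlongrightarrow> y) (at_right 0)}"

definition exp_stable :: "(real \<Rightarrow> 'x::real_normed_vector \<Rightarrow>\<^sub>L 'x) \<Rightarrow> bool" where
  "exp_stable T \<longleftrightarrow> (\<exists>\<omega>>0. \<exists>\<nu>\<ge>1. \<forall>t\<ge>0. norm (T t) \<le> \<nu> * exp (- \<omega> * t))"


section \<open>L\'evy processes and Wiener integrals\<close>

definition levy_process ::
  "'w measure \<Rightarrow> (real \<Rightarrow> 'w \<Rightarrow> 'v::{real_normed_vector, second_countable_topology}) \<Rightarrow> bool" where
  "levy_process P M \<longleftrightarrow>
     (\<forall>t\<ge>0. M t \<in> borel_measurable P) \<and>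
     (AE w in P. M 0 w = 0) \<and>
     (\<forall>\<tau> n. 0 \<le> \<tau> 0 \<and> incseq \<tau> \<longrightarrow>
        prob_space.indep_vars P (\<lambda>_. borel) (\<lambda>i w. M (\<tau> (Suc i)) w - M (\<tau> i) w) {..<n::nat}) \<and>
     (\<forall>s t. 0 \<le> s \<and> s \<le> t \<longrightarrow>
        distr P borel (\<lambda>w. M t w - M s w) = distr P borel (M (t - s))) \<and>
     (\<forall>t\<ge>0. \<forall>\<epsilon>>0.
        ((\<lambda>s. measure P {w \<in> space P. \<epsilon> < norm (M s w - M t w)}) \<longlongrightarrow> 0) (at t within {0..}))"

definition step_function ::
  "nat \<Rightarrow> (nat \<Rightarrow> real) \<Rightarrow> (nat \<Rightarrow> 'b::real_vector) \<Rightarrow> real \<Rightarrow> 'b" where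
  "step_function n \<tau> \<Phi> s = (\<Sum>i<n. indicator {\<tau> i<..\<tau> (Suc i)} s *\<^sub>R \<Phi> i)"

definition step_integral ::
  "(real \<Rightarrow> 'w \<Rightarrow> 'v::real_normed_vector) \<Rightarrow> nat \<Rightarrow> (nat \<Rightarrow> real) \<Rightarrow>
     (nat \<Rightarrow> 'v \<Rightarrow>\<^sub>L 'x::real_normed_vector) \<Rightarrow> 'w \<Rightarrow> 'x" where
  "step_integral M n \<tau> \<Phi> w = (\<Sum>i<n. \<Phi> i (M (\<tau> (Suc i)) w - M (\<tau> i) w))"

text \<open>
  \<open>I\<close> is (a version of) the stochastic integral of the deterministic operator-valued function
  \<open>F\<close> over \<open>{0..t}\<close> with respect to \<open>M\<close>: the limit in mean square of
  the integrals of step functions that converge to \<open>F\<close> in \<open>L\<^sup>2\<close>. If \<open>M\<close> is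
  a square-integrable mean-zero L\'evy process, the It\^o isometry makes \<open>I\<close> unique up to
  null sets.
\<close>

definition has_wiener_integral ::
  "'w measure \<Rightarrow> (real \<Rightarrow> 'w \<Rightarrow> 'v::real_normed_vector) \<Rightarrow>
     (real \<Rightarrow> 'v \<Rightarrow>\<^sub>L 'x::real_normed_vector) \<Rightarrow> real \<Rightarrow> ('w \<Rightarrow> 'x) \<Rightarrow> bool" where
  "has_wiener_integral P M F t I \<longleftrightarrow>
     set_borel_measurable lborel {0..t} F \<and> I \<in> borel_measurable P \<and>
     (\<exists>n \<tau> \<Phi>.
        (\<forall>j. mono (\<tau> j) \<and> range (\<tau> j) \<subseteq> {0..t}) \<and>
        (\<lambda>j. \<integral>\<^sup>+s\<in>{0..t}. ennreal ((norm (F s - step_function (n j) (\<tau> j) (\<Phi> j) s))\<^sup>2) \<partial>lborel)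
          \<longlonglongrightarrow> 0 \<and>
        (\<lambda>j. \<integral>\<^sup>+w. ennreal ((norm (I w - step_integral M (n j) (\<tau> j) (\<Phi> j) w))\<^sup>2) \<partial>P)
          \<longlonglongrightarrow> 0)"


section \<open>Ornstein--Uhlenbeck systems\<close>

text \<open>The product space \<open>\<Omega> \<times> (0, T)\<close>.\<close>

abbreviation time_product :: "'w measure \<Rightarrow> real \<Rightarrow> ('w \<times> real) measure" where
  "time_product P \<T> \<equiv> P \<Otimes>\<^sub>M restrict_space lborel {0<..<\<T>}"

text \<open>
  The stochastic convolution is determined only up to a null set for each time, so
  \<open>Z\<close> is any jointly measurable version. As the stochastic integrand is deterministic,
  neither \<open>u\<close> nor \<open>Z\<close> has to be adapted.
\<close>

definition mild_solution ::
  "'w measure \<Rightarrow> (real \<Rightarrow> 'w \<Rightarrow> real^'d) \<Rightarrow>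
     (real \<Rightarrow> 'x::{real_inner, banach, second_countable_topology} \<Rightarrow>\<^sub>L 'x) \<Rightarrow>
     ((real^'m) \<Rightarrow>\<^sub>L 'x) \<Rightarrow> ((real^'d) \<Rightarrow>\<^sub>L 'x) \<Rightarrow>
     (real \<Rightarrow> 'w \<Rightarrow> real^'m) \<Rightarrow> 'x \<Rightarrow> real \<Rightarrow> (real \<Rightarrow> 'w \<Rightarrow> 'x) \<Rightarrow> bool" where
  "mild_solution P M T B K u \<xi> \<T> Z \<longleftrightarrow>
     (\<lambda>(w, t). Z t w) \<in> borel_measurable (time_product P \<T>) \<and>
     (\<forall>t\<in>{0..\<T>}. \<exists>I.
        has_wiener_integral P M (\<lambda>s. T (t - s) o\<^sub>L K) t I \<and>
        (AE w in P. Z t w =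
           T t \<xi> + I w + (LINT s:{0<..<t}|lborel. T (t - s) (B (u s w)))))"

definition B_in :: "('k::finite \<Rightarrow> 'x::real_vector) \<Rightarrow> real^'k \<Rightarrow> 'x" where
  "B_in \<phi> v = (\<Sum>i\<in>UNIV. (v \<bullet> axis i 1) *\<^sub>R \<phi> i)"

definition second_moment :: "'w measure \<Rightarrow> (real \<Rightarrow> 'w \<Rightarrow> real^'d) \<Rightarrow> real^'d^'d" where
  "second_moment P M = (\<chi> i j. \<integral>w. M 1 w $ i * M 1 w $ j \<partial>P)"

text \<open>
  For an exponentially stable semigroup the orbit in \<open>ou_W\<close> is square-integrable, so
  \<open>abs_L2_halfline\<close> yields its class; the integral in \<open>ou_R\<close> does not depend on the
  representative chosen by \<open>rep_L2_halfline\<close>.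
\<close>

definition ou_W ::
  "(real \<Rightarrow> 'x::real_normed_vector \<Rightarrow>\<^sub>L 'x) \<Rightarrow>
     ('x \<Rightarrow>\<^sub>L 'h::{real_inner, second_countable_topology}) \<Rightarrow> 'x \<Rightarrow> 'h L2_halfline" where
  "ou_W T C x = abs_L2_halfline (\<lambda>t. C (T t x))"

definition ou_R ::
  "'w measure \<Rightarrow> (real \<Rightarrow> 'w \<Rightarrow> real^'d) \<Rightarrow>
     (real \<Rightarrow> 'x::{real_inner, banach, second_countable_topology} \<Rightarrow>\<^sub>L 'x) \<Rightarrow>
     ((real^'m) \<Rightarrow>\<^sub>L 'x) \<Rightarrow> ((real^'d) \<Rightarrow>\<^sub>L 'x) \<Rightarrow> ('k::finite \<Rightarrow> 'x) \<Rightarrow>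
     (real^'m) L2_halfline \<times> (real^'d) \<times> (real^'k) \<Rightarrow> 'x" where
  "ou_R P M T B K \<phi> = (\<lambda>(f, w, a).
     (\<integral>s. T s (B (rep_L2_halfline f s)) \<partial>halfline) +
     K (op_sqrt (\<lambda>z. second_moment P M *v z) w) + B_in \<phi> a)"

definition ou_hankel ::
  "'w measure \<Rightarrow> (real \<Rightarrow> 'w \<Rightarrow> real^'d) \<Rightarrow>
     (real \<Rightarrow> 'x::{real_inner, banach, second_countable_topology} \<Rightarrow>\<^sub>L 'x) \<Rightarrow>
     ((real^'m) \<Rightarrow>\<^sub>L 'x) \<Rightarrow> ((real^'d) \<Rightarrow>\<^sub>L 'x) \<Rightarrow> ('x \<Rightarrow>\<^sub>L 'h) \<Rightarrow> ('k::finite \<Rightarrow> 'x) \<Rightarrow>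
     (real^'m) L2_halfline \<times> (real^'d) \<times> (real^'k) \<Rightarrow>
     'h::{real_inner, second_countable_topology} L2_halfline" where
  "ou_hankel P M T B K C \<phi> = ou_W T C \<circ> ou_R P M T B K \<phi>"

end

theory Submission
  imports Defs
begin

text \<open>
  Let \<open>F\<close> be the difference of the two Hankel operators and \<open>\<tau>\<close> its trace norm. Let
  \<open>h(t) = C T\<^sub>t B - C' T'\<^sub>t B'\<close> and \<open>k(t) = C T\<^sub>t K - C' T'\<^sub>t K'\<close> be the differences of the
  responses to the control and to the noise, and \<open>Q\<close> the second moment of \<open>M\<^sub>1\<close>. Then
  \<open>F (f, 0, 0) (t) = \<integral> h(t + s) f(s) ds\<close>, \<open>F (0, w, 0) (t) = k(t) \<surd>Q w\<close>, and
  \<open>F (0, 0, v)\<close> is the difference of the free responses to \<open>\<xi>\<close> and \<open>\<xi>'\<close>. The error of the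
  outputs is a sum of three terms, and each of them is governed by one component of \<open>F\<close>.

  The free response is \<open>F (0, 0, v)\<close>, so its \<open>L\<^sup>2\<close> norm is at most \<open>\<tau> \<parallel>v\<parallel> = \<tau> \<parallel>\<xi>\<parallel>\<close>, the \<open>\<phi>\<^sub>i\<close>
  being orthonormal.

  By the It\^o isometry the stochastic convolution has second moment
  \<open>\<integral>\<^sub>0\<^sup>t \<parallel>k(s) \<surd>Q\<parallel>\<^sup>2 ds\<close> at time \<open>t\<close>, with the Hilbert-Schmidt norm in the integrand. This is at
  most the sum of \<open>\<parallel>F (0, e\<^sub>r, 0)\<parallel>\<^sup>2\<close> over the standard basis, hence at most \<open>\<tau>\<^sup>2\<close>. Integration
  over \<open>(0, \<T>)\<close> gives \<open>\<tau> \<surd>\<T>\<close>.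

  By Young's inequality the control convolution is at most \<open>\<parallel>h\<parallel>\<^sub>1 \<parallel>u\<parallel>\<close>, and \<open>\<parallel>h\<parallel>\<^sub>1 \<le> 2 \<tau>\<close>. The
  factor 2 appears because the diagonal of the Hankel kernel is \<open>h(2 t)\<close>: testing \<open>F\<close> with
  functions \<open>1\<^sub>I a\<close> and \<open>1\<^sub>I b\<close> on the intervals \<open>I\<close> of a fine partition produces Riemann sums of
  \<open>\<integral> \<parallel>h(2 t)\<parallel> dt = \<parallel>h\<parallel>\<^sub>1 / 2\<close>.

  All three estimates rest on one property of the trace norm, \<open>bessel_pairing_le_trace_norm\<close>: for families
  \<open>f\<^sub>j\<close>, \<open>g\<^sub>j\<close> that satisfy Bessel's inequality, \<open>\<Sum>\<^sub>j \<langle>F f\<^sub>j, g\<^sub>j\<rangle> \<le> \<tau>\<close>. Since the trace norm is defined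
  through the adjoint, a positive square root and an orthonormal basis, these have to exist first;
  this takes the completeness of \<open>L\<^sup>2(0, \<infinity>)\<close>. If the trace norm is infinite there is nothing to
  prove, and if it is finite then \<open>F\<close> is bounded by definition.
\<close>


section \<open>Projections, adjoints and orthonormal bases\<close>

text \<open>
  A minimizing sequence for the distance from \<open>x\<close> is Cauchy by the parallelogram law. Its limit \<open>y\<close>
  is the projection, since moving from \<open>y\<close> along \<open>z\<close> cannot decrease the distance.
\<close>

lemma ex_orthogonal_projection:
  fixes W :: "'a::{real_inner, banach} set"
  assumes "subspace W" "closed W"
  shows "\<exists>y\<in>W. \<forall>z\<in>W. (x - y) \<bullet> z = 0"
proof -
  define d where "d = infdist x W"
  have ne: "W \<noteq> {}" using subspace_0[OF assms(1)] by auto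
  have d_le: "d \<le> norm (x - y)" if "y \<in> W" for y
    using infdist_le[OF that, of x] by (simp add: d_def dist_norm)
  have d0: "0 \<le> d" by (simp add: d_def infdist_nonneg)
  have "\<exists>y\<in>W. norm (x - y) < d + 1 / real (Suc n)" for n
  proof (rule ccontr)
    assume "\<not> ?thesis"
    then have "d + 1 / real (Suc n) \<le> d"
      unfolding d_def using ne by (subst (2) infdist_def) (auto intro!: cINF_greatest simp: dist_norm not_less)
    then show False by (simp add: field_simps)
  qed
  then obtain Y where Y: "\<And>n. Y n \<in> W" "\<And>n. norm (x - Y n) < d + 1 / real (Suc n)"
    by metis
  have Y_lim: "(\<lambda>n. norm (x - Y n)) \<longlonglongrightarrow> d"
  proof (rule tendsto_sandwich)
    show "\<forall>\<^sub>F n in sequentially. d \<le> norm (x - Y n)"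
      using Y(1) d_le by simp
    show "\<forall>\<^sub>F n in sequentially. norm (x - Y n) \<le> d + 1 / real (Suc n)"
      using Y(2) by (auto intro!: always_eventually less_imp_le)
    show "(\<lambda>n. d + 1 / real (Suc n)) \<longlonglongrightarrow> d"
      using LIMSEQ_inverse_real_of_nat_add[of d] by (simp add: inverse_eq_divide)
  qed simp
  \<comment> \<open>parallelogram law at the midpoint of \<open>Y m\<close> and \<open>Y n\<close>, which lies in \<open>W\<close> too\<close>
  have par: "(norm (Y m - Y n))\<^sup>2 \<le> 2 * ((norm (x - Y m))\<^sup>2 - d\<^sup>2) + 2 * ((norm (x - Y n))\<^sup>2 - d\<^sup>2)" for m n
  proof -
    have "(1/2) *\<^sub>R (Y m + Y n) \<in> W"
      using Y(1) assms(1) by (simp add: subspace_add subspace_scale)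
    from d_le[OF this] have "d\<^sup>2 \<le> (norm (x - (1/2) *\<^sub>R (Y m + Y n)))\<^sup>2"
      using d0 by (intro power_mono) auto
    then show ?thesis
      by (simp add: power2_norm_eq_inner inner_diff inner_add inner_commute algebra_simps)
  qed
  have "Cauchy Y"
  proof (rule metric_CauchyI)
    fix e :: real assume "e > 0"
    have "(\<lambda>n. (norm (x - Y n))\<^sup>2 - d\<^sup>2) \<longlonglongrightarrow> d\<^sup>2 - d\<^sup>2"
      by (intro tendsto_intros Y_lim)
    then have "eventually (\<lambda>n. (norm (x - Y n))\<^sup>2 - d\<^sup>2 < e\<^sup>2 / 4) sequentially"
      by (rule order_tendstoD) (use \<open>e > 0\<close> in auto)
    then obtain N where N: "\<And>n. n \<ge> N \<Longrightarrow> (norm (x - Y n))\<^sup>2 - d\<^sup>2 < e\<^sup>2 / 4"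
      by (auto simp: eventually_sequentially)
    have "dist (Y m) (Y n) < e" if "m \<ge> N" "n \<ge> N" for m n
    proof -
      have "(norm (Y m - Y n))\<^sup>2 < e\<^sup>2"
        using par[of m n] add_strict_mono[OF mult_strict_left_mono[OF N[OF that(1)], of 2]
            mult_strict_left_mono[OF N[OF that(2)], of 2]] by simp
      then show ?thesis using \<open>e > 0\<close> by (simp add: dist_norm power2_less_imp_less)
    qed
    then show "\<exists>N. \<forall>m\<ge>N. \<forall>n\<ge>N. dist (Y m) (Y n) < e" by blast
  qed
  then obtain y where y: "Y \<longlonglongrightarrow> y" using Cauchy_convergent convergent_def by blast
  have yW: "y \<in> W" using closed_sequentially[OF assms(2) Y(1) y] .
  have "(\<lambda>n. norm (x - Y n)) \<longlonglongrightarrow> norm (x - y)" by (intro tendsto_intros y)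
  then have dy: "norm (x - y) = d" using Y_lim LIMSEQ_unique by blast
  have "(x - y) \<bullet> z = 0" if "z \<in> W" for z
  proof (rule ccontr)
    assume nz: "(x - y) \<bullet> z \<noteq> 0"
    then have z0: "z \<bullet> z > 0" by auto
    \<comment> \<open>the step length that minimizes the distance along \<open>z\<close>\<close>
    define c where "c = ((x - y) \<bullet> z) / (z \<bullet> z)"
    have "y + c *\<^sub>R z \<in> W" using yW that assms(1) by (simp add: subspace_add subspace_scale)
    from d_le[OF this] have "d\<^sup>2 \<le> (norm (x - (y + c *\<^sub>R z)))\<^sup>2"
      using d0 by (intro power_mono) auto
    also have "\<dots> = d\<^sup>2 - 2 * c * ((x - y) \<bullet> z) + c\<^sup>2 * (z \<bullet> z)"
      unfolding dy[symmetric]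
      unfolding power2_norm_eq_inner
      by (simp add: inner_diff inner_add inner_commute algebra_simps power2_eq_square)
    also have "\<dots> = d\<^sup>2 - ((x - y) \<bullet> z)\<^sup>2 / (z \<bullet> z)"
      using z0 by (simp add: c_def power2_eq_square field_simps)
    finally show False using nz z0 by (simp add: field_simps) 
  qed
  then show ?thesis using yW by blast
qed

text \<open>
  If \<open>f x \<noteq> 0\<close>, the component of \<open>x\<close> orthogonal to the kernel of \<open>f\<close> is, up to a factor, the representer.
\<close>

lemma ex_riesz_representer:
  fixes f :: "'a::{real_inner, banach} \<Rightarrow> real"
  assumes "bounded_linear f"
  shows "\<exists>u. \<forall>x. f x = x \<bullet> u"
proof (cases "\<forall>x. f x = 0")
  case True
  then show ?thesis by (intro exI[of _ 0]) auto
next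
  case False
  interpret bounded_linear f by fact
  from False obtain x where x: "f x \<noteq> 0" by auto
  define W where "W = {x. f x = 0}"
  have "subspace W" by (auto simp: W_def subspace_def add zero scaleR)
  moreover have "closed W" unfolding W_def
    by (intro closed_Collect_eq linear_continuous_on assms) auto
  ultimately obtain y where y: "y \<in> W" "\<And>z. z \<in> W \<Longrightarrow> (x - y) \<bullet> z = 0"
    using ex_orthogonal_projection[of W x] by blast
  define n where "n = x - y"
  have fn: "f n \<noteq> 0" using x y(1) by (simp add: n_def diff W_def)
  then have n0: "n \<bullet> n > 0" using zero by auto
  have "f z = z \<bullet> ((f n / (n \<bullet> n)) *\<^sub>R n)" for z
  proof -
    have "z - (f z / f n) *\<^sub>R n \<in> W" using fn by (simp add: W_def diff scaleR)
    then have "n \<bullet> (z - (f z / f n) *\<^sub>R n) = 0" using y(2) n_def by blast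
    then have "n \<bullet> z = (f z / f n) * (n \<bullet> n)" by (simp add: inner_diff_right)
    then show ?thesis using fn n0 by (simp add: inner_commute field_simps)
  qed
  then show ?thesis by blast
qed

text \<open>
  The constant \<^const>\<open>adjoint\<close> chooses some map with this property; the Riesz representation
  theorem provides one.
\<close>

lemma inner_adjoint:
  fixes F :: "'a::{real_inner, banach} \<Rightarrow> 'b::real_inner"
  assumes "bounded_linear F"
  shows "F x \<bullet> y = x \<bullet> adjoint F y"
proof -
  have "\<exists>u. \<forall>x. F x \<bullet> y = x \<bullet> u" for y
    by (rule ex_riesz_representer) (rule bounded_linear_compose[OF bounded_linear_inner_left assms])
  then have "\<exists>G. \<forall>x y. F x \<bullet> y = x \<bullet> G y" by metis
  then have "\<forall>x y. F x \<bullet> y = x \<bullet> adjoint F y"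
    unfolding adjoint_def by (rule someI_ex)
  then show ?thesis by blast
qed

lemma subspace_closure:
  fixes W :: "'a::real_normed_vector set"
  assumes "subspace W"
  shows "subspace (closure W)"
  unfolding subspace_def
proof (intro conjI ballI allI)
  show "0 \<in> closure W" using subspace_0[OF assms] closure_subset by blast
next
  fix x y assume "x \<in> closure W" "y \<in> closure W"
  then obtain f g where "\<And>n. f n \<in> W" "f \<longlonglongrightarrow> x" "\<And>n. g n \<in> W" "g \<longlonglongrightarrow> y"
    unfolding closure_sequential by blast
  then have "(\<forall>n. f n + g n \<in> W) \<and> (\<lambda>n. f n + g n) \<longlonglongrightarrow> x + y"
    using assms by (auto intro: subspace_add tendsto_add)
  then show "x + y \<in> closure W" unfolding closure_sequential by (intro exI[of _ "\<lambda>n. f n + g n"])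
next
  fix x c assume "x \<in> closure W"
  then obtain f where "\<And>n. f n \<in> W" "f \<longlonglongrightarrow> x"
    unfolding closure_sequential by blast
  then have "(\<forall>n. c *\<^sub>R f n \<in> W) \<and> (\<lambda>n. c *\<^sub>R f n) \<longlonglongrightarrow> c *\<^sub>R x"
    using assms by (auto intro: subspace_scale tendsto_scaleR)
  then show "c *\<^sub>R x \<in> closure W" unfolding closure_sequential by (intro exI[of _ "\<lambda>n. c *\<^sub>R f n"])
qed

text \<open>
  A maximal orthonormal set, which exists by Zorn's lemma, spans a dense subspace: otherwise the
  projection theorem yields a unit vector orthogonal to it.
\<close>

lemma ex_orthonormal_basis: "\<exists>E::'a::{real_inner, banach} set. orthonormal_basis E"
proof -
  define \<O> where "\<O> = {E::'a set. pairwise orthogonal E \<and> (\<forall>e\<in>E. norm e = 1)}"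
  have "\<exists>E\<in>\<O>. \<forall>X\<in>\<O>. E \<subseteq> X \<longrightarrow> X = E"
  proof (rule subset_Zorn')
    fix \<C> assume "subset.chain \<O> \<C>"
    then have sub: "\<C> \<subseteq> \<O>" and ch: "\<And>A B. A \<in> \<C> \<Longrightarrow> B \<in> \<C> \<Longrightarrow> A \<subseteq> B \<or> B \<subseteq> A"
      by (auto simp: subset_chain_def)
    have "orthogonal a b" if "a \<in> A" "A \<in> \<C>" "b \<in> B" "B \<in> \<C>" "a \<noteq> b" for a b A B
      using ch[OF that(2,4)] sub that unfolding \<O>_def pairwise_def by blast
    then show "\<Union>\<C> \<in> \<O>" using sub by (auto simp: \<O>_def pairwise_def)
  qed
  then obtain E where E: "E \<in> \<O>" and max: "\<And>X. X \<in> \<O> \<Longrightarrow> E \<subseteq> X \<Longrightarrow> X = E" by blast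
  have "x \<in> closure (span E)" for x
  proof (rule ccontr)
    assume x: "x \<notin> closure (span E)"
    have "subspace (closure (span E))" by (rule subspace_closure) simp
    then obtain y where y: "y \<in> closure (span E)" "\<And>z. z \<in> closure (span E) \<Longrightarrow> (x - y) \<bullet> z = 0"
      using ex_orthogonal_projection[of "closure (span E)" x] closed_closure by blast
    define n where "n = sgn (x - y)"
    have ne: "x - y \<noteq> 0" using x y by auto
    have n1: "norm n = 1" using ne by (simp add: n_def norm_sgn)
    have orth: "n \<bullet> e = 0" if "e \<in> E" for e
      using y(2)[of e] that closure_subset span_base by (fastforce simp: n_def sgn_div_norm)
    then have "insert n E \<in> \<O>"
      using E n1 by (auto simp: \<O>_def pairwise_insert orthogonal_def inner_commute)
    then have "n \<in> E" using max by blast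
    with orth[of n] n1 show False by (simp add: norm_eq_1)
  qed
  then show ?thesis using E unfolding orthonormal_basis_def \<O>_def by blast
qed


section \<open>Positive operators and their square roots\<close>

lemma positive_operatorD:
  assumes "positive_operator S"
  shows "bounded_linear S" "S x \<bullet> y = x \<bullet> S y" "0 \<le> S x \<bullet> x"
  using assms unfolding positive_operator_def by blast+

text \<open>
  The quadratic polynomial \<open>t \<mapsto> \<langle>S (x + t y), x + t y\<rangle>\<close> has no negative value.
\<close>

lemma positive_form_Cauchy_Schwarz:
  assumes "positive_operator S"
  shows "(S x \<bullet> y)\<^sup>2 \<le> (S x \<bullet> x) * (S y \<bullet> y)"
proof -
  interpret bounded_linear S using assms by (simp add: positive_operator_def)
  have sym: "S y \<bullet> x = S x \<bullet> y"
    using positive_operatorD(2)[OF assms, of y x] by (simp add: inner_commute)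
  note pos = positive_operatorD(3)[OF assms]
  have q: "0 \<le> S x \<bullet> x + 2 * t * (S x \<bullet> y) + t\<^sup>2 * (S y \<bullet> y)" for t
  proof -
    have "S (x + t *\<^sub>R y) \<bullet> (x + t *\<^sub>R y) = S x \<bullet> x + 2 * t * (S x \<bullet> y) + t\<^sup>2 * (S y \<bullet> y)"
      using sym by (simp add: add scaleR inner_add power2_eq_square algebra_simps)
    then show ?thesis using pos by metis
  qed
  show ?thesis
  proof (cases "S y \<bullet> y = 0")
    case True
    have "S x \<bullet> y = 0"
    proof (rule ccontr)
      assume nz: "S x \<bullet> y \<noteq> 0"
      show False using q[of "- (S x \<bullet> x + 1) / (2 * (S x \<bullet> y))"] nz True by (simp add: field_simps)
    qed
    then show ?thesis using True by simp
  next
    case False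
    then have d: "S y \<bullet> y > 0" using pos[of y] by simp
    have "0 \<le> S x \<bullet> x - (S x \<bullet> y)\<^sup>2 / (S y \<bullet> y)"
      using q[of "- (S x \<bullet> y) / (S y \<bullet> y)"] d by (simp add: power2_eq_square field_simps)
    then show ?thesis using d by (simp add: field_simps)
  qed
qed

lemma norm_le_of_positive_form_le:
  assumes "positive_operator S" "\<And>z. S z \<bullet> z \<le> (norm z)\<^sup>2"
  shows "norm (S x) \<le> norm x"
proof -
  have "((norm (S x))\<^sup>2)\<^sup>2 \<le> (S x \<bullet> x) * (S (S x) \<bullet> S x)"
    using positive_form_Cauchy_Schwarz[OF assms(1), of x "S x"] by (simp add: power2_norm_eq_inner)
  also have "\<dots> \<le> (norm x)\<^sup>2 * (norm (S x))\<^sup>2"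
    using assms(2)[of x] assms(2)[of "S x"] positive_operatorD(3)[OF assms(1), of "S x"]
    by (intro mult_mono) auto
  finally have "(norm (S x))\<^sup>2 * (norm (S x))\<^sup>2 \<le> (norm (S x))\<^sup>2 * (norm x)\<^sup>2"
    by (simp add: power2_eq_square algebra_simps)
  then have "S x \<noteq> 0 \<Longrightarrow> (norm (S x))\<^sup>2 \<le> (norm x)\<^sup>2" by (rule mult_left_le_imp_le) simp
  then show ?thesis by (cases "S x = 0") (auto intro: power2_le_imp_le)
qed

text \<open>
  Everything, linearity and boundedness included, follows from
  \<open>\<langle>F\<^sup>* F x, y\<rangle> = \<langle>F x, F y\<rangle>\<close>.
\<close>

lemma positive_operator_adjoint_comp:
  fixes F :: "'a::{real_inner, banach} \<Rightarrow> 'b::real_inner"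
  assumes "bounded_linear F"
  shows "positive_operator (adjoint F \<circ> F)"
proof -
  interpret F: bounded_linear F by fact
  have eq: "(adjoint F \<circ> F) x \<bullet> y = F x \<bullet> F y" for x y
    using inner_adjoint[OF assms, of y "F x"] by (simp add: inner_commute)
  have uniq: "a = b" if "\<And>z. a \<bullet> z = b \<bullet> z" for a b :: 'a
  proof -
    have "(a - b) \<bullet> (a - b) = 0" using that[of "a - b"] by (simp add: inner_diff_left)
    then show ?thesis by simp
  qed
  obtain c where c: "c > 0" "\<And>x. norm (F x) \<le> norm x * c" using F.pos_bounded by blast
  have "bounded_linear (adjoint F \<circ> F)"
  proof (rule bounded_linear_intro)
    show "(adjoint F \<circ> F) (x + y) = (adjoint F \<circ> F) x + (adjoint F \<circ> F) y" for x y
      by (rule uniq) (simp only: eq inner_add_left F.add)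
    show "(adjoint F \<circ> F) (r *\<^sub>R x) = r *\<^sub>R (adjoint F \<circ> F) x" for x r
      by (rule uniq) (simp only: eq inner_scaleR_left F.scaleR)
    show "norm ((adjoint F \<circ> F) x) \<le> norm x * (c * c)" for x
    proof -
      let ?y = "(adjoint F \<circ> F) x"
      have "norm ?y * norm ?y = F x \<bullet> F ?y" using eq[of x ?y] by (simp only: dot_square_norm power2_eq_square)
      also have "\<dots> \<le> norm (F x) * norm (F ?y)" by (rule norm_cauchy_schwarz)
      also have "\<dots> \<le> (norm x * c) * (norm ?y * c)" by (intro mult_mono c) (auto simp: c less_imp_le)
      finally have "norm ?y * norm ?y \<le> norm ?y * (norm x * (c * c))" by (simp add: algebra_simps)
      then show ?thesis using c by (cases "norm ?y = 0") auto
    qed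
  qed
  moreover have "(adjoint F \<circ> F) x \<bullet> y = x \<bullet> (adjoint F \<circ> F) y" for x y
    using eq[of x y] eq[of y x] inner_commute[of "F x"] inner_commute[of x] by metis
  moreover have "0 \<le> (adjoint F \<circ> F) x \<bullet> x" for x
    unfolding eq by simp
  ultimately show ?thesis unfolding positive_operator_def by blast
qed

text \<open>
  The polynomials in \<open>R\<close> with nonnegative coefficients and without constant term, together with
  their value at 1, the sum of the coefficients. This number bounds the operator norm if
  \<open>\<parallel>R\<parallel> \<le> 1\<close>, and so it reduces the convergence of a sequence of such polynomials to the
  convergence of numbers.
\<close>

inductive nonneg_poly :: "('a::real_normed_vector \<Rightarrow>\<^sub>L 'a) \<Rightarrow> ('a \<Rightarrow>\<^sub>L 'a) \<Rightarrow> real \<Rightarrow> bool"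
  for R where
  base: "nonneg_poly R R 1"
| zero: "nonneg_poly R 0 0"
| add: "nonneg_poly R Y c \<Longrightarrow> nonneg_poly R Z d \<Longrightarrow> nonneg_poly R (Y + Z) (c + d)"
| scale: "nonneg_poly R Y c \<Longrightarrow> 0 \<le> a \<Longrightarrow> nonneg_poly R (a *\<^sub>R Y) (a * c)"
| compose: "nonneg_poly R Y c \<Longrightarrow> nonneg_poly R Z d \<Longrightarrow> nonneg_poly R (Y o\<^sub>L Z) (c * d)"

lemma nonneg_poly_commute:
  assumes "nonneg_poly R Y c" "A o\<^sub>L R = R o\<^sub>L A"
  shows "A o\<^sub>L Y = Y o\<^sub>L A"
  using assms
proof (induction rule: nonneg_poly.induct)
  case (compose Y c Z d)
  then have "\<And>x. A (Y x) = Y (A x)" "\<And>x. A (Z x) = Z (A x)"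
    by (metis blinfun_apply_blinfun_compose)+
  then show ?case by (intro blinfun_eqI) simp
next
  case (add Y c Z d)
  then have "\<And>x. A (Y x) = Y (A x)" "\<And>x. A (Z x) = Z (A x)"
    by (metis blinfun_apply_blinfun_compose)+
  then show ?case by (intro blinfun_eqI) (simp add: blinfun.bilinear_simps)
next
  case (scale Y c a)
  then have "\<And>x. A (Y x) = Y (A x)"
    by (metis blinfun_apply_blinfun_compose)
  then show ?case by (intro blinfun_eqI) (simp add: blinfun.bilinear_simps)
qed auto

lemma nonneg_poly_commute2:
  assumes "nonneg_poly R Y c" "nonneg_poly R Z d"
  shows "Z o\<^sub>L Y = Y o\<^sub>L Z"
  using nonneg_poly_commute[OF assms(1)] nonneg_poly_commute[OF assms(2), of R]
  by simp

lemma norm_nonneg_poly_le: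
  assumes "nonneg_poly R Y c" "norm R \<le> 1"
  shows "norm Y \<le> c"
  using assms
proof (induction rule: nonneg_poly.induct)
  case (add Y c Z d)
  then show ?case using norm_triangle_ineq[of Y Z] by simp
next
  case (compose Y c Z d)
  then have "norm Y * norm Z \<le> c * d"
    using order_trans[OF norm_ge_zero[of Y], of c] by (intro mult_mono) auto
  then show ?case using norm_blinfun_compose[of Y Z] by simp
qed (auto intro: mult_left_mono)

text \<open>
  A product of self-adjoint operators is self-adjoint if they commute, and polynomials in the same
  operator do.
\<close>

lemma nonneg_poly_selfadjoint:
  assumes "nonneg_poly R Y c" "\<And>x y. R x \<bullet> y = x \<bullet> R y"
  shows "Y x \<bullet> y = x \<bullet> Y y"
  using assms
proof (induction arbitrary: x y rule: nonneg_poly.induct)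
  case (compose Y c Z d)
  have "(Z o\<^sub>L Y) y = (Y o\<^sub>L Z) y"
    using nonneg_poly_commute2[OF compose(1,2)] by simp
  then show ?case using compose by simp
qed (auto simp: blinfun.bilinear_simps inner_add)

text \<open>
  The iteration \<open>Y \<mapsto> (R + Y\<^sup>2) / 2\<close>, started at 0, has a limit \<open>L\<close> with \<open>(1 - L)\<^sup>2 = 1 - R\<close>. Its
  increments are polynomials in \<open>R\<close> with nonnegative coefficients, because
  \<open>Y\<^sup>2 - Z\<^sup>2 = (Y + Z) (Y - Z)\<close> for commuting operators. Hence their norms are at most the increments
  of the scalar iteration \<open>c \<mapsto> (1 + c\<^sup>2) / 2\<close>, which increases and stays below 1.
\<close>

lemma ex_positive_sqrt_near_id:
  fixes R :: "'a::{real_inner, banach} \<Rightarrow>\<^sub>L 'a"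
  assumes sa: "\<And>x y. R x \<bullet> y = x \<bullet> R y" and R1: "norm R \<le> 1"
  shows "\<exists>S. positive_operator S \<and> (\<forall>x. S (S x) = x - R x)"
proof -
  define Y :: "nat \<Rightarrow> 'a \<Rightarrow>\<^sub>L 'a" where "Y = rec_nat 0 (\<lambda>_ Y. (1/2) *\<^sub>R (R + (Y o\<^sub>L Y)))"
  define c :: "nat \<Rightarrow> real" where "c = rec_nat 0 (\<lambda>_ c. (1/2) * (1 + c * c))"
  have Y0: "Y 0 = 0" and YS: "\<And>n. Y (Suc n) = (1/2) *\<^sub>R (R + (Y n o\<^sub>L Y n))"
    and c0: "c 0 = 0" and cS: "\<And>n. c (Suc n) = (1/2) * (1 + c n * c n)"
    by (auto simp: Y_def c_def)
  have pY: "nonneg_poly R (Y n) (c n)" for n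
  proof (induction n)
    case 0 then show ?case by (simp add: Y0 c0 nonneg_poly.zero)
  next
    case (Suc n) then show ?case unfolding YS cS
      by (intro nonneg_poly.intros) auto
  qed
  have c01: "0 \<le> c n \<and> c n \<le> 1" for n
  proof (induction n)
    case (Suc n)
    then have "c n * c n \<le> 1 * 1" by (intro mult_mono) auto
    then show ?case using Suc by (simp add: cS)
  qed (simp add: c0)
  have pD: "nonneg_poly R (Y (Suc n) - Y n) (c (Suc n) - c n)" for n
  proof (induction n)
    case 0
    have "nonneg_poly R ((1/2) *\<^sub>R R) (1/2 * 1)" by (intro nonneg_poly.intros) auto
    then show ?case by (simp add: Y0 c0 YS cS)
  next
    case (Suc n)
    have "(Y (Suc n) + Y n) o\<^sub>L (Y (Suc n) - Y n) = (Y (Suc n) o\<^sub>L Y (Suc n)) - (Y n o\<^sub>L Y n)"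
    proof -
      have "Y (Suc n) o\<^sub>L Y n = Y n o\<^sub>L Y (Suc n)"
        by (rule nonneg_poly_commute2[OF pY pY])
      then have "\<And>x. Y (Suc n) (Y n x) = Y n (Y (Suc n) x)"
        by (metis blinfun_apply_blinfun_compose)
      then show ?thesis by (intro blinfun_eqI) (simp add: blinfun.bilinear_simps)
    qed
    then have "Y (Suc (Suc n)) - Y (Suc n) = (1/2) *\<^sub>R ((Y (Suc n) + Y n) o\<^sub>L (Y (Suc n) - Y n))"
      by (simp add: YS[of "Suc n"] scaleR_diff_right[symmetric]) (simp add: YS scaleR_diff_right scaleR_add_right)
    moreover have "c (Suc (Suc n)) - c (Suc n) = (1/2) * ((c (Suc n) + c n) * (c (Suc n) - c n))"
      unfolding cS[of "Suc n"] by (subst (3) cS) (simp add: algebra_simps)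
    ultimately show ?case
      by (simp only:) (intro nonneg_poly.intros pY Suc; simp)
  qed
  have nD: "norm (Y (m + n) - Y n) \<le> c (m + n) - c n" for m n
  proof (induction m)
    case (Suc m)
    have "norm (Y (Suc (m + n)) - Y n) \<le> norm (Y (Suc (m + n)) - Y (m + n)) + norm (Y (m + n) - Y n)"
      by (rule order_trans[OF _ norm_triangle_ineq]) simp
    then show ?case using Suc norm_nonneg_poly_le[OF pD R1, of "m + n"] by simp
  qed simp
  have "incseq c"
  proof (rule incseq_SucI)
    show "c n \<le> c (Suc n)" for n
      using norm_nonneg_poly_le[OF pD R1, of n] norm_ge_zero[of "Y (Suc n) - Y n"] by linarith
  qed
  then obtain l where "c \<longlonglongrightarrow> l" using incseq_convergent[of c 1] c01 by blast
  then have "Cauchy c" by (simp add: LIMSEQ_imp_Cauchy)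
  have "Cauchy Y"
  proof (rule CauchyI')
    fix e :: real assume "e > 0"
    then obtain N where N: "\<forall>m\<ge>N. \<forall>n>m. dist (c m) (c n) < e"
      using \<open>Cauchy c\<close> by (metis Cauchy_altdef)
    have "dist (Y m) (Y n) < e" if "m \<ge> N" "n > m" for m n
    proof -
      have "norm (Y n - Y m) \<le> c n - c m" using nD[of "n - m" m] that by simp
      also have "c n - c m \<le> dist (c m) (c n)" by (simp add: dist_real_def)
      also have "\<dots> < e" using N that by blast
      finally show ?thesis by (simp add: dist_norm norm_minus_commute)
    qed
    then show "\<exists>M. \<forall>m\<ge>M. \<forall>n>m. dist (Y m) (Y n) < e" by blast
  qed
  then have "convergent Y" by (rule Cauchy_convergent)
  then obtain L where L: "Y \<longlonglongrightarrow> L" by (auto simp: convergent_def)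
  have "(\<lambda>n. (1/2) *\<^sub>R (R + (Y n o\<^sub>L Y n))) \<longlonglongrightarrow> (1/2) *\<^sub>R (R + (L o\<^sub>L L))"
    by (intro tendsto_intros bounded_bilinear.tendsto[OF bounded_bilinear_blinfun_compose] L)
  moreover have "(\<lambda>n. Y (Suc n)) \<longlonglongrightarrow> L" using L by (rule LIMSEQ_Suc)
  ultimately have "L = (1/2) *\<^sub>R (R + (L o\<^sub>L L))" unfolding YS by (rule LIMSEQ_unique[rotated])
  then have fixp: "2 *\<^sub>R L x = R x + L (L x)" for x
  proof -
    have "L x = ((1/2) *\<^sub>R (R + (L o\<^sub>L L))) x" using \<open>L = _\<close> by (rule arg_cong)
    then have "2 *\<^sub>R L x = 2 *\<^sub>R (1/2) *\<^sub>R (R x + L (L x))" by (simp add: blinfun.bilinear_simps)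
    then show ?thesis by simp
  qed
  have L1: "norm L \<le> 1"
    by (rule LIMSEQ_le_const2[OF tendsto_norm[OF L]])
      (use norm_nonneg_poly_le[OF pY R1] c01 in \<open>auto intro: order_trans\<close>)
  have Lsa: "L x \<bullet> y = x \<bullet> L y" for x y
  proof (rule LIMSEQ_unique)
    show "(\<lambda>n. Y n x \<bullet> y) \<longlonglongrightarrow> L x \<bullet> y" by (intro tendsto_intros L)
    show "(\<lambda>n. Y n x \<bullet> y) \<longlonglongrightarrow> x \<bullet> L y"
      unfolding nonneg_poly_selfadjoint[OF pY sa] by (intro tendsto_intros L)
  qed
  define S where "S = (\<lambda>x. x - L x)"
  have "positive_operator S"
    unfolding positive_operator_def
  proof (intro conjI allI)
    show "bounded_linear S" unfolding S_def
      by (intro bounded_linear_sub bounded_linear_ident blinfun.bounded_linear_right)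
    show "S x \<bullet> y = x \<bullet> S y" for x y by (simp add: S_def inner_diff Lsa)
    show "0 \<le> S x \<bullet> x" for x
    proof -
      have "L x \<bullet> x \<le> norm (L x) * norm x" by (rule norm_cauchy_schwarz)
      also have "\<dots> \<le> (norm L * norm x) * norm x" by (intro mult_right_mono norm_blinfun) auto
      also have "\<dots> \<le> (1 * norm x) * norm x" using L1 by (intro mult_right_mono) auto
      finally show ?thesis by (simp add: S_def inner_diff dot_square_norm power2_eq_square)
    qed
  qed
  moreover have "S (S x) = x - R x" for x
  proof -
    have "S (S x) = x - 2 *\<^sub>R L x + L (L x)"
      by (simp add: S_def blinfun.bilinear_simps algebra_simps scaleR_2)
    then show ?thesis by (simp add: fixp)
  qed
  ultimately show ?thesis by blast
qed

text \<open>
  For \<open>c \<ge> \<parallel>Q\<parallel>\<close> the operator \<open>1 - Q / c\<close> is positive and bounded by 1, hence a contraction.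
\<close>

lemma ex_positive_sqrt:
  fixes Q :: "'a::{real_inner, banach} \<Rightarrow> 'a"
  assumes "positive_operator Q"
  shows "\<exists>S. positive_operator S \<and> S \<circ> S = Q"
proof -
  interpret Q: bounded_linear Q using assms by (simp add: positive_operator_def)
  have Qsym: "Q x \<bullet> y = x \<bullet> Q y" and Qpos: "0 \<le> Q x \<bullet> x" for x y
    using assms by (auto simp: positive_operator_def)
  obtain c where c: "c > 0" "\<And>x. norm (Q x) \<le> norm x * c" using Q.pos_bounded by blast
  define R where "R = (\<lambda>x. x - (1/c) *\<^sub>R Q x)"
  have bl: "bounded_linear R" unfolding R_def
    by (intro bounded_linear_sub bounded_linear_ident bounded_linear_compose[OF bounded_linear_scaleR_right] Q.bounded_linear_axioms)
  have Rsym: "R x \<bullet> y = x \<bullet> R y" for x y by (simp add: R_def inner_diff Qsym)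
  have Qle: "Q x \<bullet> x \<le> c * (norm x)\<^sup>2" for x
  proof -
    have "Q x \<bullet> x \<le> norm (Q x) * norm x" by (rule norm_cauchy_schwarz)
    also have "\<dots> \<le> (norm x * c) * norm x" by (intro mult_right_mono c) auto
    finally show ?thesis by (simp add: power2_eq_square algebra_simps)
  qed
  have "positive_operator R" unfolding positive_operator_def
    using bl Rsym Qle c by (auto simp: R_def inner_diff field_simps power2_norm_eq_inner)
  then have "norm (R x) \<le> norm x" for x
    by (rule norm_le_of_positive_form_le) (use Qpos c in \<open>simp add: R_def inner_diff power2_norm_eq_inner\<close>)
  then have "norm (Blinfun R) \<le> 1"
    by (intro norm_blinfun_bound) (auto simp: bounded_linear_Blinfun_apply[OF bl])
  then obtain S where S: "positive_operator S" "\<And>x. S (S x) = x - R x"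
    using ex_positive_sqrt_near_id[of "Blinfun R"] Rsym by (auto simp: bounded_linear_Blinfun_apply[OF bl])
  interpret S: bounded_linear S by (rule positive_operatorD(1)) fact
  let ?S = "\<lambda>x. sqrt c *\<^sub>R S x"
  have "positive_operator ?S"
    using S(1) c(1) unfolding positive_operator_def
    by (auto intro: bounded_linear_compose[OF bounded_linear_scaleR_right])
  moreover have "?S \<circ> ?S = Q"
    using c(1) by (auto simp: fun_eq_iff S.scaleR S(2) R_def)
  ultimately show ?thesis by blast
qed

text \<open>
  A positive square root exists, so the choice made by \<^const>\<open>op_sqrt\<close> yields one.
\<close>

lemma op_sqrt:
  fixes Q :: "'a::{real_inner, banach} \<Rightarrow> 'a"
  assumes "positive_operator Q"
  shows "positive_operator (op_sqrt Q)" "op_sqrt Q (op_sqrt Q x) = Q x"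
proof -
  have *: "positive_operator (op_sqrt Q) \<and> op_sqrt Q \<circ> op_sqrt Q = Q"
    unfolding op_sqrt_def using someI_ex[OF ex_positive_sqrt[OF assms]] .
  then show "positive_operator (op_sqrt Q)" "op_sqrt Q (op_sqrt Q x) = Q x"
    by (auto simp: fun_eq_iff)
qed


section \<open>Bessel families and the trace norm\<close>

text \<open>
  The families that satisfy Bessel's inequality. Besides the orthonormal ones these are the
  orthogonal families of vectors of norm at most 1, zero vectors included, and their images under
  contractions.
\<close>

definition bessel_family :: "'i set \<Rightarrow> ('i \<Rightarrow> 'a::real_inner) \<Rightarrow> bool" where
  "bessel_family J y \<longleftrightarrow> finite J \<and> (\<forall>z. (\<Sum>j\<in>J. (y j \<bullet> z)\<^sup>2) \<le> (norm z)\<^sup>2)"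

text \<open>
  Expand \<open>\<parallel>p - z\<parallel>\<^sup>2 \<ge> 0\<close> for \<open>p = \<Sum>\<^sub>j \<langle>y\<^sub>j, z\<rangle> y\<^sub>j\<close>, for which \<open>\<parallel>p\<parallel>\<^sup>2 \<le> \<langle>p, z\<rangle>\<close>.
\<close>

lemma bessel_family_orthogonal:
  assumes "finite J" "\<And>i j. i \<in> J \<Longrightarrow> j \<in> J \<Longrightarrow> i \<noteq> j \<Longrightarrow> y i \<bullet> y j = 0"
    and "\<And>j. j \<in> J \<Longrightarrow> norm (y j) \<le> 1"
  shows "bessel_family J y"
  unfolding bessel_family_def
proof (intro conjI allI assms(1))
  fix z
  let ?p = "\<Sum>j\<in>J. (y j \<bullet> z) *\<^sub>R y j"
  have "?p \<bullet> ?p = (\<Sum>j\<in>J. (y j \<bullet> z)\<^sup>2 * (y j \<bullet> y j))"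
  proof -
    have "?p \<bullet> y j = (y j \<bullet> z) * (y j \<bullet> y j)" if "j \<in> J" for j
    proof -
      have "?p \<bullet> y j = (\<Sum>i\<in>J. if i = j then (y j \<bullet> z) * (y j \<bullet> y j) else 0)"
        unfolding inner_sum_left
      proof (rule sum.cong)
        fix i assume i: "i \<in> J"
        show "((y i \<bullet> z) *\<^sub>R y i) \<bullet> y j = (if i = j then (y j \<bullet> z) * (y j \<bullet> y j) else 0)"
        proof (cases "i = j")
          case False
          show ?thesis using assms(2)[OF i that False] False by simp
        qed simp
      qed simp
      also have "\<dots> = (y j \<bullet> z) * (y j \<bullet> y j)"
        using assms(1) that by simp
      finally show ?thesis .
    qed
    then have "(\<Sum>j\<in>J. (y j \<bullet> z) * (?p \<bullet> y j)) = (\<Sum>j\<in>J. (y j \<bullet> z)\<^sup>2 * (y j \<bullet> y j))"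
      by (intro sum.cong) (simp_all only: power2_eq_square mult.assoc)
    then show ?thesis unfolding inner_sum_right[of ?p] inner_scaleR_right .
  qed
  also have "\<dots> \<le> (\<Sum>j\<in>J. (y j \<bullet> z)\<^sup>2 * 1)"
    using assms(3) by (intro sum_mono mult_left_mono) (auto simp: dot_square_norm power_le_one)
  finally have pp: "?p \<bullet> ?p \<le> (\<Sum>j\<in>J. (y j \<bullet> z)\<^sup>2)" by simp
  have pz: "?p \<bullet> z = (\<Sum>j\<in>J. (y j \<bullet> z)\<^sup>2)" by (simp add: inner_sum_left power2_eq_square)
  have "0 \<le> q \<bullet> q - 2 * (q \<bullet> z) + (norm z)\<^sup>2" for q
    using inner_ge_zero[of "q - z"] by (simp add: inner_diff inner_commute power2_norm_eq_inner)
  from this[of ?p] show "(\<Sum>j\<in>J. (y j \<bullet> z)\<^sup>2) \<le> (norm z)\<^sup>2"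
    using pp unfolding pz by linarith
qed

lemma bessel_family_fst:
  fixes f :: "'i \<Rightarrow> 'a::real_inner"
  assumes "bessel_family J f"
  shows "bessel_family J (\<lambda>j. (f j, 0 :: 'b::real_inner))"
  unfolding bessel_family_def
proof (intro conjI allI)
  show "finite J" using assms by (simp add: bessel_family_def)
  fix z :: "'a \<times> 'b"
  have "(\<Sum>j\<in>J. ((f j, 0) \<bullet> z)\<^sup>2) = (\<Sum>j\<in>J. (f j \<bullet> fst z)\<^sup>2)" by (simp add: inner_prod_def)
  also have "\<dots> \<le> (norm (fst z))\<^sup>2" using assms by (simp add: bessel_family_def)
  also have "\<dots> \<le> (norm z)\<^sup>2" using norm_fst_le[of "fst z" "snd z"] by (intro power_mono) simp_all
  finally show "(\<Sum>j\<in>J. ((f j, 0) \<bullet> z)\<^sup>2) \<le> (norm z)\<^sup>2" .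
qed

text \<open>
  Parseval's identity up to an error: the orthogonal projection of \<open>x\<close> to the span of \<open>A'\<close> is at
  least as close to \<open>x\<close> as a given vector of the span of \<open>A\<close>. All \<open>A'\<close> that contain \<open>A\<close> are
  admitted so that one finite set serves several vectors at once.
\<close>

lemma orthonormal_basis_norm_approx:
  assumes E: "orthonormal_basis E" and "e > 0"
  shows "\<exists>A. finite A \<and> A \<subseteq> E \<and> (\<forall>A'. finite A' \<and> A \<subseteq> A' \<and> A' \<subseteq> E \<longrightarrow>
     (norm x)\<^sup>2 \<le> (\<Sum>a\<in>A'. (x \<bullet> a)\<^sup>2) + e)"
proof -
  have "x \<in> closure (span E)" using E by (simp add: orthonormal_basis_def)
  then obtain y where y: "y \<in> span E" "dist y x < sqrt e"
    using \<open>e > 0\<close> unfolding closure_approachable by (metis real_sqrt_gt_zero)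
  obtain A r where A: "finite A" "A \<subseteq> E" "y = (\<Sum>a\<in>A. r a *\<^sub>R a)"
    using y(1) unfolding span_explicit by auto
  have "(norm x)\<^sup>2 \<le> (\<Sum>a\<in>A'. (x \<bullet> a)\<^sup>2) + e" if A': "finite A'" "A \<subseteq> A'" "A' \<subseteq> E" for A'
  proof -
    define p where "p = (\<Sum>a\<in>A'. (x \<bullet> a) *\<^sub>R a)"
    have on: "a \<bullet> b = (if a = b then 1 else 0)" if "a \<in> A'" "b \<in> A'" for a b
    proof -
      have "a \<in> E" "b \<in> E" using that A'(3) by auto
      then show ?thesis
        using E unfolding orthonormal_basis_def pairwise_def orthogonal_def by (auto simp: norm_eq_1)
    qed
    have pa: "p \<bullet> a = x \<bullet> a" if "a \<in> A'" for a
    proof -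
      have "p \<bullet> a = (\<Sum>b\<in>A'. if b = a then x \<bullet> a else 0)"
        unfolding p_def inner_sum_left using that by (intro sum.cong) (simp_all add: on)
      then show ?thesis using that A'(1) by simp
    qed
    have "(x - p) \<bullet> y = 0"
      unfolding A(3) using pa A'(2) by (auto simp: inner_sum_right inner_diff_left intro!: sum.neutral)
    moreover have "(x - p) \<bullet> p = 0"
      by (subst (2) p_def) (auto simp: inner_sum_right inner_diff_left pa intro!: sum.neutral)
    moreover have "p \<bullet> p = (\<Sum>a\<in>A'. (x \<bullet> a)\<^sup>2)"
      by (subst (2) p_def) (simp add: inner_sum_right pa power2_eq_square)
    moreover have "(norm (x - y))\<^sup>2 \<le> e"
      using y(2) \<open>e > 0\<close> real_sqrt_pow2[of e] power_mono[of "norm (x - y)" "sqrt e" 2]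
      by (simp add: dist_norm norm_minus_commute)
    moreover have "0 \<le> (p - y) \<bullet> (p - y)" by simp
    ultimately show ?thesis
      by (simp add: power2_norm_eq_inner inner_diff inner_commute algebra_simps)
  qed
  then show ?thesis using A by blast
qed

text \<open>
  For \<open>R = \<surd>S\<close>, Parseval's identity gives
  \<open>\<Sum>\<^sub>j \<langle>S y\<^sub>j, y\<^sub>j\<rangle> = \<Sum>\<^sub>j \<parallel>R y\<^sub>j\<parallel>\<^sup>2 = \<Sum>\<^sub>j \<Sum>\<^sub>a \<langle>R y\<^sub>j, a\<rangle>\<^sup>2 = \<Sum>\<^sub>a \<Sum>\<^sub>j \<langle>y\<^sub>j, R a\<rangle>\<^sup>2\<close>, and by Bessel's
  inequality this is at most \<open>\<Sum>\<^sub>a \<parallel>R a\<parallel>\<^sup>2 = \<Sum>\<^sub>a \<langle>S a, a\<rangle>\<close>.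
\<close>

lemma positive_trace_ge_bessel:
  fixes S :: "'a::{real_inner, banach} \<Rightarrow> 'a"
  assumes S: "positive_operator S" and tr: "positive_trace S = ennreal \<tau>" "0 \<le> \<tau>"
    and y: "bessel_family J y"
  shows "(\<Sum>j\<in>J. S (y j) \<bullet> y j) \<le> \<tau>"
proof -
  obtain R where R: "positive_operator R" "R \<circ> R = S" using ex_positive_sqrt[OF S] by blast
  have Rsym: "R x \<bullet> z = x \<bullet> R z" for x z using R by (auto simp: positive_operator_def)
  have SR: "S x \<bullet> x = (norm (R x))\<^sup>2" for x
    using R(2) Rsym[of "R x" x] by (auto simp: power2_norm_eq_inner)
  define E :: "'a set" where "E = (SOME E. orthonormal_basis E)"
  have E: "orthonormal_basis E"
    unfolding E_def by (rule someI_ex) (rule ex_orthonormal_basis)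
  have finle: "(\<Sum>a\<in>A. S a \<bullet> a) \<le> \<tau>" if "finite A" "A \<subseteq> E" for A
  proof -
    have "ennreal (\<Sum>a\<in>A. S a \<bullet> a) = (\<Sum>a\<in>A. ennreal (S a \<bullet> a))"
      using positive_operatorD(3)[OF S] by (simp add: sum_ennreal)
    also have "\<dots> \<le> infsum (\<lambda>a. ennreal (S a \<bullet> a)) E"
      using that by (subst nonneg_infsum_complete) (auto intro!: SUP_upper)
    also have "\<dots> = ennreal \<tau>" using tr(1) by (simp add: positive_trace_def E_def)
    finally show ?thesis using tr(2) by simp
  qed
  have fJ: "finite J" using y by (simp add: bessel_family_def)
  have main: "(\<Sum>j\<in>J. S (y j) \<bullet> y j) \<le> \<tau> + e * card J" if e0: "e > 0" for e :: real
  proof -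
    have "\<exists>A. \<forall>j. finite (A j) \<and> A j \<subseteq> E \<and> (\<forall>A'. finite A' \<and> A j \<subseteq> A' \<and> A' \<subseteq> E \<longrightarrow>
        (norm (R (y j)))\<^sup>2 \<le> (\<Sum>a\<in>A'. (R (y j) \<bullet> a)\<^sup>2) + e)"
      by (rule choice) (rule allI, rule orthonormal_basis_norm_approx[OF E e0])
    then obtain A where A: "\<forall>j. finite (A j) \<and> A j \<subseteq> E \<and> (\<forall>A'. finite A' \<and> A j \<subseteq> A' \<and> A' \<subseteq> E \<longrightarrow>
        (norm (R (y j)))\<^sup>2 \<le> (\<Sum>a\<in>A'. (R (y j) \<bullet> a)\<^sup>2) + e)" ..
    define U where "U = (\<Union>j\<in>J. A j)"
    have U: "finite U" "U \<subseteq> E" "\<And>j. j \<in> J \<Longrightarrow> A j \<subseteq> U" using A fJ by (auto simp: U_def)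
    have "(\<Sum>j\<in>J. S (y j) \<bullet> y j) \<le> (\<Sum>j\<in>J. (\<Sum>a\<in>U. (R (y j) \<bullet> a)\<^sup>2) + e)"
    proof (rule sum_mono)
      fix j assume "j \<in> J"
      then show "S (y j) \<bullet> y j \<le> (\<Sum>a\<in>U. (R (y j) \<bullet> a)\<^sup>2) + e"
        unfolding SR using A U by blast
    qed
    also have "\<dots> = (\<Sum>a\<in>U. \<Sum>j\<in>J. (y j \<bullet> R a)\<^sup>2) + e * card J"
      by (simp add: sum.distrib Rsym sum.swap[of _ J])
    also have "(\<Sum>a\<in>U. \<Sum>j\<in>J. (y j \<bullet> R a)\<^sup>2) \<le> (\<Sum>a\<in>U. S a \<bullet> a)"
      unfolding SR using y by (intro sum_mono) (auto simp: bessel_family_def)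
    also have "\<dots> \<le> \<tau>" using finle U by blast
    finally show ?thesis by simp
  qed
  show ?thesis
  proof (rule field_le_epsilon)
    fix e :: real assume "e > 0"
    then have "(\<Sum>j\<in>J. S (y j) \<bullet> y j) \<le> \<tau> + e / (card J + 1) * card J" by (intro main) auto
    also have "\<dots> \<le> \<tau> + e" using \<open>e > 0\<close> by (simp add: field_simps)
    finally show "(\<Sum>j\<in>J. S (y j) \<bullet> y j) \<le> \<tau> + e" .
  qed
qed

lemma ex_orthonormal_spanning:
  fixes B :: "'a::real_inner set"
  assumes "finite B"
  shows "\<exists>D. finite D \<and> D \<subseteq> span B \<and> (\<forall>d\<in>D. norm d = 1) \<and> pairwise orthogonal D \<and>
    (\<forall>u\<in>span B. u = (\<Sum>d\<in>D. (u \<bullet> d) *\<^sub>R d))"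
proof -
  obtain C where C: "finite C" "span C = span B" "pairwise orthogonal C"
    using basis_orthogonal[OF assms] by blast
  define D where "D = sgn ` (C - {0})"
  have D1: "\<forall>d\<in>D. norm d = 1" by (auto simp: D_def norm_sgn)
  have Dsub: "D \<subseteq> span B" unfolding D_def C(2)[symmetric] by (auto simp: sgn_div_norm span_base span_scale)
  have Dorth: "pairwise orthogonal D"
    using C(3) unfolding D_def pairwise_def orthogonal_def by (auto simp: sgn_div_norm)
  have fD: "finite D" using C(1) by (simp add: D_def)
  have on: "a \<bullet> b = (if a = b then 1 else 0)" if "a \<in> D" "b \<in> D" for a b
    using D1 Dorth that unfolding pairwise_def orthogonal_def by (auto simp: norm_eq_1)
  have "span C \<subseteq> span D"
  proof (rule span_minimal)
    show "C \<subseteq> span D"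
    proof
      fix x assume "x \<in> C"
      show "x \<in> span D"
      proof (cases "x = 0")
        case False
        then have "sgn x \<in> span D" using \<open>x \<in> C\<close> by (auto simp: D_def intro: span_base)
        then have "norm x *\<^sub>R sgn x \<in> span D" by (rule span_scale)
        then show ?thesis using False by (simp add: sgn_div_norm)
      qed (simp add: span_zero)
    qed
  qed simp
  then have sub: "span B \<subseteq> span D" by (simp add: C(2))
  have expand: "u = (\<Sum>d\<in>D. (u \<bullet> d) *\<^sub>R d)" if "u \<in> span D" for u
    using that
  proof (induction rule: span_induct_alt)
    case base then show ?case by simp
  next
    case (step c x y)
    have "(\<Sum>d\<in>D. ((c *\<^sub>R x + y) \<bullet> d) *\<^sub>R d) = c *\<^sub>R (\<Sum>d\<in>D. (x \<bullet> d) *\<^sub>R d) + (\<Sum>d\<in>D. (y \<bullet> d) *\<^sub>R d)"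
      by (simp add: inner_add_left scaleR_add_left sum.distrib scaleR_sum_right)
    also have "(\<Sum>d\<in>D. (x \<bullet> d) *\<^sub>R d) = x"
    proof -
      have "(\<Sum>d\<in>D. (x \<bullet> d) *\<^sub>R d) = (\<Sum>d\<in>D. if d = x then x else 0)"
        using step(1) by (intro sum.cong) (simp_all add: on)
      then show ?thesis using step(1) fD by simp
    qed
    finally show ?case unfolding step(2)[symmetric] by (rule sym)
  qed
  have "\<forall>u\<in>span B. u = (\<Sum>d\<in>D. (u \<bullet> d) *\<^sub>R d)"
    by (intro ballI expand subsetD[OF sub])
  with fD Dsub D1 Dorth show ?thesis by (intro exI[of _ D] conjI)
qed

text \<open>
  This is polar decomposition on the span of the \<open>f\<^sub>j\<close>. For \<open>S = \<bar>F\<bar>\<close> one has \<open>\<parallel>F x\<parallel> = \<parallel>S x\<parallel>\<close>. So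
  if \<open>D\<close> is an orthonormal basis of the span of the \<open>S f\<^sub>j\<close> and \<open>S x\<^sub>d = d\<close>, then \<open>d \<mapsto> F x\<^sub>d\<close> extends
  to an isometry that maps \<open>S f\<^sub>j\<close> to \<open>F f\<^sub>j\<close>. The vectors \<open>y\<^sub>j = \<Sum>\<^sub>d \<langle>F x\<^sub>d, g\<^sub>j\<rangle> d\<close>, the images of the
  \<open>g\<^sub>j\<close> under its adjoint, again satisfy Bessel's inequality, and
  \<open>\<langle>F f\<^sub>j, g\<^sub>j\<rangle> = \<langle>S f\<^sub>j, y\<^sub>j\<rangle> \<le> (\<langle>S f\<^sub>j, f\<^sub>j\<rangle> + \<langle>S y\<^sub>j, y\<^sub>j\<rangle>) / 2\<close>. Both sums are at most the trace of \<open>S\<close>.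
\<close>

lemma bessel_pairing_le_trace_norm:
  fixes F :: "'a::{real_inner, banach} \<Rightarrow> 'b::real_inner"
  assumes tn: "trace_norm F = ennreal \<tau>" "0 \<le> \<tau>"
    and f: "bessel_family J f" and g: "bessel_family J g"
  shows "(\<Sum>j\<in>J. F (f j) \<bullet> g j) \<le> \<tau>"
proof -
  have bl: "bounded_linear F" using tn(1) by (auto simp: trace_norm_def split: if_splits)
  interpret F: bounded_linear F by fact
  define S where "S = op_sqrt (adjoint F \<circ> F)"
  have S: "positive_operator S" and SS: "S (S x) = adjoint F (F x)" for x
    using op_sqrt[OF positive_operator_adjoint_comp[OF bl]] by (auto simp: S_def)
  interpret S: bounded_linear S by (rule positive_operatorD(1)) fact
  have Ssym: "S x \<bullet> z = x \<bullet> S z" for x z using S by (auto simp: positive_operator_def)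
  have nFS: "norm (F x) = norm (S x)" for x
    using Ssym[of x "S x"] inner_adjoint[OF bl, of x "F x"] by (simp add: SS norm_eq_sqrt_inner)
  have ptr: "positive_trace S = ennreal \<tau>" using tn(1) bl by (simp add: trace_norm_def S_def)
  have fJ: "finite J" using f by (simp add: bessel_family_def)
  obtain D where D: "finite D" "D \<subseteq> span (S ` f ` J)" "\<forall>d\<in>D. norm d = 1" "pairwise orthogonal D"
    "\<And>u. u \<in> span (S ` f ` J) \<Longrightarrow> u = (\<Sum>d\<in>D. (u \<bullet> d) *\<^sub>R d)"
    using ex_orthonormal_spanning[of "S ` f ` J"] fJ by auto
  have "\<forall>d\<in>D. \<exists>x. S x = d"
    using D(2) linear_span_image[OF S.linear_axioms, of "f ` J"] by auto
  then obtain x where x: "\<And>d. d \<in> D \<Longrightarrow> S (x d) = d" by metis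
  define y where "y = (\<lambda>j. \<Sum>d\<in>D. (F (x d) \<bullet> g j) *\<^sub>R d)"
  have Ff: "F (f j) \<bullet> g j = S (f j) \<bullet> y j" if "j \<in> J" for j
  proof -
    have Sf: "S (f j) = (\<Sum>d\<in>D. (S (f j) \<bullet> d) *\<^sub>R d)" using that by (intro D(5) span_base) auto
    have "S (f j - (\<Sum>d\<in>D. (S (f j) \<bullet> d) *\<^sub>R x d)) = 0"
      using Sf x by (simp add: S.diff S.sum S.scaleR)
    then have "F (f j - (\<Sum>d\<in>D. (S (f j) \<bullet> d) *\<^sub>R x d)) = 0" using nFS by (metis norm_eq_zero)
    then have "F (f j) = (\<Sum>d\<in>D. (S (f j) \<bullet> d) *\<^sub>R F (x d))" by (simp add: F.diff F.sum F.scaleR)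
    then show ?thesis by (simp add: y_def inner_sum_left inner_sum_right mult.commute)
  qed
  have "bessel_family D (\<lambda>d. d)"
    using D(1,3,4) by (intro bessel_family_orthogonal) (auto simp: pairwise_def orthogonal_def)
  then have Dz: "(\<Sum>d\<in>D. (d \<bullet> z)\<^sup>2) \<le> (norm z)\<^sup>2" for z by (simp add: bessel_family_def)
  have yB: "bessel_family J y"
    unfolding bessel_family_def
  proof (intro conjI allI fJ)
    fix z
    define p where "p = (\<Sum>d\<in>D. (d \<bullet> z) *\<^sub>R x d)"
    have "(\<Sum>j\<in>J. (y j \<bullet> z)\<^sup>2) = (\<Sum>j\<in>J. (g j \<bullet> F p)\<^sup>2)"
      by (simp add: y_def p_def inner_sum_left inner_sum_right F.sum F.scaleR inner_commute mult.commute)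
    also have "\<dots> \<le> (norm (F p))\<^sup>2" using g by (simp add: bessel_family_def)
    also have "\<dots> = (norm (S p))\<^sup>2" by (simp add: nFS)
    also have "S p = (\<Sum>d\<in>D. (d \<bullet> z) *\<^sub>R d)" by (simp add: p_def S.sum S.scaleR x)
    also have "(norm \<dots>)\<^sup>2 = (\<Sum>d\<in>D. (norm ((d \<bullet> z) *\<^sub>R d))\<^sup>2)"
      using D(1,4) by (intro norm_sum_Pythagorean) (auto simp: pairwise_def orthogonal_def)
    also have "\<dots> = (\<Sum>d\<in>D. (d \<bullet> z)\<^sup>2)" using D(3) by simp
    also have "\<dots> \<le> (norm z)\<^sup>2" by (rule Dz)
    finally show "(\<Sum>j\<in>J. (y j \<bullet> z)\<^sup>2) \<le> (norm z)\<^sup>2" .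
  qed
  have young: "S a \<bullet> b \<le> (S a \<bullet> a + S b \<bullet> b) / 2" for a b
  proof -
    have "0 \<le> S (a - b) \<bullet> (a - b)" by (rule positive_operatorD(3)[OF S])
    then show ?thesis using Ssym[of b a] by (simp add: S.diff inner_diff inner_commute)
  qed
  have "(\<Sum>j\<in>J. F (f j) \<bullet> g j) = (\<Sum>j\<in>J. S (f j) \<bullet> y j)" using Ff by simp
  also have "\<dots> \<le> (\<Sum>j\<in>J. (S (f j) \<bullet> f j + S (y j) \<bullet> y j) / 2)" by (intro sum_mono young)
  also have "\<dots> = ((\<Sum>j\<in>J. S (f j) \<bullet> f j) + (\<Sum>j\<in>J. S (y j) \<bullet> y j)) / 2"
    by (simp add: sum.distrib flip: sum_divide_distrib)
  also have "\<dots> \<le> \<tau>"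
    using positive_trace_ge_bessel[OF S ptr tn(2) f] positive_trace_ge_bessel[OF S ptr tn(2) yB] by simp
  finally show ?thesis .
qed

text \<open>
  The trace norm dominates the Hilbert-Schmidt norm. With \<open>\<sigma>\<^sup>2\<close> for the sum on the left, the vectors
  \<open>F f\<^sub>j / \<sigma>\<close> satisfy Bessel's inequality by Cauchy-Schwarz, and pairing them with the \<open>F f\<^sub>j\<close> gives
  \<open>\<sigma>\<close>.
\<close>

lemma bessel_sum_norm_sq_le_trace_norm:
  fixes F :: "'a::{real_inner, banach} \<Rightarrow> 'b::real_inner"
  assumes tn: "trace_norm F = ennreal \<tau>" "0 \<le> \<tau>" and f: "bessel_family J f"
  shows "(\<Sum>j\<in>J. (norm (F (f j)))\<^sup>2) \<le> \<tau>\<^sup>2"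
proof -
  define \<sigma> where "\<sigma> = sqrt (\<Sum>j\<in>J. (norm (F (f j)))\<^sup>2)"
  have \<sigma>2: "(\<Sum>j\<in>J. (norm (F (f j)))\<^sup>2) = \<sigma>\<^sup>2" by (simp add: \<sigma>_def sum_nonneg)
  have fJ: "finite J" using f by (simp add: bessel_family_def)
  show ?thesis
  proof (cases "\<sigma> = 0")
    case False
    then have pos: "\<sigma> > 0" using \<sigma>_def by (simp add: order_less_le sum_nonneg)
    have "bessel_family J (\<lambda>j. F (f j) /\<^sub>R \<sigma>)"
      unfolding bessel_family_def
    proof (intro conjI allI fJ)
      fix z
      have "(\<Sum>j\<in>J. ((F (f j) /\<^sub>R \<sigma>) \<bullet> z)\<^sup>2) = (\<Sum>j\<in>J. (F (f j) \<bullet> z)\<^sup>2) / \<sigma>\<^sup>2"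
        by (simp add: power_mult_distrib divide_simps sum_divide_distrib)
      also have "\<dots> \<le> (\<Sum>j\<in>J. (norm (F (f j)))\<^sup>2 * (norm z)\<^sup>2) / \<sigma>\<^sup>2"
        by (intro divide_right_mono sum_mono) (auto simp: power2_norm_eq_inner Cauchy_Schwarz_ineq)
      also have "\<dots> = (norm z)\<^sup>2" using pos by (simp add: \<sigma>2 flip: sum_distrib_right)
      finally show "(\<Sum>j\<in>J. ((F (f j) /\<^sub>R \<sigma>) \<bullet> z)\<^sup>2) \<le> (norm z)\<^sup>2" .
    qed
    from bessel_pairing_le_trace_norm[OF tn f this]
    have "(\<Sum>j\<in>J. (norm (F (f j)))\<^sup>2) / \<sigma> \<le> \<tau>"
      by (simp add: power2_norm_eq_inner divide_inverse sum_distrib_left mult.commute)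
    then have "\<sigma> \<le> \<tau>" using pos by (simp only: \<sigma>2) (simp add: power2_eq_square)
    then show ?thesis using pos by (simp add: \<sigma>2 power_mono)
  qed (simp add: \<sigma>2)
qed

lemma norm_le_trace_norm:
  fixes F :: "'a::{real_inner, banach} \<Rightarrow> 'b::real_inner"
  assumes tn: "trace_norm F = ennreal \<tau>" "0 \<le> \<tau>"
  shows "norm (F x) \<le> \<tau> * norm x"
proof -
  interpret bounded_linear F using tn(1) by (auto simp: trace_norm_def split: if_splits)
  show ?thesis
  proof (cases "x = 0")
    case False
    have "bessel_family {()} (\<lambda>_. sgn x)"
      by (rule bessel_family_orthogonal) (simp_all add: norm_sgn)
    from bessel_sum_norm_sq_le_trace_norm[OF tn this] have "(norm (F (sgn x)))\<^sup>2 \<le> \<tau>\<^sup>2" by simp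
    then have "norm (F (sgn x)) \<le> \<tau>" by (rule power2_le_imp_le[OF _ tn(2)])
    then have "norm x * norm (F (sgn x)) \<le> norm x * \<tau>" by (rule mult_left_mono) simp
    moreover have "F x = norm x *\<^sub>R F (sgn x)" using False by (simp add: sgn_div_norm scaleR)
    ultimately show ?thesis by (simp add: mult.commute)
  qed (simp add: zero)
qed


section \<open>Completeness of the space of square-integrable functions\<close>

lemma sq_integrable_rep_L2_halfline: "sq_integrable halfline (rep_L2_halfline f)"
  using Quotient3_rep_reflp[OF Quotient3_L2_halfline, of f] by simp

lemma abs_rep_L2_halfline: "abs_L2_halfline (rep_L2_halfline f) = f"
  by (rule Quotient3_abs_rep[OF Quotient3_L2_halfline])

lemma rep_abs_L2_halfline:
  assumes "sq_integrable halfline f"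
  shows "AE t in halfline. rep_L2_halfline (abs_L2_halfline f) t = f t"
  using Quotient3_rep_abs[OF Quotient3_L2_halfline, of f] assms by simp

lemma zero_eq_abs_L2_halfline: "0 = abs_L2_halfline (\<lambda>_. 0)"
  by (rule zero_L2_halfline.abs_eq)

lemma inner_abs_L2_halfline:
  assumes "sq_integrable halfline f" "sq_integrable halfline g"
  shows "abs_L2_halfline f \<bullet> abs_L2_halfline g = (\<integral>t. f t \<bullet> g t \<partial>halfline)"
  using inner_L2_halfline.abs_eq[of f g] assms by simp

lemma minus_abs_L2_halfline:
  assumes "sq_integrable halfline f" "sq_integrable halfline g"
  shows "abs_L2_halfline f - abs_L2_halfline g = abs_L2_halfline (\<lambda>t. f t - g t)"
  using minus_L2_halfline.abs_eq[of f g] assms by simp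

lemma nn_integral_norm_sq_abs_L2_halfline:
  assumes "sq_integrable halfline f"
  shows "(\<integral>\<^sup>+t. ennreal ((norm (f t))\<^sup>2) \<partial>halfline) = ennreal ((norm (abs_L2_halfline f))\<^sup>2)"
proof -
  have "(norm (abs_L2_halfline f))\<^sup>2 = (\<integral>t. (norm (f t))\<^sup>2 \<partial>halfline)"
    using inner_abs_L2_halfline[OF assms assms] by (simp add: power2_norm_eq_inner)
  then show ?thesis
    using assms by (subst nn_integral_eq_integral) (auto simp: sq_integrable_def)
qed

text \<open>
  The series \<open>\<Sum>\<^sub>k 2\<^sup>k \<parallel>d\<^sub>k\<parallel>\<^sup>2\<close> of the increments \<open>d\<^sub>k\<close> has a finite integral, so it converges almost
  everywhere, and \<open>\<parallel>d\<^sub>k\<parallel> \<le> 2\<^sup>k \<parallel>d\<^sub>k\<parallel>\<^sup>2 + 2\<^sup>-\<^sup>k\<close>.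
\<close>

lemma AE_convergent_of_summable_increments:
  fixes g :: "nat \<Rightarrow> 's \<Rightarrow> 'a::{banach, second_countable_topology}"
  assumes meas: "\<And>k. g k \<in> borel_measurable N"
    and small: "\<And>k. (\<integral>\<^sup>+t. ennreal ((norm (g (Suc k) t - g k t))\<^sup>2) \<partial>N) \<le> ennreal ((1/16) ^ k)"
  shows "AE t in N. convergent (\<lambda>k. g k t)"
proof -
  have [measurable]: "g k \<in> borel_measurable N" for k by (rule meas)
  define d where "d = (\<lambda>k t. g (Suc k) t - g k t)"
  have [measurable]: "d k \<in> borel_measurable N" for k by (simp add: d_def)
  have "(\<integral>\<^sup>+t. (\<Sum>k. ennreal (2 ^ k * (norm (d k t))\<^sup>2)) \<partial>N)
      = (\<Sum>k. \<integral>\<^sup>+t. ennreal (2 ^ k * (norm (d k t))\<^sup>2) \<partial>N)"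
    by (rule nn_integral_suminf) simp
  also have "\<dots> \<le> (\<Sum>k. ennreal ((1/8) ^ k))"
  proof (rule suminf_le)
    fix k
    have "(\<integral>\<^sup>+t. ennreal (2 ^ k * (norm (d k t))\<^sup>2) \<partial>N) = ennreal (2 ^ k) * (\<integral>\<^sup>+t. ennreal ((norm (d k t))\<^sup>2) \<partial>N)"
      by (simp add: ennreal_mult nn_integral_cmult)
    also have "\<dots> \<le> ennreal (2 ^ k) * ennreal ((1/16) ^ k)"
      using small by (intro mult_left_mono) (auto simp: d_def)
    also have "\<dots> = ennreal ((1/8) ^ k)"
    proof -
      have "(2::real) ^ k * (1/16) ^ k = (1/8) ^ k"
        by (simp only: power_mult_distrib[symmetric]) simp
      then show ?thesis by (subst ennreal_mult[symmetric]) simp_all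
    qed
    finally show "(\<integral>\<^sup>+t. ennreal (2 ^ k * (norm (d k t))\<^sup>2) \<partial>N) \<le> ennreal ((1/8) ^ k)" .
  qed auto
  also have "\<dots> < \<infinity>"
    by (subst suminf_ennreal2) (auto intro: summable_geometric)
  finally have "AE t in N. (\<Sum>k. ennreal (2 ^ k * (norm (d k t))\<^sup>2)) \<noteq> \<infinity>"
    by (intro nn_integral_PInf_AE) auto
  then show ?thesis
  proof eventually_elim
    case (elim t)
    then have s: "summable (\<lambda>k. 2 ^ k * (norm (d k t))\<^sup>2)"
      by (intro summable_suminf_not_top) auto
    have le: "norm (d k t) \<le> 2 ^ k * (norm (d k t))\<^sup>2 + (1/2) ^ k" for k
    proof -
      have "0 \<le> (2 ^ k * norm (d k t) - 1)\<^sup>2 * (1/2) ^ k" by simp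
      also have "\<dots> = 2 ^ k * (norm (d k t))\<^sup>2 - 2 * norm (d k t) + (1/2) ^ k"
        by (simp add: power2_eq_square algebra_simps power_one_over)
      finally show ?thesis using norm_ge_zero[of "d k t"] by linarith
    qed
    have "summable (\<lambda>k. 2 ^ k * (norm (d k t))\<^sup>2 + (1/2 :: real) ^ k)"
      by (intro summable_add s summable_geometric) simp
    then have "summable (\<lambda>k. d k t)"
      by (rule summable_comparison_test') (rule le)
    then have "convergent (\<lambda>n. \<Sum>k<n. d k t)" by (simp add: summable_iff_convergent)
    moreover have "(\<Sum>k<n. d k t) = g n t - g 0 t" for n using sum_lessThan_telescope[of "\<lambda>k. g k t" n] by (simp only: d_def)
    ultimately have "convergent (\<lambda>n. g n t - g 0 t)" by simp
    then have "convergent (\<lambda>n. (g n t - g 0 t) + g 0 t)" by (intro convergent_add convergent_const)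
    then show ?case by simp
  qed
qed

text \<open>
  The Riesz-Fischer theorem. A subsequence with rapidly decreasing increments converges almost
  everywhere, and by Fatou's lemma the pointwise limit is also its limit in mean square.
\<close>

instance L2_halfline :: ("{real_inner, banach, second_countable_topology}") banach
proof
  fix X :: "nat \<Rightarrow> 'a L2_halfline"
  assume X: "Cauchy X"
  define g where "g = (\<lambda>n. rep_L2_halfline (X n))"
  have sq: "sq_integrable halfline (g n)" for n by (simp add: g_def sq_integrable_rep_L2_halfline)
  have [measurable]: "g n \<in> borel_measurable halfline" for n using sq by (simp add: sq_integrable_def)
  have Xg: "X n = abs_L2_halfline (g n)" for n by (simp add: g_def abs_rep_L2_halfline)
  have diff: "(\<integral>\<^sup>+t. ennreal ((norm (g m t - g n t))\<^sup>2) \<partial>halfline) = ennreal ((norm (X m - X n))\<^sup>2)" for m n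
    unfolding Xg minus_abs_L2_halfline[OF sq sq]
    by (rule nn_integral_norm_sq_abs_L2_halfline[OF sq_integrable_diff[OF sq sq]])
  have "\<exists>N. \<forall>k. \<forall>m\<ge>N k. \<forall>n\<ge>N k. dist (X m) (X n) < (1/4) ^ k"
    using X by (intro choice allI) (auto simp: Cauchy_def)
  then obtain N where N: "\<And>k m n. m \<ge> N k \<Longrightarrow> n \<ge> N k \<Longrightarrow> dist (X m) (X n) < (1/4) ^ k" by blast
  \<comment> \<open>the sum makes \<open>r\<close> strictly increasing while keeping it above each \<open>N k\<close>\<close>
  define r where "r = (\<lambda>k. (\<Sum>i\<le>k. N i) + k)"
  have r: "strict_mono r" by (rule strict_monoI_Suc) (simp add: r_def)
  have rN: "N k \<le> r j" if "k \<le> j" for k j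
    using member_le_sum[of k "{..j}" N] that by (auto simp: r_def)
  have sm: "(norm (X (r j) - X (r k)))\<^sup>2 \<le> (1/16) ^ k" if "k \<le> j" for j k
  proof -
    have "norm (X (r j) - X (r k)) \<le> (1/4) ^ k"
      using N[OF rN[OF that] rN[OF order_refl]] by (simp add: dist_norm)
    then have "(norm (X (r j) - X (r k)))\<^sup>2 \<le> ((1/4) ^ k)\<^sup>2" by (intro power_mono) auto
    also have "((1/4) ^ k)\<^sup>2 = ((1/16)::real) ^ k" by (simp only: power2_eq_square power_mult_distrib[symmetric]) simp
    finally show ?thesis .
  qed
  have conv: "AE t in halfline. convergent (\<lambda>k. g (r k) t)"
    by (rule AE_convergent_of_summable_increments) (auto simp: diff intro: ennreal_leI sm)
  define f where "f = (\<lambda>t. lim (\<lambda>k. g (r k) t))"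
  have [measurable]: "f \<in> borel_measurable halfline"
    unfolding f_def by (rule borel_measurable_lim_metric) simp
  have fk: "(\<integral>\<^sup>+t. ennreal ((norm (f t - g (r k) t))\<^sup>2) \<partial>halfline) \<le> ennreal ((1/16) ^ k)" for k
  proof -
    have "(\<integral>\<^sup>+t. ennreal ((norm (f t - g (r k) t))\<^sup>2) \<partial>halfline)
        = (\<integral>\<^sup>+t. liminf (\<lambda>j. ennreal ((norm (g (r j) t - g (r k) t))\<^sup>2)) \<partial>halfline)"
    proof (rule nn_integral_cong_AE)
      show "AE t in halfline. ennreal ((norm (f t - g (r k) t))\<^sup>2)
          = liminf (\<lambda>j. ennreal ((norm (g (r j) t - g (r k) t))\<^sup>2))"
        using conv
      proof eventually_elim
        case (elim t)
        then have "(\<lambda>j. g (r j) t) \<longlonglongrightarrow> f t" by (simp add: f_def convergent_LIMSEQ_iff)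
        then have "(\<lambda>j. ennreal ((norm (g (r j) t - g (r k) t))\<^sup>2)) \<longlonglongrightarrow> ennreal ((norm (f t - g (r k) t))\<^sup>2)"
          by (intro tendsto_intros)
        from lim_imp_Liminf[OF sequentially_bot this] show ?case by (rule sym)
      qed
    qed
    also have "\<dots> \<le> liminf (\<lambda>j. \<integral>\<^sup>+t. ennreal ((norm (g (r j) t - g (r k) t))\<^sup>2) \<partial>halfline)"
      by (rule nn_integral_liminf) simp
    also have "\<dots> \<le> ennreal ((1/16) ^ k)"
    proof (rule Liminf_le)
      show "\<forall>\<^sub>F j in sequentially. (\<integral>\<^sup>+t. ennreal ((norm (g (r j) t - g (r k) t))\<^sup>2) \<partial>halfline) \<le> ennreal ((1/16) ^ k)"
        unfolding diff using eventually_ge_at_top[of k] by eventually_elim (intro ennreal_leI sm)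
    qed simp
    finally show ?thesis .
  qed
  have sqd: "sq_integrable halfline (\<lambda>t. f t - g (r k) t)" for k
    unfolding sq_integrable_def
  proof
    have "(\<integral>\<^sup>+t. ennreal ((norm (f t - g (r k) t))\<^sup>2) \<partial>halfline) < \<infinity>"
      using fk[of k] by (rule order.strict_trans1) simp
    then show "integrable halfline (\<lambda>t. (norm (f t - g (r k) t))\<^sup>2)"
      by (intro integrableI_bounded) auto
  qed simp
  have sqf: "sq_integrable halfline f"
    using sq_integrable_add[OF sqd[of 0] sq[of "r 0"]] by simp
  define L where "L = abs_L2_halfline f"
  have LX: "norm (X (r k) - L) \<le> (1/4) ^ k" for k
  proof -
    have "ennreal ((norm (L - X (r k)))\<^sup>2) \<le> ennreal ((1/16) ^ k)"
      unfolding L_def Xg minus_abs_L2_halfline[OF sqf sq]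
      using fk[of k] nn_integral_norm_sq_abs_L2_halfline[OF sqd[of k]] by simp
    then have "(norm (L - X (r k)))\<^sup>2 \<le> (1/16) ^ k" by simp
    also have "(1/16) ^ k = ((1/4 :: real) ^ k)\<^sup>2"
      by (simp only: power2_eq_square power_mult_distrib[symmetric]) simp
    finally show ?thesis by (subst norm_minus_commute) (rule power2_le_imp_le, simp_all)
  qed
  have "(\<lambda>k. X (r k) - L) \<longlonglongrightarrow> 0"
    by (rule Lim_null_comparison[where g = "\<lambda>k. (1/4) ^ k"]) (auto simp: LX LIMSEQ_realpow_zero)
  then have "(X \<circ> r) \<longlonglongrightarrow> L" by (simp add: LIM_zero_iff o_def)
  from Cauchy_converges_subseq[OF X r this] show "convergent X" by (rule convergentI)
qed


section \<open>Inequalities of Minkowski and Young\<close>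

lemma ennreal_sqrt_power2: "(ennreal_sqrt x)\<^sup>2 = x"
  by (cases x rule: ennreal_cases) (auto simp: ennreal_sqrt_def ennreal_power)

lemma ennreal_sqrt_of_power2: "ennreal_sqrt (x\<^sup>2) = x"
  by (cases x rule: ennreal_cases) (auto simp: ennreal_sqrt_def ennreal_power)

lemma ennreal_sqrt_mono: "x \<le> y \<Longrightarrow> ennreal_sqrt x \<le> ennreal_sqrt y"
  by (cases x rule: ennreal_cases; cases y rule: ennreal_cases) (auto simp: ennreal_sqrt_def top_unique)

lemma ennreal_sqrt_le_iff: "ennreal_sqrt x \<le> y \<longleftrightarrow> x \<le> y\<^sup>2"
  using ennreal_sqrt_mono[of x "y\<^sup>2"] power_mono_ennreal[of "ennreal_sqrt x" y 2]
  by (auto simp: ennreal_sqrt_power2 ennreal_sqrt_of_power2)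

lemma borel_measurable_ennreal_sqrt [measurable]: "ennreal_sqrt \<in> borel_measurable borel"
  unfolding ennreal_sqrt_def by measurable

text \<open>
  The \<open>L\<^sup>2\<close> norm of a function with values in \<open>[0, \<infinity>]\<close>. Upper bounds for norms of vector-valued
  functions are combined as functions of this kind, before anything is known to be finite.
\<close>

definition L2_ennreal :: "'s measure \<Rightarrow> ('s \<Rightarrow> ennreal) \<Rightarrow> ennreal" where
  "L2_ennreal N f = ennreal_sqrt (\<integral>\<^sup>+x. (f x)\<^sup>2 \<partial>N)"

lemma L2_norm_eq_L2_ennreal: "L2_norm N f = L2_ennreal N (\<lambda>x. ennreal (norm (f x)))"
  by (simp add: L2_norm_def L2_ennreal_def ennreal_power)

lemma L2_ennreal_power2: "(L2_ennreal N f)\<^sup>2 = (\<integral>\<^sup>+x. (f x)\<^sup>2 \<partial>N)"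
  by (simp add: L2_ennreal_def ennreal_sqrt_power2)

lemma L2_ennreal_const:
  assumes "prob_space P"
  shows "L2_ennreal P (\<lambda>_. c) = c"
  using prob_space.emeasure_space_1[OF assms] by (simp add: L2_ennreal_def ennreal_sqrt_of_power2)

lemma L2_ennreal_mono_AE:
  assumes "AE x in N. f x \<le> g x"
  shows "L2_ennreal N f \<le> L2_ennreal N g"
  unfolding L2_ennreal_def
  by (intro ennreal_sqrt_mono nn_integral_mono_AE)
    (use assms in eventually_elim, rule power_mono_ennreal)

lemma L2_ennreal_cmult:
  assumes "f \<in> borel_measurable N"
  shows "L2_ennreal N (\<lambda>x. c * f x) = c * L2_ennreal N f"
proof -
  have "(L2_ennreal N (\<lambda>x. c * f x))\<^sup>2 = (c * L2_ennreal N f)\<^sup>2"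
    using assms by (simp add: L2_ennreal_power2 power_mult_distrib nn_integral_cmult)
  then show ?thesis by (metis ennreal_sqrt_of_power2)
qed

lemma L2_ennreal_triangle:
  assumes [measurable]: "f \<in> borel_measurable N" "g \<in> borel_measurable N"
  shows "L2_ennreal N (\<lambda>x. f x + g x) \<le> L2_ennreal N f + L2_ennreal N g"
proof -
  let ?A = "L2_ennreal N f" and ?B = "L2_ennreal N g"
  have "(\<integral>\<^sup>+x. f x * g x \<partial>N)\<^sup>2 \<le> (?A * ?B)\<^sup>2"
    using Cauchy_Schwarz_nn_integral[OF assms] by (simp add: L2_ennreal_power2 power_mult_distrib)
  then have "(\<integral>\<^sup>+x. f x * g x \<partial>N) \<le> ?A * ?B"
    using ennreal_sqrt_mono by (metis ennreal_sqrt_of_power2)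
  then have "2 * (\<integral>\<^sup>+x. f x * g x \<partial>N) \<le> 2 * (?A * ?B)" by (rule mult_left_mono) simp
  then have "(\<integral>\<^sup>+x. (f x)\<^sup>2 \<partial>N) + 2 * (\<integral>\<^sup>+x. f x * g x \<partial>N) + (\<integral>\<^sup>+x. (g x)\<^sup>2 \<partial>N) \<le> ?A\<^sup>2 + 2 * (?A * ?B) + ?B\<^sup>2"
    unfolding L2_ennreal_power2 by (intro add_mono) auto
  also have "(\<integral>\<^sup>+x. (f x)\<^sup>2 \<partial>N) + 2 * (\<integral>\<^sup>+x. f x * g x \<partial>N) + (\<integral>\<^sup>+x. (g x)\<^sup>2 \<partial>N)
      = (\<integral>\<^sup>+x. (f x + g x)\<^sup>2 \<partial>N)"
    by (simp add: nn_integral_add[symmetric] nn_integral_cmult[symmetric] power2_sum algebra_simps)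
  also have "?A\<^sup>2 + 2 * (?A * ?B) + ?B\<^sup>2 = (?A + ?B)\<^sup>2" by (simp add: power2_sum algebra_simps)
  finally show ?thesis by (simp add: L2_ennreal_def[of N "\<lambda>x. f x + g x"] ennreal_sqrt_le_iff)
qed

lemma L2_ennreal_sum_le:
  assumes "finite I" "\<And>i. i \<in> I \<Longrightarrow> f i \<in> borel_measurable N"
  shows "L2_ennreal N (\<lambda>x. \<Sum>i\<in>I. f i x) \<le> (\<Sum>i\<in>I. L2_ennreal N (f i))"
  using assms
proof (induction I rule: finite_induct)
  case empty
  then show ?case by (simp add: L2_ennreal_def ennreal_sqrt_def)
next
  case (insert i I)
  have "L2_ennreal N (\<lambda>x. f i x + (\<Sum>i\<in>I. f i x)) \<le> L2_ennreal N (f i) + L2_ennreal N (\<lambda>x. \<Sum>i\<in>I. f i x)"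
    using insert by (intro L2_ennreal_triangle borel_measurable_sum) auto
  also have "\<dots> \<le> L2_ennreal N (f i) + (\<Sum>i\<in>I. L2_ennreal N (f i))"
    using insert by (intro add_left_mono) auto
  finally show ?case using insert by simp
qed

lemma nn_integral_reflect:
  fixes g :: "real \<Rightarrow> ennreal"
  assumes "g \<in> borel_measurable borel"
  shows "(\<integral>\<^sup>+s. g (t - s) \<partial>lborel) = (\<integral>\<^sup>+s. g s \<partial>lborel)"
  using nn_integral_real_affine[OF assms, of "-1" t] by simp

text \<open>
  Young's inequality with an additional parameter \<open>w\<close> for the kernel \<open>\<kappa>\<^sup>2\<close>. Cauchy-Schwarz for the
  factors \<open>\<kappa>\<close> and \<open>\<kappa> U\<close> bounds the square of the convolution by \<open>\<parallel>\<kappa>\<^sup>2\<parallel>\<^sub>1 (\<kappa>\<^sup>2 * U\<^sup>2)\<close>, and Tonelli's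
  theorem evaluates the integral of the second factor.
\<close>

lemma young_convolution_L2:
  fixes \<kappa> :: "real \<Rightarrow> ennreal" and U :: "'w \<times> real \<Rightarrow> ennreal"
  assumes "sigma_finite_measure P" and [measurable]: "\<kappa> \<in> borel_measurable borel"
    and U: "U \<in> borel_measurable (P \<Otimes>\<^sub>M restrict_space lborel A)" and A: "A \<in> sets lborel"
  shows "(\<integral>\<^sup>+t. \<integral>\<^sup>+w. (\<integral>\<^sup>+s. (\<kappa> (t - s))\<^sup>2 * U (w, s) \<partial>restrict_space lborel A)\<^sup>2 \<partial>P \<partial>restrict_space lborel A)
    \<le> (\<integral>\<^sup>+r. (\<kappa> r)\<^sup>2 \<partial>lborel)\<^sup>2 * (\<integral>\<^sup>+z. (U z)\<^sup>2 \<partial>(P \<Otimes>\<^sub>M restrict_space lborel A))"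
proof -
  define R where "R = restrict_space (lborel :: real measure) A"
  define L where "L = (\<integral>\<^sup>+r. (\<kappa> r)\<^sup>2 \<partial>lborel)"
  let ?k = "\<lambda>t s. (\<kappa> (t - s))\<^sup>2"
  interpret P: sigma_finite_measure P by fact
  interpret R: sigma_finite_measure R
    unfolding R_def by (rule sigma_finite_measure_restrict_space[OF sigma_finite_lborel A])
  interpret PR: pair_sigma_finite P R ..
  interpret PRR: pair_sigma_finite "P \<Otimes>\<^sub>M R" R
    by (intro pair_sigma_finite.intro PR.sigma_finite_measure_axioms R.sigma_finite_measure_axioms)
  have [measurable]: "U \<in> borel_measurable (P \<Otimes>\<^sub>M R)" using U by (simp add: R_def)
  have idR [measurable]: "(\<lambda>s. s) \<in> borel_measurable R"
    unfolding R_def by (rule measurable_restrict_space1) simp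
  have kR: "(\<integral>\<^sup>+s. ?k t s \<partial>R) \<le> L" "(\<integral>\<^sup>+s. ?k s t \<partial>R) \<le> L" for t
  proof -
    have "(\<integral>\<^sup>+s. ?k t s \<partial>R) \<le> (\<integral>\<^sup>+s. ?k t s \<partial>lborel)"
      unfolding R_def using A by (subst nn_integral_restrict_space) (auto intro!: nn_integral_mono simp: indicator_def)
    also have "\<dots> = L" unfolding L_def by (rule nn_integral_reflect[where g = "\<lambda>r. (\<kappa> r)\<^sup>2"]) simp
    finally show "(\<integral>\<^sup>+s. ?k t s \<partial>R) \<le> L" .
    have "(\<integral>\<^sup>+s. ?k s t \<partial>R) \<le> (\<integral>\<^sup>+s. ?k s t \<partial>lborel)"
      unfolding R_def using A by (subst nn_integral_restrict_space) (auto intro!: nn_integral_mono simp: indicator_def)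
    also have "\<dots> = L" unfolding L_def
      using nn_integral_real_affine[of "\<lambda>r. (\<kappa> r)\<^sup>2" 1 "- t"] by simp
    finally show "(\<integral>\<^sup>+s. ?k s t \<partial>R) \<le> L" .
  qed
  have "(\<integral>\<^sup>+t. \<integral>\<^sup>+w. (\<integral>\<^sup>+s. ?k t s * U (w, s) \<partial>R)\<^sup>2 \<partial>P \<partial>R)
      \<le> (\<integral>\<^sup>+t. \<integral>\<^sup>+w. L * (\<integral>\<^sup>+s. ?k t s * (U (w, s))\<^sup>2 \<partial>R) \<partial>P \<partial>R)"
  proof (intro nn_integral_mono)
    fix t w assume "w \<in> space P"
    then have [measurable]: "(\<lambda>s. U (w, s)) \<in> borel_measurable R" by simp
    have "(\<integral>\<^sup>+s. ?k t s * U (w, s) \<partial>R)\<^sup>2 = (\<integral>\<^sup>+s. \<kappa> (t - s) * (\<kappa> (t - s) * U (w, s)) \<partial>R)\<^sup>2"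
      by (simp add: power2_eq_square mult.assoc)
    also have "\<dots> \<le> (\<integral>\<^sup>+s. ?k t s \<partial>R) * (\<integral>\<^sup>+s. (\<kappa> (t - s) * U (w, s))\<^sup>2 \<partial>R)"
      by (rule Cauchy_Schwarz_nn_integral) simp_all
    also have "\<dots> \<le> L * (\<integral>\<^sup>+s. ?k t s * (U (w, s))\<^sup>2 \<partial>R)"
      using kR(1) by (simp add: power_mult_distrib mult_right_mono)
    finally show "(\<integral>\<^sup>+s. ?k t s * U (w, s) \<partial>R)\<^sup>2 \<le> L * (\<integral>\<^sup>+s. ?k t s * (U (w, s))\<^sup>2 \<partial>R)" .
  qed
  also have "\<dots> = L * (\<integral>\<^sup>+t. \<integral>\<^sup>+w. \<integral>\<^sup>+s. ?k t s * (U (w, s))\<^sup>2 \<partial>R \<partial>P \<partial>R)"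
    by (simp add: nn_integral_cmult)
  also have "(\<integral>\<^sup>+t. \<integral>\<^sup>+w. \<integral>\<^sup>+s. ?k t s * (U (w, s))\<^sup>2 \<partial>R \<partial>P \<partial>R)
      = (\<integral>\<^sup>+t. \<integral>\<^sup>+z. ?k t (snd z) * (U z)\<^sup>2 \<partial>(P \<Otimes>\<^sub>M R) \<partial>R)"
    by (intro nn_integral_cong) (simp add: R.nn_integral_fst[symmetric])
  also have "\<dots> = (\<integral>\<^sup>+z. \<integral>\<^sup>+t. ?k t (snd z) * (U z)\<^sup>2 \<partial>R \<partial>(P \<Otimes>\<^sub>M R))"
    by (rule PRR.Fubini') simp
  also have "\<dots> = (\<integral>\<^sup>+z. (\<integral>\<^sup>+t. ?k t (snd z) \<partial>R) * (U z)\<^sup>2 \<partial>(P \<Otimes>\<^sub>M R))"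
    by (intro nn_integral_cong nn_integral_multc) simp
  also have "\<dots> \<le> (\<integral>\<^sup>+z. L * (U z)\<^sup>2 \<partial>(P \<Otimes>\<^sub>M R))"
    by (intro nn_integral_mono mult_right_mono kR(2)) simp
  also have "\<dots> = L * (\<integral>\<^sup>+z. (U z)\<^sup>2 \<partial>(P \<Otimes>\<^sub>M R))" by (simp add: nn_integral_cmult)
  finally have "(\<integral>\<^sup>+t. \<integral>\<^sup>+w. (\<integral>\<^sup>+s. ?k t s * U (w, s) \<partial>R)\<^sup>2 \<partial>P \<partial>R)
      \<le> L * (L * (\<integral>\<^sup>+z. (U z)\<^sup>2 \<partial>(P \<Otimes>\<^sub>M R)))"
    by (simp add: mult_left_mono)
  then show ?thesis
    unfolding R_def[symmetric] L_def[symmetric] by (simp only: power2_eq_square[of L] mult.assoc)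
qed


section \<open>Covariance of a square-integrable L\'evy process\<close>

text \<open>
  An additive function with nonnegative values is monotone; compare its value at \<open>n t\<close> with those
  at the integers next to \<open>n t\<close>.
\<close>

lemma nonneg_additive_imp_linear:
  fixes q :: "real \<Rightarrow> real"
  assumes nn: "\<And>t. 0 \<le> t \<Longrightarrow> 0 \<le> q t" and add: "\<And>s t. 0 \<le> s \<Longrightarrow> 0 \<le> t \<Longrightarrow> q (s + t) = q s + q t"
    and t: "0 \<le> t"
  shows "q t = t * q 1"
proof -
  have mono: "q a \<le> q b" if "0 \<le> a" "a \<le> b" for a b
    using add[of a "b - a"] nn[of "b - a"] that by simp
  have mult: "q (real n * x) = real n * q x" if "0 \<le> x" for n x
  proof (induction n)
    case 0
    then show ?case using add[of 0 0] by simp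
  next
    case (Suc n)
    then show ?case using add[of x "real n * x"] that by (simp add: algebra_simps)
  qed
  have "\<bar>q t - t * q 1\<bar> \<le> q 1 / real (Suc n)" for n
  proof -
    let ?n = "real (Suc n)"
    define m where "m = nat \<lfloor>?n * t\<rfloor>"
    have nt: "0 \<le> ?n * t" using t by simp
    then have m: "real m \<le> ?n * t" "?n * t \<le> real (Suc m)" unfolding m_def by linarith+
    have "real m * q 1 \<le> ?n * q t" using mono[OF _ m(1)] mult[of 1 m] mult[OF t, of "Suc n"] by simp
    moreover have "?n * q t \<le> real (Suc m) * q 1" using mono[OF nt m(2)] mult[of 1 "Suc m"] mult[OF t, of "Suc n"] by simp
    moreover have "real m * q 1 \<le> ?n * t * q 1" "?n * t * q 1 \<le> real (Suc m) * q 1"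
      using m nn[of 1] by (auto intro: mult_right_mono)
    ultimately have "\<bar>?n * q t - ?n * t * q 1\<bar> \<le> q 1"
      by (simp add: abs_le_iff algebra_simps)
    then have "\<bar>?n * (q t - t * q 1)\<bar> \<le> q 1" by (simp add: right_diff_distrib mult.assoc)
    then have "?n * \<bar>q t - t * q 1\<bar> \<le> q 1" by (simp add: abs_mult)
    then show ?thesis by (simp add: field_simps)
  qed
  moreover have "(\<lambda>n. q 1 / real (Suc n)) \<longlonglongrightarrow> 0"
    using tendsto_mult_right[OF LIMSEQ_inverse_real_of_nat, of "q 1"] by (simp add: divide_inverse mult.commute)
  ultimately have "\<bar>q t - t * q 1\<bar> \<le> 0" by (intro LIMSEQ_le_const[of _ 0]) auto
  then show ?thesis by simp
qed

locale square_integrable_levy = prob_space P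
  for P :: "'w measure" and M :: "real \<Rightarrow> 'w \<Rightarrow> real^'d" +
  assumes levy: "levy_process P M"
    and sq_integrable_levy: "0 \<le> t \<Longrightarrow> sq_integrable P (M t)"
    and mean_zero: "0 \<le> t \<Longrightarrow> (\<integral>w. M t w \<partial>P) = 0"
begin

lemma measurable_levy [measurable]: "0 \<le> t \<Longrightarrow> M t \<in> borel_measurable P"
  using levy by (simp add: levy_process_def)

lemma sq_integrable_inner_levy:
  assumes "0 \<le> t"
  shows "sq_integrable P (\<lambda>w. z \<bullet> M t w)"
  unfolding sq_integrable_def
proof
  have [measurable]: "M t \<in> borel_measurable P" using assms by simp
  show "(\<lambda>w. z \<bullet> M t w) \<in> borel_measurable P" by simp
  show "integrable P (\<lambda>w. (norm (z \<bullet> M t w))\<^sup>2)"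
  proof (rule Bochner_Integration.integrable_bound[where f = "\<lambda>w. (norm z)\<^sup>2 * (norm (M t w))\<^sup>2"])
    show "integrable P (\<lambda>w. (norm z)\<^sup>2 * (norm (M t w))\<^sup>2)"
      using sq_integrable_levy[OF assms] by (simp add: sq_integrable_def)
    show "AE w in P. norm ((norm (z \<bullet> M t w))\<^sup>2) \<le> norm ((norm z)\<^sup>2 * (norm (M t w))\<^sup>2)"
    proof (rule AE_I2)
      fix w
      have "\<bar>z \<bullet> M t w\<bar>\<^sup>2 \<le> (norm z * norm (M t w))\<^sup>2" by (intro power_mono Cauchy_Schwarz_ineq2) simp
      then show "norm ((norm (z \<bullet> M t w))\<^sup>2) \<le> norm ((norm z)\<^sup>2 * (norm (M t w))\<^sup>2)"
        by (simp add: power_mult_distrib)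
    qed
  qed simp
qed

lemma integrable_inner_prod:
  assumes "0 \<le> s" "0 \<le> t"
  shows "integrable P (\<lambda>w. (z \<bullet> M s w) * (z' \<bullet> M t w))"
  using sq_integrable_inner[OF sq_integrable_inner_levy[OF assms(1), of z] sq_integrable_inner_levy[OF assms(2), of z']]
  by simp

lemma integrable_inner_levy:
  assumes "0 \<le> t"
  shows "integrable P (\<lambda>w. z \<bullet> M t w)"
  by (rule square_integrable_imp_integrable)
    (use sq_integrable_inner_levy[OF assms, of z] in \<open>auto simp: sq_integrable_def\<close>)

lemma integrable_levy:
  assumes "0 \<le> t"
  shows "integrable P (M t)"
proof -
  have [measurable]: "M t \<in> borel_measurable P" using assms by simp
  have "integrable P (\<lambda>w. norm (M t w))"
    by (rule square_integrable_imp_integrable)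
      (use sq_integrable_levy[OF assms] in \<open>auto simp: sq_integrable_def\<close>)
  then show ?thesis by (rule integrable_norm_cancel) simp
qed

lemma mean_inner_levy: "0 \<le> t \<Longrightarrow> (\<integral>w. z \<bullet> M t w \<partial>P) = 0"
  using integrable_levy mean_zero by simp

text \<open>
  Up to a null set \<open>M\<^sub>s\<close> is the increment from 0 to \<open>s\<close>, and this is independent of the next
  increment, which has mean 0.
\<close>

lemma uncorrelated_increment:
  assumes "0 \<le> s" "s \<le> t"
  shows "(\<integral>w. (z \<bullet> M s w) * (z' \<bullet> (M t w - M s w)) \<partial>P) = 0"
proof -
  \<comment> \<open>the times 0, \<open>s\<close>, \<open>t\<close>, \<open>t\<close>, ...: two increments, from 0 to \<open>s\<close> and from \<open>s\<close> to \<open>t\<close>\<close>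
  define \<tau> where "\<tau> = (\<lambda>n::nat. if n = 0 then 0 else if n = 1 then s else t)"
  have "0 \<le> \<tau> 0 \<and> incseq \<tau>" using assms by (auto simp: \<tau>_def incseq_def)
  then have ind: "indep_vars (\<lambda>_. borel) (\<lambda>i w. M (\<tau> (Suc i)) w - M (\<tau> i) w) {..<2}"
    using levy unfolding levy_process_def by blast
  define Y where "Y = (\<lambda>(i::nat) x. (if i = 0 then z else z') \<bullet> (x :: real^'d))"
  have "indep_vars (\<lambda>_. borel) (\<lambda>i w. Y i (M (\<tau> (Suc i)) w - M (\<tau> i) w)) {..<2}"
    by (rule indep_vars_compose2[OF ind]) (simp add: Y_def)
  moreover have "integrable P (\<lambda>w. Y i (M (\<tau> (Suc i)) w - M (\<tau> i) w))" for i
    using assms by (auto simp: Y_def \<tau>_def inner_diff_right intro!: Bochner_Integration.integrable_diff integrable_inner_levy)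
  ultimately have "(\<integral>w. (\<Prod>i<2. Y i (M (\<tau> (Suc i)) w - M (\<tau> i) w)) \<partial>P)
      = (\<Prod>i<2. \<integral>w. Y i (M (\<tau> (Suc i)) w - M (\<tau> i) w) \<partial>P)"
    by (intro indep_vars_lebesgue_integral) auto
  also have "\<dots> = 0"
    using assms by (simp add: numeral_2_eq_2 Y_def \<tau>_def inner_diff_right mean_inner_levy integrable_inner_levy)
  also have "(\<integral>w. (\<Prod>i<2. Y i (M (\<tau> (Suc i)) w - M (\<tau> i) w)) \<partial>P) = (\<integral>w. (z \<bullet> M s w) * (z' \<bullet> (M t w - M s w)) \<partial>P)"
  proof (rule integral_cong_AE)
    have "AE w in P. M 0 w = 0" using levy by (simp add: levy_process_def)
    then show "AE w in P. (\<Prod>i<2. Y i (M (\<tau> (Suc i)) w - M (\<tau> i) w)) = (z \<bullet> M s w) * (z' \<bullet> (M t w - M s w))"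
      by eventually_elim (simp add: numeral_2_eq_2 Y_def \<tau>_def)
    have [measurable]: "M s \<in> borel_measurable P" "M t \<in> borel_measurable P" "M 0 \<in> borel_measurable P"
      using assms by auto
    show "(\<lambda>w. \<Prod>i<2. Y i (M (\<tau> (Suc i)) w - M (\<tau> i) w)) \<in> borel_measurable P"
      by (simp add: numeral_2_eq_2 Y_def \<tau>_def)
    show "(\<lambda>w. z \<bullet> M s w * (z' \<bullet> (M t w - M s w))) \<in> borel_measurable P" by simp
  qed
  finally show ?thesis .
qed

lemma covariance_eq_min:
  assumes "0 \<le> s" "0 \<le> t"
  shows "(\<integral>w. (z \<bullet> M s w) * (z' \<bullet> M t w) \<partial>P) = (\<integral>w. (z \<bullet> M (min s t) w) * (z' \<bullet> M (min s t) w) \<partial>P)"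
proof -
  have *: "(\<integral>w. (z \<bullet> M s w) * (z' \<bullet> M t w) \<partial>P) = (\<integral>w. (z \<bullet> M s w) * (z' \<bullet> M s w) \<partial>P)"
    if "0 \<le> s" "s \<le> t" for s t z z'
    using uncorrelated_increment[OF that, of z z'] that
    by (simp add: inner_diff_right right_diff_distrib integrable_inner_prod)
  show ?thesis
  proof (cases "s \<le> t")
    case True
    then show ?thesis using *[OF assms(1) True, of z z'] by (simp only: min_absorb1)
  next
    case False
    then have ts: "t \<le> s" by simp
    show ?thesis using *[OF assms(2) ts, of z' z] by (simp only: min_absorb2[OF ts] mult.commute)
  qed
qed

text \<open>
  Uncorrelated stationary increments make the variance additive in time.
\<close>

lemma variance_linear:
  assumes "0 \<le> t"
  shows "(\<integral>w. (z \<bullet> M t w)\<^sup>2 \<partial>P) = t * (\<integral>w. (z \<bullet> M 1 w)\<^sup>2 \<partial>P)"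
proof (rule nonneg_additive_imp_linear[OF _ _ assms])
  fix s t :: real assume st: "0 \<le> s" "0 \<le> t"
  have [measurable]: "M s \<in> borel_measurable P" "M t \<in> borel_measurable P" "M (s + t) \<in> borel_measurable P"
    using st by auto
  let ?D = "\<lambda>w. M (s + t) w - M s w"
  have "distr P borel ?D = distr P borel (M (s + t - s))"
    using levy st unfolding levy_process_def by (meson le_add_same_cancel1)
  then have "(\<integral>x. (z \<bullet> x)\<^sup>2 \<partial>distr P borel ?D) = (\<integral>x. (z \<bullet> x)\<^sup>2 \<partial>distr P borel (M t))" by simp
  then have D2: "(\<integral>w. (z \<bullet> ?D w)\<^sup>2 \<partial>P) = (\<integral>w. (z \<bullet> M t w)\<^sup>2 \<partial>P)"
    by (subst (asm) (1 2) integral_distr) auto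
  have cr: "(\<integral>w. (z \<bullet> M s w) * (z \<bullet> ?D w) \<partial>P) = 0" by (rule uncorrelated_increment) (use st in auto)
  have i1: "integrable P (\<lambda>w. (z \<bullet> M s w)\<^sup>2)" using integrable_inner_prod[of s s z z] st by (simp add: power2_eq_square)
  have i2: "integrable P (\<lambda>w. (z \<bullet> M s w) * (z \<bullet> ?D w))"
    using st by (simp add: inner_diff_right right_diff_distrib integrable_inner_prod)
  have "integrable P (\<lambda>w. (z \<bullet> M (s + t) w) * (z \<bullet> ?D w))" 
    using st by (simp add: inner_diff_right right_diff_distrib integrable_inner_prod)
  then have i3: "integrable P (\<lambda>w. (z \<bullet> ?D w)\<^sup>2)"
    using Bochner_Integration.integrable_diff[OF _ i2] by (simp add: inner_diff_right power2_eq_square left_diff_distrib)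
  have "(\<integral>w. (z \<bullet> M (s + t) w)\<^sup>2 \<partial>P)
      = (\<integral>w. (z \<bullet> M s w)\<^sup>2 + 2 * ((z \<bullet> M s w) * (z \<bullet> ?D w)) + (z \<bullet> ?D w)\<^sup>2 \<partial>P)"
    by (intro Bochner_Integration.integral_cong) (auto simp: inner_diff_right power2_eq_square algebra_simps)
  also have "\<dots> = (\<integral>w. (z \<bullet> M s w)\<^sup>2 \<partial>P) + 2 * 0 + (\<integral>w. (z \<bullet> M t w)\<^sup>2 \<partial>P)"
    using i1 i2 i3 by (simp add: cr D2)
  finally show "(\<integral>w. (z \<bullet> M (s + t) w)\<^sup>2 \<partial>P) = (\<integral>w. (z \<bullet> M s w)\<^sup>2 \<partial>P) + (\<integral>w. (z \<bullet> M t w)\<^sup>2 \<partial>P)" by simp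
qed simp

text \<open>
  Polarization of the variances, which are linear in time.
\<close>

abbreviation cov :: "real^'d \<Rightarrow> real^'d \<Rightarrow> real" where
  "cov z z' \<equiv> \<integral>w. (z \<bullet> M 1 w) * (z' \<bullet> M 1 w) \<partial>P"

lemma covariance:
  assumes "0 \<le> s" "0 \<le> t"
  shows "(\<integral>w. (z \<bullet> M s w) * (z' \<bullet> M t w) \<partial>P) = min s t * cov z z'"
proof -
  let ?q = "\<lambda>z r. \<integral>w. (z \<bullet> M r w)\<^sup>2 \<partial>P" and ?b = "\<lambda>r. \<integral>w. (z \<bullet> M r w) * (z' \<bullet> M r w) \<partial>P"
  have pol: "?b r
      = (?q (z + z') r - ?q z r - ?q z' r) / 2"
    if "0 \<le> r" for r
  proof -
    have i: "integrable P (\<lambda>w. (z \<bullet> M r w)\<^sup>2)" for z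
      using integrable_inner_prod[of r r z z] that by (simp add: power2_eq_square)
    have "?q (z + z') r
        = (\<integral>w. (z \<bullet> M r w)\<^sup>2 + 2 * ((z \<bullet> M r w) * (z' \<bullet> M r w)) + (z' \<bullet> M r w)\<^sup>2 \<partial>P)"
      by (intro Bochner_Integration.integral_cong) (auto simp: inner_add_left power2_eq_square algebra_simps)
    also have "\<dots> = ?q z r + 2 * ?b r + ?q z' r"
      using i integrable_inner_prod[of r r z z'] that by simp
    finally show ?thesis by simp
  qed
  have "0 \<le> min s t" using assms by simp
  show ?thesis
    unfolding covariance_eq_min[OF assms] pol[OF \<open>0 \<le> min s t\<close>] pol[OF zero_le_one]
      variance_linear[OF \<open>0 \<le> min s t\<close>]
    by (simp only: right_diff_distrib times_divide_eq_right)
qed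

text \<open>
  For \<open>a \<le> b\<close> and \<open>c \<le> d\<close>, the length of the intersection of the two intervals is
  \<open>min b d - min b c - min a d + min a c\<close>.
\<close>

lemma increment_covariance:
  assumes "0 \<le> a" "a \<le> b" "0 \<le> c" "c \<le> d"
  shows "(\<integral>w. (z \<bullet> (M b w - M a w)) * (z' \<bullet> (M d w - M c w)) \<partial>P)
    = measure lborel ({a<..b} \<inter> {c<..d}) * cov z z'"
    and "integrable P (\<lambda>w. (z \<bullet> (M b w - M a w)) * (z' \<bullet> (M d w - M c w)))"
proof -
  let ?g = "\<lambda>w. (z \<bullet> (M b w - M a w)) * (z' \<bullet> (M d w - M c w))"
  have nn: "0 \<le> b" "0 \<le> d" using assms by auto
  let ?f = "\<lambda>s t w. (z \<bullet> M s w) * (z' \<bullet> M t w)"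
  have eq: "?g = (\<lambda>w. ?f b d w - ?f b c w - ?f a d w + ?f a c w)"
    by (auto simp: fun_eq_iff inner_diff_right algebra_simps)
  have i: "integrable P (?f b d)" "integrable P (?f b c)" "integrable P (?f a d)" "integrable P (?f a c)"
    using assms nn by (auto intro: integrable_inner_prod)
  show "integrable P ?g"
    unfolding eq using i by simp
  have "{a<..b} \<inter> {c<..d} = {max a c<..min b d}" by auto
  then have m: "measure lborel ({a<..b} \<inter> {c<..d}) = min b d - min b c - min a d + min a c"
    using assms by (cases "max a c \<le> min b d") (auto simp: min_def max_def split: if_splits)
  show "(\<integral>w. ?g w \<partial>P)
    = measure lborel ({a<..b} \<inter> {c<..d}) * cov z z'"
  proof -
    have "(\<integral>w. ?f b d w - ?f b c w - ?f a d w + ?f a c w \<partial>P)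
        = (\<integral>w. ?f b d w \<partial>P) - (\<integral>w. ?f b c w \<partial>P) - (\<integral>w. ?f a d w \<partial>P) + (\<integral>w. ?f a c w \<partial>P)"
      using i by simp
    also have "\<dots> = (min b d - min b c - min a d + min a c) * cov z z'"
      unfolding covariance[OF nn(1,2)] covariance[OF nn(1) assms(3)] covariance[OF assms(1) nn(2)]
        covariance[OF assms(1,3)]
      by (simp only: left_diff_distrib distrib_right)
    finally show ?thesis unfolding eq m .
  qed
qed

end


section \<open>Wiener integrals\<close>

lemma borel_measurable_blinfun_apply [measurable (raw)]:
  fixes L :: "'a::real_normed_vector \<Rightarrow>\<^sub>L 'b::real_normed_vector"
  assumes "f \<in> borel_measurable N"
  shows "(\<lambda>x. L (f x)) \<in> borel_measurable N"
  using assms by (rule measurable_compose)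
    (rule borel_measurable_continuous_onI[OF linear_continuous_on[OF blinfun.bounded_linear_right]])

lemma borel_measurable_blinfun_eval:
  fixes F :: "'s \<Rightarrow> 'a::real_normed_vector \<Rightarrow>\<^sub>L 'b::real_normed_vector"
  assumes "F \<in> borel_measurable N"
  shows "(\<lambda>x. F x z) \<in> borel_measurable N"
  using assms by (rule measurable_compose)
    (rule borel_measurable_continuous_onI[OF linear_continuous_on[OF blinfun.bounded_linear_left]])

lemma axis_inner: "axis i 1 \<bullet> x = x $ i" for x :: "real^'n"
  by (simp add: inner_axis')

lemma vec_eq_sum_axis: "x = (\<Sum>i\<in>UNIV. (axis i 1 \<bullet> x) *\<^sub>R axis i 1)" for x :: "real^'n"
  unfolding axis_inner by (simp add: vec_eq_iff axis_def if_distrib cong: if_cong)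

lemma inner_eq_sum_axis: "x \<bullet> y = (\<Sum>i\<in>UNIV. (axis i 1 \<bullet> x) * (axis i 1 \<bullet> y))" for x y :: "real^'n"
  unfolding axis_inner by (simp add: inner_vec_def)

lemma blinfun_inner_eq_sum_axis:
  fixes \<Phi> \<Psi> :: "(real^'n) \<Rightarrow>\<^sub>L 'h::real_inner"
  shows "\<Phi> x \<bullet> \<Psi> y = (\<Sum>i\<in>UNIV. \<Sum>j\<in>UNIV. (\<Phi> (axis i 1) \<bullet> \<Psi> (axis j 1)) * ((axis i 1 \<bullet> x) * (axis j 1 \<bullet> y)))"
proof -
  have \<Phi>: "\<Phi> x = (\<Sum>i\<in>UNIV. (axis i 1 \<bullet> x) *\<^sub>R \<Phi> (axis i 1))"
    by (subst vec_eq_sum_axis) (simp only: blinfun.sum_right blinfun.scaleR_right)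
  have \<Psi>: "\<Psi> y = (\<Sum>j\<in>UNIV. (axis j 1 \<bullet> y) *\<^sub>R \<Psi> (axis j 1))"
    by (subst vec_eq_sum_axis) (simp only: blinfun.sum_right blinfun.scaleR_right)
  show ?thesis
    unfolding \<Phi> \<Psi> inner_sum_left
    by (intro sum.cong refl) (simp only: inner_sum_right inner_scaleR_left inner_scaleR_right sum_distrib_left mult_ac)
qed

text \<open>
  Both sides are the Hilbert-Schmidt inner product of \<open>\<Phi> S\<close> and \<open>\<Psi> S\<close>.
\<close>

lemma sum_axis_selfadjoint:
  fixes \<Phi> \<Psi> :: "(real^'n) \<Rightarrow>\<^sub>L 'h::real_inner" and S :: "real^'n \<Rightarrow> real^'n"
  assumes "\<And>x y. S x \<bullet> y = x \<bullet> S y"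
  shows "(\<Sum>i\<in>UNIV. \<Sum>j\<in>UNIV. (\<Phi> (axis i 1) \<bullet> \<Psi> (axis j 1)) * (S (axis i 1) \<bullet> S (axis j 1)))
    = (\<Sum>r\<in>UNIV. \<Phi> (S (axis r 1)) \<bullet> \<Psi> (S (axis r 1)))"
proof -
  let ?c = "\<lambda>i j. \<Phi> (axis i 1) \<bullet> \<Psi> (axis j 1)"
  have "(\<Sum>r\<in>UNIV. \<Phi> (S (axis r 1)) \<bullet> \<Psi> (S (axis r 1)))
      = (\<Sum>r\<in>UNIV. \<Sum>i\<in>UNIV. \<Sum>j\<in>UNIV. ?c i j * ((axis i 1 \<bullet> S (axis r 1)) * (axis j 1 \<bullet> S (axis r 1))))"
    by (intro sum.cong refl) (rule blinfun_inner_eq_sum_axis)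
  also have "\<dots> = (\<Sum>i\<in>UNIV. \<Sum>r\<in>UNIV. \<Sum>j\<in>UNIV. ?c i j * ((axis i 1 \<bullet> S (axis r 1)) * (axis j 1 \<bullet> S (axis r 1))))"
    by (rule sum.swap)
  also have "\<dots> = (\<Sum>i\<in>UNIV. \<Sum>j\<in>UNIV. \<Sum>r\<in>UNIV. ?c i j * ((axis i 1 \<bullet> S (axis r 1)) * (axis j 1 \<bullet> S (axis r 1))))"
    by (rule sum.cong[OF refl]) (rule sum.swap)
  also have "\<dots> = (\<Sum>i\<in>UNIV. \<Sum>j\<in>UNIV. \<Sum>r\<in>UNIV. ?c i j * ((axis r 1 \<bullet> S (axis i 1)) * (axis r 1 \<bullet> S (axis j 1))))"
  proof -
    have e: "axis i 1 \<bullet> S (axis r 1) = axis r 1 \<bullet> S (axis i 1)" for i r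
      using assms[of "axis i 1" "axis r 1"] by (simp only: inner_commute)
    show ?thesis by (intro sum.cong refl arg_cong2[where f = "(*)"] e)
  qed
  also have "\<dots> = (\<Sum>i\<in>UNIV. \<Sum>j\<in>UNIV. ?c i j * (S (axis i 1) \<bullet> S (axis j 1)))"
    by (simp only: sum_distrib_left[symmetric] inner_eq_sum_axis[symmetric])
  finally show ?thesis by (rule sym)
qed

lemma norm_sum_scaleR_sq:
  fixes u :: "'i \<Rightarrow> 'h::real_inner"
  shows "(norm (\<Sum>i\<in>J. c i *\<^sub>R u i))\<^sup>2 = (\<Sum>i\<in>J. \<Sum>j\<in>J. c i * c j * (u i \<bullet> u j))"
proof -
  have "(norm (\<Sum>i\<in>J. c i *\<^sub>R u i))\<^sup>2 = (\<Sum>i\<in>J. (c i *\<^sub>R u i) \<bullet> (\<Sum>j\<in>J. c j *\<^sub>R u j))"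
    unfolding power2_norm_eq_inner by (rule inner_sum_left)
  also have "\<dots> = (\<Sum>i\<in>J. \<Sum>j\<in>J. (c i *\<^sub>R u i) \<bullet> (c j *\<^sub>R u j))"
    by (intro sum.cong refl inner_sum_right)
  finally show ?thesis by (simp only: inner_scaleR_left inner_scaleR_right mult_ac)
qed

text \<open>
  With respect to the operator norm \<open>s \<mapsto> D s\<close> is not assumed to be measurable, so a constant cannot
  be moved in front of the integral of \<open>\<parallel>D s\<parallel>\<^sup>2\<close>. The factor \<open>\<parallel>z\<parallel>\<close> is therefore separated while
  the integrand is still \<open>\<parallel>D s z\<parallel>\<close>, by passing to the unit vector in the direction of \<open>z\<close>.
\<close>

lemma L2_ennreal_blinfun_eval_le:
  fixes D :: "'s \<Rightarrow> 'a::real_normed_vector \<Rightarrow>\<^sub>L 'b::{real_normed_vector, second_countable_topology}"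
  assumes meas: "\<And>z. (\<lambda>s. indicator A s *\<^sub>R D s z) \<in> borel_measurable N"
    and le: "(\<integral>\<^sup>+s\<in>A. ennreal ((norm (D s))\<^sup>2) \<partial>N) \<le> (ennreal e)\<^sup>2"
  shows "L2_ennreal N (\<lambda>s. ennreal (norm (indicator A s *\<^sub>R D s z))) \<le> ennreal (norm z * e)"
proof (cases "z = 0")
  case True
  then show ?thesis by (simp add: L2_ennreal_def ennreal_sqrt_def blinfun.zero_right)
next
  case False
  let ?f = "\<lambda>s. indicator A s *\<^sub>R D s (sgn z)"
  have [measurable]: "?f \<in> borel_measurable N" by (rule meas)
  have z: "D s z = norm z *\<^sub>R D s (sgn z)" for s
    using False by (simp add: sgn_div_norm blinfun.scaleR_right)
  have "L2_ennreal N (\<lambda>s. ennreal (norm (indicator A s *\<^sub>R D s z)))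
      = L2_ennreal N (\<lambda>s. ennreal (norm z) * ennreal (norm (?f s)))"
    by (simp add: z ennreal_mult[symmetric] mult_ac)
  also have "\<dots> = ennreal (norm z) * L2_ennreal N (\<lambda>s. ennreal (norm (?f s)))"
    by (rule L2_ennreal_cmult) measurable
  also have "L2_ennreal N (\<lambda>s. ennreal (norm (?f s))) \<le> ennreal e"
    unfolding L2_ennreal_def ennreal_sqrt_le_iff
  proof (rule order_trans[OF nn_integral_mono le])
    fix s
    have "norm (D s (sgn z)) \<le> norm (D s)"
      by (rule order_trans[OF norm_blinfun]) (simp add: norm_sgn)
    then show "(ennreal (norm (?f s)))\<^sup>2 \<le> ennreal ((norm (D s))\<^sup>2) * indicator A s"
      by (auto simp: ennreal_power indicator_def intro!: ennreal_leI power_mono)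
  qed
  finally show ?thesis by (simp add: ennreal_mult' mult_left_mono)
qed

context square_integrable_levy
begin

abbreviation covariance_sqrt :: "real^'d \<Rightarrow> real^'d" where
  "covariance_sqrt \<equiv> op_sqrt (\<lambda>z. second_moment P M *v z)"

lemma second_moment_inner:
  "(second_moment P M *v z) \<bullet> z' = cov z z'"
proof -
  have i: "integrable P (\<lambda>w. M 1 w $ i * M 1 w $ j)" for i j
    using integrable_inner_prod[of 1 1 "axis i 1" "axis j 1"] by (simp add: axis_inner)
  have "(cov z z')
      = (\<integral>w. (\<Sum>i\<in>UNIV. \<Sum>j\<in>UNIV. z' $ i * z $ j * (M 1 w $ i * M 1 w $ j)) \<partial>P)"
  proof -
    have "(z' \<bullet> M 1 w) * (z \<bullet> M 1 w) = (\<Sum>i\<in>UNIV. \<Sum>j\<in>UNIV. z' $ i * z $ j * (M 1 w $ i * M 1 w $ j))" for w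
      unfolding inner_vec_def inner_real_def sum_product
      by (intro sum.cong refl) (simp only: mult_ac)
    then show ?thesis by (subst mult.commute) (simp only:)
  qed
  also have "\<dots> = (\<Sum>i\<in>UNIV. \<Sum>j\<in>UNIV. z' $ i * z $ j * (\<integral>w. M 1 w $ i * M 1 w $ j \<partial>P))"
    using i by simp
  also have "\<dots> = (second_moment P M *v z) \<bullet> z'"
    unfolding inner_vec_def inner_real_def matrix_vector_mult_def second_moment_def
    by (simp only: vec_lambda_beta sum_distrib_right) (intro sum.cong refl, simp only: mult_ac)
  finally show ?thesis by (rule sym)
qed

lemma positive_operator_second_moment: "positive_operator (\<lambda>z. second_moment P M *v z)"
  unfolding positive_operator_def
proof (intro conjI allI)
  show "bounded_linear ((*v) (second_moment P M))" by (rule matrix_vector_mul_bounded_linear)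
  show "(second_moment P M *v x) \<bullet> y = x \<bullet> (second_moment P M *v y)" for x y
    by (subst inner_commute[of x]) (simp only: second_moment_inner mult.commute)
  show "0 \<le> (second_moment P M *v x) \<bullet> x" for x
    by (simp add: second_moment_inner)
qed

lemma covariance_sqrt_inner:
  "covariance_sqrt z \<bullet> covariance_sqrt z' = cov z z'"
  using op_sqrt(2)[OF positive_operator_second_moment, of z] second_moment_inner[of z z']
    positive_operatorD(2)[OF op_sqrt(1)[OF positive_operator_second_moment], of "covariance_sqrt z" z']
  by simp

lemma increment_pairing:
  fixes \<Phi> \<Psi> :: "(real^'d) \<Rightarrow>\<^sub>L 'h::{real_inner, banach, second_countable_topology}"
  assumes "0 \<le> a" "a \<le> b" "0 \<le> c" "c \<le> d"
  shows "(\<integral>w. \<Phi> (M b w - M a w) \<bullet> \<Psi> (M d w - M c w) \<partial>P)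
    = measure lborel ({a<..b} \<inter> {c<..d}) * (\<Sum>r\<in>UNIV. \<Phi> (covariance_sqrt (axis r 1)) \<bullet> \<Psi> (covariance_sqrt (axis r 1)))"
    and "integrable P (\<lambda>w. \<Phi> (M b w - M a w) \<bullet> \<Psi> (M d w - M c w))"
proof -
  let ?f = "\<lambda>w. \<Phi> (M b w - M a w) \<bullet> \<Psi> (M d w - M c w)"
  note i = increment_covariance(2)[OF assms]
  have eq: "?f = (\<lambda>w. \<Sum>p\<in>UNIV. \<Sum>q\<in>UNIV.
      (\<Phi> (axis p 1) \<bullet> \<Psi> (axis q 1)) * ((axis p 1 \<bullet> (M b w - M a w)) * (axis q 1 \<bullet> (M d w - M c w))))"
    by (rule ext) (rule blinfun_inner_eq_sum_axis)
  show "integrable P ?f"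
    unfolding eq by (intro Bochner_Integration.integrable_sum integrable_mult_right i)
  have "(\<integral>w. ?f w \<partial>P)
    = (\<Sum>p\<in>UNIV. \<Sum>q\<in>UNIV. (\<Phi> (axis p 1) \<bullet> \<Psi> (axis q 1)) *
        (\<integral>w. (axis p 1 \<bullet> (M b w - M a w)) * (axis q 1 \<bullet> (M d w - M c w)) \<partial>P))"
    unfolding eq by (simp only: Bochner_Integration.integral_sum Bochner_Integration.integrable_sum
        integrable_mult_right integral_mult_right_zero i)
  also have "\<dots> = measure lborel ({a<..b} \<inter> {c<..d}) *
      (\<Sum>p\<in>UNIV. \<Sum>q\<in>UNIV. (\<Phi> (axis p 1) \<bullet> \<Psi> (axis q 1)) * (covariance_sqrt (axis p 1) \<bullet> covariance_sqrt (axis q 1)))"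
    unfolding increment_covariance(1)[OF assms] covariance_sqrt_inner
    by (simp only: sum_distrib_left mult_ac)
  also have "\<dots> = measure lborel ({a<..b} \<inter> {c<..d}) * (\<Sum>r\<in>UNIV. \<Phi> (covariance_sqrt (axis r 1)) \<bullet> \<Psi> (covariance_sqrt (axis r 1)))"
    by (subst sum_axis_selfadjoint) (auto intro: positive_operatorD(2) op_sqrt(1) positive_operator_second_moment)
  finally show "(\<integral>w. ?f w \<partial>P)
    = measure lborel ({a<..b} \<inter> {c<..d}) * (\<Sum>r\<in>UNIV. \<Phi> (covariance_sqrt (axis r 1)) \<bullet> \<Psi> (covariance_sqrt (axis r 1)))" .
qed

text \<open>
  The intervals need not form a partition. So the difference of two integrals of step functions over
  different partitions is of this form as well, and common refinements are avoided.
\<close>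

lemma ito_isometry:
  fixes \<Phi> :: "'i \<Rightarrow> (real^'d) \<Rightarrow>\<^sub>L 'h::{real_inner, banach, second_countable_topology}"
  assumes J: "finite J" and ab: "\<And>i. i \<in> J \<Longrightarrow> 0 \<le> a i" "\<And>i. i \<in> J \<Longrightarrow> a i \<le> b i"
  shows "(\<integral>\<^sup>+w. ennreal ((norm (\<Sum>i\<in>J. \<Phi> i (M (b i) w - M (a i) w)))\<^sup>2) \<partial>P)
    = (\<integral>\<^sup>+s. ennreal (\<Sum>r\<in>UNIV. (norm (\<Sum>i\<in>J. indicator {a i<..b i} s *\<^sub>R \<Phi> i (covariance_sqrt (axis r 1))))\<^sup>2) \<partial>lborel)"
proof -
  let ?D = "\<lambda>i w. M (b i) w - M (a i) w"
  let ?S = "\<lambda>r. covariance_sqrt (axis r 1)"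
  let ?V = "\<lambda>i j. \<Sum>r\<in>UNIV. \<Phi> i (?S r) \<bullet> \<Phi> j (?S r)"
  let ?I = "\<lambda>i j. {a i<..b i} \<inter> {a j<..b j}"
  let ?n = "\<lambda>s. \<Sum>r\<in>UNIV. (norm (\<Sum>i\<in>J. indicator {a i<..b i} s *\<^sub>R \<Phi> i (?S r)))\<^sup>2"
  let ?sum = "\<Sum>i\<in>J. \<Sum>j\<in>J. measure lborel (?I i j) * ?V i j"
  have eq1: "(norm (\<Sum>i\<in>J. \<Phi> i (?D i w)))\<^sup>2 = (\<Sum>i\<in>J. \<Sum>j\<in>J. \<Phi> i (?D i w) \<bullet> \<Phi> j (?D j w))" for w
    by (simp only: power2_norm_eq_inner inner_sum_left inner_sum_right) (rule sum.swap)
  have eq2: "?n s = (\<Sum>i\<in>J. \<Sum>j\<in>J. indicator (?I i j) s * ?V i j)" for s :: real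
  proof -
    have "?n s = (\<Sum>r\<in>UNIV. \<Sum>i\<in>J. \<Sum>j\<in>J. indicator (?I i j) s * (\<Phi> i (?S r) \<bullet> \<Phi> j (?S r)))"
      by (simp only: norm_sum_scaleR_sq indicator_inter_arith)
    also have "\<dots> = (\<Sum>i\<in>J. \<Sum>j\<in>J. \<Sum>r\<in>UNIV. indicator (?I i j) s * (\<Phi> i (?S r) \<bullet> \<Phi> j (?S r)))"
      by (rule trans[OF sum.swap]) (rule sum.cong[OF refl], rule sum.swap)
    finally show ?thesis by (simp only: sum_distrib_left)
  qed
  have i1: "integrable P (\<lambda>w. \<Phi> i (?D i w) \<bullet> \<Phi> j (?D j w))"
    and e1: "(\<integral>w. \<Phi> i (?D i w) \<bullet> \<Phi> j (?D j w) \<partial>P) = measure lborel (?I i j) * ?V i j"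
    if "i \<in> J" "j \<in> J" for i j
    using increment_pairing[OF ab(1)[OF that(1)] ab(2)[OF that(1)] ab(1)[OF that(2)] ab(2)[OF that(2)]] by auto
  have ind: "integrable lborel (indicator (?I i j) :: real \<Rightarrow> real)" for i j
  proof -
    have "?I i j = {max (a i) (a j)<..min (b i) (b j)}" by auto
    then show ?thesis
      by (cases "max (a i) (a j) \<le> min (b i) (b j)") (auto simp: integrable_indicator_iff)
  qed
  have i2: "integrable lborel (\<lambda>s. indicator (?I i j) s * ?V i j)" for i j
    using ind by (rule integrable_mult_left)
  have e2: "(\<integral>s. indicator (?I i j) s * ?V i j \<partial>lborel)
      = measure lborel (?I i j) * ?V i j" for i j
    by (simp only: integral_mult_left_zero Bochner_Integration.integral_indicator space_lborel space_borel Int_UNIV_right)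
  have "(\<integral>\<^sup>+w. ennreal ((norm (\<Sum>i\<in>J. \<Phi> i (?D i w)))\<^sup>2) \<partial>P) = ennreal ?sum"
  proof (subst nn_integral_eq_integral)
    show "integrable P (\<lambda>w. (norm (\<Sum>i\<in>J. \<Phi> i (?D i w)))\<^sup>2)"
      unfolding eq1 by (intro Bochner_Integration.integrable_sum i1)
    have "(\<integral>w. (norm (\<Sum>i\<in>J. \<Phi> i (?D i w)))\<^sup>2 \<partial>P) = ?sum"
      unfolding eq1 by (simp add: Bochner_Integration.integral_sum Bochner_Integration.integrable_sum i1 e1 cong: sum.cong)
    then show "ennreal (\<integral>w. (norm (\<Sum>i\<in>J. \<Phi> i (?D i w)))\<^sup>2 \<partial>P) = ennreal ?sum"
      by (rule arg_cong)
  qed simp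
  also have "\<dots> = (\<integral>\<^sup>+s. ennreal (?n s) \<partial>lborel)"
  proof (subst nn_integral_eq_integral)
    show "integrable lborel ?n"
      unfolding eq2 by (intro Bochner_Integration.integrable_sum i2)
    have "(\<integral>s. ?n s \<partial>lborel) = ?sum"
      unfolding eq2
      by (subst Bochner_Integration.integral_sum, intro Bochner_Integration.integrable_sum i2,
          subst Bochner_Integration.integral_sum, rule i2, subst e2, rule refl)
    then show "ennreal ?sum
        = ennreal (\<integral>s. ?n s \<partial>lborel)"
      by (rule arg_cong[OF sym])
  qed (simp add: sum_nonneg)
  finally show ?thesis .
qed

text \<open>
  Both integrals are approximated by integrals of step functions. The isometry holds for the
  difference of the latter, and the triangle inequality leads back to the integrands.
\<close>

lemma wiener_integral_difference_bound:
  fixes C :: "'x::{real_inner, banach, second_countable_topology} \<Rightarrow>\<^sub>L 'h::{real_inner, banach, second_countable_topology}"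
    and C' :: "'y::{real_inner, banach, second_countable_topology} \<Rightarrow>\<^sub>L 'h"
  assumes W: "has_wiener_integral P M F t I" and W': "has_wiener_integral P M F' t I'"
  shows "L2_norm P (\<lambda>w. C (I w) - C' (I' w))
    \<le> L2_ennreal lborel (\<lambda>s. ennreal (indicator {0..t} s *
        L2_set (\<lambda>r. norm (C (F s (covariance_sqrt (axis r 1))) - C' (F' s (covariance_sqrt (axis r 1))))) UNIV))"
    (is "?L \<le> ?R")
proof (rule ennreal_le_epsilon)
  fix \<epsilon> :: real assume "\<epsilon> > 0"
  let ?S = "\<lambda>r. covariance_sqrt (axis r 1)"
  \<comment> \<open>\<open>e\<close> is the accuracy of the approximations, \<open>e * Q\<close> the resulting error\<close>
  define Q where "Q = norm C + norm C' + (\<Sum>r\<in>UNIV. norm C * norm (?S r) + norm C' * norm (?S r))"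
  have Q0: "Q \<ge> 0" by (simp add: Q_def sum_nonneg)
  define e where "e = \<epsilon> / (Q + 1)"
  have e0: "e > 0" using \<open>\<epsilon> > 0\<close> Q0 by (simp add: e_def)
  have eQ: "e * Q \<le> \<epsilon>" using \<open>\<epsilon> > 0\<close> Q0 by (simp add: e_def field_simps)
  have choose: "\<exists>n \<tau> \<Phi>. mono \<tau> \<and> range \<tau> \<subseteq> {0..t} \<and>
      (\<integral>\<^sup>+s\<in>{0..t}. ennreal ((norm (G s - step_function n \<tau> \<Phi> s))\<^sup>2) \<partial>lborel) \<le> (ennreal e)\<^sup>2 \<and>
      (\<integral>\<^sup>+w. ennreal ((norm (Y w - step_integral M n \<tau> \<Phi> w))\<^sup>2) \<partial>P) \<le> (ennreal e)\<^sup>2"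
    if GY: "has_wiener_integral P M G t Y" for G :: "real \<Rightarrow> (real^'d) \<Rightarrow>\<^sub>L 'z::real_normed_vector" and Y
  proof -
    obtain n \<tau> \<Phi> where m: "\<forall>j. mono (\<tau> j) \<and> range (\<tau> j) \<subseteq> {0..t}"
      and l1: "(\<lambda>j. \<integral>\<^sup>+s\<in>{0..t}. ennreal ((norm (G s - step_function (n j) (\<tau> j) (\<Phi> j) s))\<^sup>2) \<partial>lborel) \<longlonglongrightarrow> 0"
      and l2: "(\<lambda>j. \<integral>\<^sup>+w. ennreal ((norm (Y w - step_integral M (n j) (\<tau> j) (\<Phi> j) w))\<^sup>2) \<partial>P) \<longlonglongrightarrow> 0"
      using GY unfolding has_wiener_integral_def by blast
    have "(0::ennreal) < (ennreal e)\<^sup>2" using e0 by (simp add: ennreal_power)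
    from eventually_conj[OF order_tendstoD(2)[OF l1 this] order_tendstoD(2)[OF l2 this]]
    obtain j where j: "(\<integral>\<^sup>+s\<in>{0..t}. ennreal ((norm (G s - step_function (n j) (\<tau> j) (\<Phi> j) s))\<^sup>2) \<partial>lborel) < (ennreal e)\<^sup>2"
      "(\<integral>\<^sup>+w. ennreal ((norm (Y w - step_integral M (n j) (\<tau> j) (\<Phi> j) w))\<^sup>2) \<partial>P) < (ennreal e)\<^sup>2"
      by (auto simp: eventually_sequentially)
    then show ?thesis using m by (intro exI[of _ "n j"] exI[of _ "\<tau> j"] exI[of _ "\<Phi> j"]) (auto intro: less_imp_le)
  qed
  obtain n \<tau> \<Phi> where \<tau>: "mono \<tau>" "range \<tau> \<subseteq> {0..t}"
    and a1: "(\<integral>\<^sup>+s\<in>{0..t}. ennreal ((norm (F s - step_function n \<tau> \<Phi> s))\<^sup>2) \<partial>lborel) \<le> (ennreal e)\<^sup>2"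
    and a2: "(\<integral>\<^sup>+w. ennreal ((norm (I w - step_integral M n \<tau> \<Phi> w))\<^sup>2) \<partial>P) \<le> (ennreal e)\<^sup>2"
    using choose[OF W] by blast
  obtain n' \<tau>' \<Phi>' where \<tau>': "mono \<tau>'" "range \<tau>' \<subseteq> {0..t}"
    and a1': "(\<integral>\<^sup>+s\<in>{0..t}. ennreal ((norm (F' s - step_function n' \<tau>' \<Phi>' s))\<^sup>2) \<partial>lborel) \<le> (ennreal e)\<^sup>2"
    and a2': "(\<integral>\<^sup>+w. ennreal ((norm (I' w - step_integral M n' \<tau>' \<Phi>' w))\<^sup>2) \<partial>P) \<le> (ennreal e)\<^sup>2"
    using choose[OF W'] by blast
  have [measurable]: "I \<in> borel_measurable P" "I' \<in> borel_measurable P"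
    using W W' by (auto simp: has_wiener_integral_def)
  have \<tau>pos: "0 \<le> \<tau> i" "0 \<le> \<tau>' i" "\<tau> i \<le> t" "\<tau>' i \<le> t" for i
  proof -
    have "\<tau> i \<in> {0..t}" "\<tau>' i \<in> {0..t}" using \<tau>(2) \<tau>'(2) by blast+
    then show "0 \<le> \<tau> i" "0 \<le> \<tau>' i" "\<tau> i \<le> t" "\<tau>' i \<le> t" by auto
  qed
  have [measurable]: "M (\<tau> i) \<in> borel_measurable P" "M (\<tau>' i) \<in> borel_measurable P" for i
    using \<tau>pos by auto
  define st where "st = step_integral M n \<tau> \<Phi>"
  define st' where "st' = step_integral M n' \<tau>' \<Phi>'"
  have [measurable]: "st \<in> borel_measurable P" "st' \<in> borel_measurable P"
    unfolding st_def st'_def step_integral_def by measurable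
  define X where "X = (\<lambda>w. C (st w) - C' (st' w))"
  have [measurable]: "X \<in> borel_measurable P" by (simp add: X_def)
  let ?C = "ennreal (norm C)" and ?C' = "ennreal (norm C')" and ?X = "\<lambda>w. ennreal (norm (X w))"
  let ?dI = "\<lambda>w. ennreal (norm (I w - st w))" and ?dI' = "\<lambda>w. ennreal (norm (I' w - st' w))"

  \<comment> \<open>replacing the stochastic integrals by those of the step functions\<close>
  have b2: "L2_ennreal P ?dI \<le> ennreal e"
    using a2 by (simp add: L2_ennreal_def ennreal_sqrt_le_iff st_def ennreal_power)
  have b2': "L2_ennreal P ?dI' \<le> ennreal e"
    using a2' by (simp add: L2_ennreal_def ennreal_sqrt_le_iff st'_def ennreal_power)
  have "?L \<le> L2_ennreal P (\<lambda>w. ?X w + (?C * ?dI w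
      + ?C' * ?dI' w))"
    unfolding L2_norm_eq_L2_ennreal
  proof (rule L2_ennreal_mono_AE, rule AE_I2)
    fix w
    have "C (I w) - C' (I' w) = X w + C (I w - st w) - C' (I' w - st' w)"
      by (simp add: X_def blinfun.diff_right)
    then have "norm (C (I w) - C' (I' w)) \<le> norm (X w) + norm (C (I w - st w)) + norm (C' (I' w - st' w))"
      using norm_triangle_ineq4[of "X w + C (I w - st w)" "C' (I' w - st' w)"]
        norm_triangle_ineq[of "X w" "C (I w - st w)"] by simp
    also have "\<dots> \<le> norm (X w) + (norm C * norm (I w - st w) + norm C' * norm (I' w - st' w))"
      using norm_blinfun[of C "I w - st w"] norm_blinfun[of C' "I' w - st' w"] by simp
    finally show "ennreal (norm (C (I w) - C' (I' w))) \<le> ?X w +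
        (?C * ?dI w + ?C' * ?dI' w)"
      by (simp add: ennreal_mult[symmetric] ennreal_plus[symmetric] ennreal_leI del: ennreal_plus)
  qed
  also have "\<dots> \<le> L2_ennreal P ?X +
      (L2_ennreal P (\<lambda>w. ?C * ?dI w)
       + L2_ennreal P (\<lambda>w. ?C' * ?dI' w))"
    by (rule order_trans[OF L2_ennreal_triangle add_left_mono[OF L2_ennreal_triangle]]) simp_all
  also have "\<dots> = L2_ennreal P ?X +
      (?C * L2_ennreal P ?dI
       + ?C' * L2_ennreal P ?dI')"
    by (subst (1 2) L2_ennreal_cmult) simp_all
  also have "\<dots> \<le> L2_ennreal P ?X + (?C * ennreal e + ?C' * ennreal e)"
    by (intro add_left_mono add_mono mult_left_mono b2 b2') auto
  finally have LX: "?L \<le> L2_ennreal P ?X + (?C * ennreal e + ?C' * ennreal e)" .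

  \<comment> \<open>the isometry for the step functions\<close>
  define sf where "sf = step_function n \<tau> \<Phi>"
  define sf' where "sf' = step_function n' \<tau>' \<Phi>'"
  let ?J = "{..<n} <+> {..<n'}"
  define \<Psi> where "\<Psi> = case_sum (\<lambda>i. C o\<^sub>L \<Phi> i) (\<lambda>i. - (C' o\<^sub>L \<Phi>' i))"
  define a where "a = case_sum \<tau> \<tau>'"
  define b where "b = case_sum (\<lambda>i. \<tau> (Suc i)) (\<lambda>i. \<tau>' (Suc i))"
  have X_eq: "X w = (\<Sum>i\<in>?J. \<Psi> i (M (b i) w - M (a i) w))" for w
    by (simp add: X_def st_def st'_def step_integral_def sum.Plus \<Psi>_def a_def b_def
        blinfun.sum_right blinfun.minus_left sum_negf)
  have sf_eq: "(\<Sum>i\<in>?J. indicator {a i<..b i} s *\<^sub>R \<Psi> i z) = C (sf s z) - C' (sf' s z)" for s z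
    unfolding sf_def sf'_def step_function_def \<Psi>_def a_def b_def sum.Plus[OF finite_lessThan finite_lessThan]
    by (simp only: o_def sum.case blinfun_apply_blinfun_compose blinfun.sum_right blinfun.sum_left
        blinfun.scaleR_left blinfun.scaleR_right blinfun.minus_left scaleR_minus_right sum_negf diff_conv_add_uminus)
  have \<tau>le: "\<tau> i \<le> \<tau> (Suc i)" "\<tau>' i \<le> \<tau>' (Suc i)" for i
    using monoD[OF \<tau>(1), of i "Suc i"] monoD[OF \<tau>'(1), of i "Suc i"] by auto
  have "(\<integral>\<^sup>+w. ennreal ((norm (X w))\<^sup>2) \<partial>P)
      = (\<integral>\<^sup>+s. ennreal (\<Sum>r\<in>UNIV. (norm (C (sf s (?S r)) - C' (sf' s (?S r))))\<^sup>2) \<partial>lborel)"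
    unfolding X_eq sf_eq[symmetric]
    by (rule ito_isometry) (auto simp: a_def b_def \<tau>pos \<tau>le)
  then have X_L2: "L2_ennreal P ?X
      = L2_ennreal lborel (\<lambda>s. ennreal (L2_set (\<lambda>r. norm (C (sf s (?S r)) - C' (sf' s (?S r)))) UNIV))"
    by (simp add: L2_ennreal_def ennreal_power L2_set_def sum_nonneg)

  \<comment> \<open>replacing the step functions by the integrands\<close>
  have sf0: "sf s = 0" "sf' s = 0" if "s \<notin> {0..t}" for s
  proof -
    have "indicator {\<tau> i<..\<tau> (Suc i)} s = (0::real)" "indicator {\<tau>' i<..\<tau>' (Suc i)} s = (0::real)" for i
      using \<tau>pos(1,2)[of i] \<tau>pos(3,4)[of "Suc i"] that by (auto simp: indicator_def)
    then show "sf s = 0" "sf' s = 0" by (simp_all add: sf_def sf'_def step_function_def)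
  qed
  have mF: "(\<lambda>s. indicator {0..t} s *\<^sub>R F s z) \<in> borel_measurable lborel" for z
    using borel_measurable_blinfun_eval[of "\<lambda>s. indicator {0..t} s *\<^sub>R F s" lborel z] W
    by (simp add: has_wiener_integral_def set_borel_measurable_def blinfun.scaleR_left)
  have mF': "(\<lambda>s. indicator {0..t} s *\<^sub>R F' s z) \<in> borel_measurable lborel" for z
    using borel_measurable_blinfun_eval[of "\<lambda>s. indicator {0..t} s *\<^sub>R F' s" lborel z] W'
    by (simp add: has_wiener_integral_def set_borel_measurable_def blinfun.scaleR_left)
  have msf: "(\<lambda>s. sf s z) \<in> borel_measurable lborel" "(\<lambda>s. sf' s z) \<in> borel_measurable lborel" for z
    unfolding sf_def sf'_def step_function_def blinfun.sum_left blinfun.scaleR_left by measurable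
  define D where "D = (\<lambda>s z. indicator {0..t} s *\<^sub>R (F s - sf s) z)"
  define D' where "D' = (\<lambda>s z. indicator {0..t} s *\<^sub>R (F' s - sf' s) z)"
  have mD: "(\<lambda>s. D s z) \<in> borel_measurable lborel" and mD': "(\<lambda>s. D' s z) \<in> borel_measurable lborel" for z
    unfolding D_def D'_def blinfun.diff_left scaleR_diff_right
    by (intro borel_measurable_diff mF mF' borel_measurable_scaleR msf; simp)+
  note [measurable] = mD mD' mF mF'
  let ?dS = "\<lambda>r s. norm C * norm (D s (?S r)) + norm C' * norm (D' s (?S r))"
  let ?G = "\<lambda>r s. C (F s (?S r)) - C' (F' s (?S r))" and ?E = "\<lambda>r s. C (sf s (?S r)) - C' (sf' s (?S r))"
  let ?LE = "\<lambda>s. L2_set (\<lambda>r. norm (?E r s)) UNIV" and ?LG = "\<lambda>s. L2_set (\<lambda>r. norm (?G r s)) UNIV"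
  have b1: "L2_ennreal lborel (\<lambda>s. ennreal (norm (D s z))) \<le> ennreal (norm z * e)" for z
    unfolding D_def by (rule L2_ennreal_blinfun_eval_le) (use mD a1 in \<open>auto simp: D_def sf_def\<close>)
  have b1': "L2_ennreal lborel (\<lambda>s. ennreal (norm (D' s z))) \<le> ennreal (norm z * e)" for z
    unfolding D'_def by (rule L2_ennreal_blinfun_eval_le) (use mD' a1' in \<open>auto simp: D'_def sf'_def\<close>)
  let ?f = "\<lambda>s. indicator {0..t} s * ?LG s"
  have f_eq: "?f s = L2_set (\<lambda>r. norm (C (indicator {0..t} s *\<^sub>R F s (?S r)) - C' (indicator {0..t} s *\<^sub>R F' s (?S r)))) UNIV" for s
    by (cases "s \<in> {0..t}") (auto simp: blinfun.zero_right L2_set_def)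
  have mf [measurable]: "?f \<in> borel_measurable lborel"
  proof -
    \<comment> \<open>only the product of \<open>F\<close> with the indicator is known to be measurable; \<open>H\<close> keeps the two together\<close>
    define H where "H = (\<lambda>z s. C (indicator {0..t} s *\<^sub>R F s z) - C' (indicator {0..t} s *\<^sub>R F' s z))"
    have [measurable]: "H z \<in> borel_measurable lborel" for z
      unfolding H_def by (intro borel_measurable_diff borel_measurable_blinfun_apply mF mF')
    have "?f = (\<lambda>s. L2_set (\<lambda>r. norm (H (?S r) s)) UNIV)"
      unfolding f_eq H_def ..
    then show ?thesis unfolding L2_set_def by simp
  qed
  let ?g = "\<lambda>r s. ?C * ennreal (norm (D s (?S r))) + ?C' * ennreal (norm (D' s (?S r)))"
  have "L2_ennreal lborel (\<lambda>s. ennreal (?LE s))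
      \<le> L2_ennreal lborel (\<lambda>s. ennreal (?f s) + (\<Sum>r\<in>UNIV. ?g r s))"
  proof (rule L2_ennreal_mono_AE, rule AE_I2)
    fix s
    show "ennreal (?LE s) \<le> ennreal (?f s) + (\<Sum>r\<in>UNIV. ?g r s)"
    proof (cases "s \<in> {0..t}")
      case True
      have "?LE s \<le> L2_set (\<lambda>r. norm (?G r s) + ?dS r s) UNIV"
      proof (rule L2_set_mono)
        fix r
        have "?E r s = ?G r s - C (D s (?S r)) + C' (D' s (?S r))"
          using True by (simp add: D_def D'_def blinfun.diff_right blinfun.diff_left)
        then have "norm (?E r s) \<le> norm (?G r s) + norm (C (D s (?S r))) + norm (C' (D' s (?S r)))"
          using norm_triangle_ineq[of "?G r s - C (D s (?S r))" "C' (D' s (?S r))"]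
            norm_triangle_ineq4[of "?G r s" "C (D s (?S r))"] by simp
        then show "norm (?E r s) \<le> norm (?G r s) + ?dS r s"
          using norm_blinfun[of C "D s (?S r)"] norm_blinfun[of C' "D' s (?S r)"] by linarith
      qed simp
      also have "\<dots> \<le> L2_set (\<lambda>r. norm (?G r s)) UNIV + L2_set (\<lambda>r. ?dS r s) UNIV"
        by (rule L2_set_triangle_ineq)
      also have "\<dots> \<le> ?f s + (\<Sum>r\<in>UNIV. ?dS r s)"
        using True by (auto intro!: add_mono L2_set_le_sum)
      finally have "ennreal (?LE s)
          \<le> ennreal (?f s + (\<Sum>r\<in>UNIV. ?dS r s))"
        by (rule ennreal_leI)
      also have "\<dots> = ennreal (?f s) + ennreal (\<Sum>r\<in>UNIV. ?dS r s)"
        by (intro ennreal_plus mult_nonneg_nonneg L2_set_nonneg sum_nonneg add_nonneg_nonneg) auto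
      also have "ennreal (\<Sum>r\<in>UNIV. ?dS r s) = (\<Sum>r\<in>UNIV. ?g r s)"
        by (subst sum_ennreal[symmetric]) (auto simp: ennreal_mult)
      finally show ?thesis .
    next
      case False
      then show ?thesis by (simp add: sf0 blinfun.zero_right L2_set_def)
    qed
  qed
  also have "\<dots> \<le> ?R + (\<Sum>r\<in>UNIV. L2_ennreal lborel (?g r))"
    by (rule order_trans[OF L2_ennreal_triangle add_left_mono[OF L2_ennreal_sum_le]]) simp_all
  also have "\<dots> \<le> ?R + (\<Sum>r\<in>UNIV. ?C * ennreal (norm (?S r) * e) + ?C' * ennreal (norm (?S r) * e))"
  proof (intro add_left_mono sum_mono)
    fix r
    have "L2_ennreal lborel (?g r) \<le> L2_ennreal lborel (\<lambda>s. ?C * ennreal (norm (D s (?S r))))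
        + L2_ennreal lborel (\<lambda>s. ?C' * ennreal (norm (D' s (?S r))))"
      by (rule L2_ennreal_triangle) simp_all
    also have "\<dots> = ?C * L2_ennreal lborel (\<lambda>s. ennreal (norm (D s (?S r))))
        + ?C' * L2_ennreal lborel (\<lambda>s. ennreal (norm (D' s (?S r))))"
      by (subst (1 2) L2_ennreal_cmult) simp_all
    also have "\<dots> \<le> ?C * ennreal (norm (?S r) * e) + ?C' * ennreal (norm (?S r) * e)"
      by (intro add_mono mult_left_mono b1 b1') auto
    finally show "L2_ennreal lborel (?g r) \<le> ?C * ennreal (norm (?S r) * e) + ?C' * ennreal (norm (?S r) * e)" .
  qed
  finally have "?L \<le> ?R + (\<Sum>r\<in>UNIV. ?C * ennreal (norm (?S r) * e) + ?C' * ennreal (norm (?S r) * e))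
      + (?C * ennreal e + ?C' * ennreal e)"
    using LX unfolding X_L2 by (meson add_right_mono order_trans)
  also have "\<dots> = ?R + ennreal (e * Q)"
  proof -
    have "(\<Sum>r\<in>UNIV. ?C * ennreal (norm (?S r) * e) + ?C' * ennreal (norm (?S r) * e))
        + (?C * ennreal e + ?C' * ennreal e) = ennreal (e * Q)"
      using e0 by (simp add: Q_def ennreal_mult[symmetric] sum_nonneg sum_ennreal algebra_simps sum.distrib sum_distrib_left
          flip: ennreal_plus)
    then show ?thesis by (simp only: add.assoc)
  qed
  also have "\<dots> \<le> ?R + ennreal \<epsilon>" by (intro add_left_mono ennreal_leI eQ)
  finally show "?L \<le> ?R + ennreal \<epsilon>" .
qed

end


section \<open>Exponentially stable semigroups\<close>

lemma exp_stableE: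
  assumes "exp_stable T"
  obtains \<omega> \<nu> where "\<omega> > 0" "\<nu> \<ge> 1" "\<And>t. t \<ge> 0 \<Longrightarrow> norm (T t) \<le> \<nu> * exp (- \<omega> * t)"
    "\<And>t. t \<ge> 0 \<Longrightarrow> norm (T t) \<le> \<nu>"
proof -
  obtain \<omega> \<nu> where *: "\<omega> > 0" "\<nu> \<ge> 1" "\<And>t. t \<ge> 0 \<Longrightarrow> norm (T t) \<le> \<nu> * exp (- \<omega> * t)"
    using assms unfolding exp_stable_def by blast
  have "norm (T t) \<le> \<nu>" if "t \<ge> 0" for t
  proof -
    have "\<nu> * exp (- \<omega> * t) \<le> \<nu> * 1" using * that by (intro mult_left_mono) auto
    then show ?thesis using *(3)[OF that] by simp
  qed
  then show ?thesis using that * by blast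
qed

text \<open>
  The semigroup law and the uniform bound \<open>\<nu>\<close> reduce continuity to continuity at 0:
  \<open>\<parallel>T\<^sub>b x - T\<^sub>a x\<parallel> \<le> \<nu> \<parallel>T\<^bsub>b-a\<^esub> x - x\<parallel>\<close> for \<open>a \<le> b\<close>.
\<close>

lemma continuous_on_orbit:
  assumes "C0_semigroup T" "exp_stable T"
  shows "continuous_on {0..} (\<lambda>t. T t x)"
proof -
  obtain \<omega> \<nu> where \<nu>: "\<nu> \<ge> 1" "\<And>t. t \<ge> 0 \<Longrightarrow> norm (T t) \<le> \<nu>"
    using exp_stableE[OF assms(2)] by metis
  have step: "norm (T b x - T a x) \<le> \<nu> * norm (T (b - a) x - x)" if "0 \<le> a" "a \<le> b" for a b
  proof -
    have "T (a + (b - a)) = T a o\<^sub>L T (b - a)"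
      using assms(1) that unfolding C0_semigroup_def by (metis diff_ge_0_iff_ge)
    then have "T b x - T a x = T a (T (b - a) x - x)" by (simp add: blinfun.diff_right)
    then have "norm (T b x - T a x) \<le> norm (T a) * norm (T (b - a) x - x)" by (simp add: norm_blinfun)
    also have "\<dots> \<le> \<nu> * norm (T (b - a) x - x)" using \<nu>(2)[OF that(1)] by (rule mult_right_mono) simp
    finally show ?thesis .
  qed
  show ?thesis
    unfolding continuous_on_iff
  proof (intro ballI allI impI)
    fix t e :: real assume t: "t \<in> {0..}" and e: "0 < e"
    have "((\<lambda>t. T t x) \<longlongrightarrow> x) (at_right 0)" using assms(1) by (simp add: C0_semigroup_def)
    then have "\<forall>\<^sub>F h in at_right 0. dist (T h x) x < e / \<nu>"
      by (rule tendstoD) (use e \<nu> in auto)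
    then obtain d where d: "d > 0" "\<And>h. 0 < h \<Longrightarrow> h < d \<Longrightarrow> dist (T h x) x < e / \<nu>"
      unfolding eventually_at_right_field by auto
    have ordered: "dist (T b x) (T a x) < e" if ab: "0 \<le> a" "a \<le> b" "b - a < d" for a b
    proof (cases "a = b")
      case False
      then have "norm (T (b - a) x - x) < e / \<nu>" using d(2)[of "b - a"] ab by (simp add: dist_norm)
      then have "\<nu> * norm (T (b - a) x - x) < \<nu> * (e / \<nu>)" using \<nu>(1) by (intro mult_strict_left_mono) auto
      then show ?thesis using step[OF ab(1,2)] \<nu>(1) by (simp add: dist_norm)
    qed (use e in simp)
    have "dist (T s x) (T t x) < e" if "s \<in> {0..}" "dist s t < d" for s
      using ordered[of t s] ordered[of s t] that t by (cases "t \<le> s") (auto simp: dist_real_def dist_commute)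
    then show "\<exists>d>0. \<forall>s\<in>{0..}. dist s t < d \<longrightarrow> dist (T s x) (T t x) < e" using d(1) by blast
  qed
qed

lemma measurable_halfline_continuous:
  fixes f :: "real \<Rightarrow> 'a::topological_space"
  assumes "continuous_on {0..} f"
  shows "f \<in> borel_measurable halfline"
proof -
  have "f \<in> borel_measurable (restrict_space borel {0<..})"
    by (rule borel_measurable_continuous_on_restrict) (rule continuous_on_subset[OF assms], auto)
  moreover have "sets (restrict_space borel {0<..}) = sets (halfline :: real measure)"
    by (rule sets_restrict_space_cong) simp
  ultimately show ?thesis using measurable_cong_sets[OF _ refl] by blast
qed

lemma measurable_orbit_halfline:
  fixes T :: "real \<Rightarrow> 'x::{real_inner, banach, second_countable_topology} \<Rightarrow>\<^sub>L 'x"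
  assumes "C0_semigroup T" "exp_stable T"
  shows "(\<lambda>s. T s x) \<in> borel_measurable halfline"
  by (rule measurable_halfline_continuous[OF continuous_on_orbit[OF assms]])

lemma integrable_exp_halfline: "0 < c \<Longrightarrow> integrable halfline (\<lambda>t. exp (- (t * c)))"
  using integrable_I0i_exp_mscale[of c]
  by (subst integrable_restrict_space) (simp_all add: set_integrable_def)

lemma sq_integrable_orbit:
  fixes C :: "'x::{real_inner, banach, second_countable_topology} \<Rightarrow>\<^sub>L 'h::{real_inner, banach, second_countable_topology}"
  assumes "C0_semigroup T" "exp_stable T"
  shows "sq_integrable halfline (\<lambda>t. C (T t x))"
  unfolding sq_integrable_def
proof
  have meas [measurable]: "(\<lambda>t. C (T t x)) \<in> borel_measurable halfline"
    by (rule measurable_halfline_continuous)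
      (rule bounded_linear.continuous_on[OF blinfun.bounded_linear_right continuous_on_orbit[OF assms]])
  then show "(\<lambda>t. C (T t x)) \<in> borel_measurable halfline" .
  obtain \<omega> \<nu> where \<nu>: "\<omega> > 0" "\<nu> \<ge> 1" "\<And>t. t \<ge> 0 \<Longrightarrow> norm (T t) \<le> \<nu> * exp (- \<omega> * t)"
    using exp_stableE[OF assms(2)] by metis
  show "integrable halfline (\<lambda>t. (norm (C (T t x)))\<^sup>2)"
  proof (rule Bochner_Integration.integrable_bound)
    show "integrable halfline (\<lambda>t. (norm C * (\<nu> * norm x))\<^sup>2 * exp (- (t * (2 * \<omega>))))"
      using \<nu>(1) by (intro integrable_mult_right integrable_exp_halfline) auto
    show "AE t in halfline. norm ((norm (C (T t x)))\<^sup>2) \<le> norm ((norm C * (\<nu> * norm x))\<^sup>2 * exp (- (t * (2 * \<omega>))))"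
    proof (rule AE_I2)
      fix t assume "t \<in> space halfline"
      then have t: "t \<ge> 0" by (simp add: space_restrict_space)
      have "norm (C (T t x)) \<le> norm C * (norm (T t) * norm x)"
        by (rule order_trans[OF norm_blinfun mult_left_mono[OF norm_blinfun]]) simp
      also have "\<dots> \<le> norm C * ((\<nu> * exp (- \<omega> * t)) * norm x)"
        using \<nu>(3)[OF t] by (intro mult_left_mono mult_right_mono) auto
      finally have "(norm (C (T t x)))\<^sup>2 \<le> (norm C * ((\<nu> * exp (- \<omega> * t)) * norm x))\<^sup>2"
        by (intro power_mono) auto
      also have "\<dots> = (norm C * (\<nu> * norm x))\<^sup>2 * exp (- (t * (2 * \<omega>)))"
      proof -
        have "(exp (- \<omega> * t))\<^sup>2 = exp (- (t * (2 * \<omega>)))"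
          by (simp add: power2_eq_square exp_add[symmetric])
        then show ?thesis by (simp only: power_mult_distrib mult_ac)
      qed
      finally show "norm ((norm (C (T t x)))\<^sup>2) \<le> norm ((norm C * (\<nu> * norm x))\<^sup>2 * exp (- (t * (2 * \<omega>))))"
        by simp
    qed
  qed simp
qed

text \<open>
  The semigroup is only strongly continuous, but the input space has finite dimension: expand
  \<open>f s\<close> in the standard basis.
\<close>

lemma borel_measurable_semigroup_input:
  fixes T :: "real \<Rightarrow> 'x::{real_inner, banach, second_countable_topology} \<Rightarrow>\<^sub>L 'x"
    and L :: "(real^'m) \<Rightarrow>\<^sub>L 'x"
  assumes "\<And>x. (\<lambda>s. T (\<rho> s) x) \<in> borel_measurable N" and f: "f \<in> borel_measurable N"
  shows "(\<lambda>s. T (\<rho> s) (L (f s))) \<in> borel_measurable N"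
proof -
  have "T (\<rho> s) (L (f s)) = (\<Sum>i\<in>UNIV. (axis i 1 \<bullet> f s) *\<^sub>R T (\<rho> s) (L (axis i 1)))" for s
    by (subst vec_eq_sum_axis[of "f s"]) (simp only: blinfun.sum_right blinfun.scaleR_right)
  moreover have "(\<lambda>s. \<Sum>i\<in>UNIV. (axis i 1 \<bullet> f s) *\<^sub>R T (\<rho> s) (L (axis i 1))) \<in> borel_measurable N"
    using f by (intro borel_measurable_sum borel_measurable_scaleR borel_measurable_inner assms(1)) simp_all
  ultimately show ?thesis by (simp only:)
qed

lemma integrable_semigroup_input:
  fixes T :: "real \<Rightarrow> 'x::{real_inner, banach, second_countable_topology} \<Rightarrow>\<^sub>L 'x"
    and L :: "(real^'m) \<Rightarrow>\<^sub>L 'x"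
  assumes T: "exp_stable T" and meas: "\<And>x. (\<lambda>s. T (\<rho> s) x) \<in> borel_measurable N"
    and \<rho>: "\<And>s. s \<in> space N \<Longrightarrow> 0 \<le> \<rho> s" and f: "integrable N f"
  shows "integrable N (\<lambda>s. T (\<rho> s) (L (f s)))"
proof -
  obtain \<omega> \<nu> where \<nu>: "\<nu> \<ge> 1" "\<And>t. t \<ge> 0 \<Longrightarrow> norm (T t) \<le> \<nu>"
    using exp_stableE[OF T] by metis
  show ?thesis
  proof (rule Bochner_Integration.integrable_bound)
    show "integrable N (\<lambda>s. (\<nu> * norm L) * norm (f s))"
      using f by simp
    show "(\<lambda>s. T (\<rho> s) (L (f s))) \<in> borel_measurable N"
      by (rule borel_measurable_semigroup_input[of T \<rho>, OF meas borel_measurable_integrable[OF f]])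
    show "AE s in N. norm (T (\<rho> s) (L (f s))) \<le> norm ((\<nu> * norm L) * norm (f s))"
    proof (rule AE_I2)
      fix s assume "s \<in> space N"
      then have "norm (T (\<rho> s)) \<le> \<nu>" by (rule \<nu>(2)[OF \<rho>])
      then have "norm (T (\<rho> s) (L (f s))) \<le> \<nu> * (norm L * norm (f s))"
        using \<nu>(1) by (intro order_trans[OF norm_blinfun] mult_mono norm_blinfun) auto
      then show "norm (T (\<rho> s) (L (f s))) \<le> norm ((\<nu> * norm L) * norm (f s))"
        using \<nu>(1) by (simp add: mult.assoc)
    qed
  qed
qed

lemma integrable_convolution:
  fixes T :: "real \<Rightarrow> 'x::{real_inner, banach, second_countable_topology} \<Rightarrow>\<^sub>L 'x"
    and L :: "(real^'m) \<Rightarrow>\<^sub>L 'x"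
  assumes T: "C0_semigroup T" "exp_stable T"
    and f: "integrable (restrict_space lborel {0<..<t}) f"
  shows "integrable (restrict_space lborel {0<..<t}) (\<lambda>s. T (t - s) (L (f s)))"
proof -
  have "(\<lambda>s. T (t - s) x) \<in> borel_measurable (restrict_space lborel {0<..<t})" for x
  proof -
    have "continuous_on {0<..<t} (\<lambda>s. T (t - s) x)"
      by (rule continuous_on_compose2[OF continuous_on_orbit[OF T]]) (auto intro!: continuous_intros)
    then have "(\<lambda>s. T (t - s) x) \<in> borel_measurable (restrict_space borel {0<..<t})"
      by (rule borel_measurable_continuous_on_restrict)
    moreover have "sets (restrict_space borel {0<..<t}) = sets (restrict_space (lborel :: real measure) {0<..<t})"
      by (rule sets_restrict_space_cong) simp
    ultimately show ?thesis using measurable_cong_sets[OF _ refl] by blast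
  qed
  then show ?thesis
    by (rule integrable_semigroup_input[OF T(2) _ _ f]) (simp add: space_restrict_space)
qed

lemma indicator_halfline:
  fixes p q :: real
  assumes "0 \<le> p" "p \<le> q"
  shows "integrable halfline (indicator {p<..q} :: real \<Rightarrow> real)"
    and "(\<integral>t. indicator {p<..q} t \<partial>halfline) = q - p"
proof -
  have eq: "(\<lambda>t. indicator {0<..} t *\<^sub>R (indicator {p<..q} t :: real)) = indicator {p<..q}"
    using assms by (auto simp: fun_eq_iff indicator_def)
  show "integrable halfline (indicator {p<..q} :: real \<Rightarrow> real)"
  proof (subst integrable_restrict_space)
    show "integrable lborel (\<lambda>t. indicator {0<..} t *\<^sub>R (indicator {p<..q} t :: real))"
      unfolding eq using assms by (simp add: integrable_indicator_iff)
  qed simp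
  show "(\<integral>t. indicator {p<..q} t \<partial>halfline) = q - p"
  proof (subst integral_restrict_space)
    show "(\<integral>t. indicator {0<..} t *\<^sub>R (indicator {p<..q} t :: real) \<partial>lborel) = q - p"
      unfolding eq using assms by simp
  qed simp
qed

lemma sq_integrable_block:
  fixes b :: "'h::{real_inner, second_countable_topology}"
  assumes "0 \<le> p" "p \<le> q"
  shows "sq_integrable halfline (\<lambda>t. indicator {p<..q} t *\<^sub>R b)"
proof -
  have m: "(indicator {p<..q} :: real \<Rightarrow> real) \<in> borel_measurable halfline"
    using indicator_halfline(1)[OF assms] by (rule borel_measurable_integrable)
  have "(\<lambda>t. (norm (indicator {p<..q} t *\<^sub>R b))\<^sup>2) = (\<lambda>t. indicator {p<..q} t * (norm b)\<^sup>2)"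
    by (auto simp: fun_eq_iff indicator_def)
  moreover have "integrable halfline (\<lambda>t. indicator {p<..q} t * (norm b)\<^sup>2)"
    using indicator_halfline(1)[OF assms] by (rule integrable_mult_left)
  ultimately show ?thesis unfolding sq_integrable_def
    using borel_measurable_scaleR[OF m borel_measurable_const] by simp
qed

lemma integrable_semigroup_block:
  fixes T :: "real \<Rightarrow> 'x::{real_inner, banach, second_countable_topology} \<Rightarrow>\<^sub>L 'x"
    and L :: "(real^'m) \<Rightarrow>\<^sub>L 'x"
  assumes T: "C0_semigroup T" "exp_stable T" and pq: "0 \<le> p" "p \<le> q"
  shows "integrable halfline (\<lambda>s. T s (L (indicator {p<..q} s *\<^sub>R a)))"
proof -
  have "integrable halfline (\<lambda>s. indicator {p<..q} s *\<^sub>R a)"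
    by (rule integrable_scaleR_left[OF indicator_halfline(1)[OF pq]])
  from integrable_semigroup_input[where \<rho> = "\<lambda>s. s", OF T(2) measurable_orbit_halfline[OF T] _ this]
  show ?thesis by (simp add: space_restrict_space)
qed

lemma B_in_zero: "B_in \<phi> 0 = 0"
  by (simp add: B_in_def)

lemma norm_B_in_orthonormal:
  fixes \<phi> :: "'k::finite \<Rightarrow> 'x::real_inner"
  assumes "\<forall>i j. \<phi> i \<bullet> \<phi> j = of_bool (i = j)"
  shows "norm (B_in \<phi> v) = norm v"
proof -
  have "(norm (B_in \<phi> v))\<^sup>2 = (\<Sum>i\<in>UNIV. \<Sum>j\<in>UNIV. if i = j then (v $ i) * (v $ i) else 0)"
    unfolding B_in_def norm_sum_scaleR_sq using assms by (intro sum.cong) (auto simp: inner_axis)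
  also have "\<dots> = (norm v)\<^sup>2" by (simp add: power2_norm_eq_inner inner_vec_def)
  finally show ?thesis by simp
qed

text \<open>
  Almost everywhere the chosen representative of the class of \<open>f\<close> coincides with \<open>f\<close>.
\<close>

lemma ou_R_input:
  fixes T :: "real \<Rightarrow> 'x::{real_inner, banach, second_countable_topology} \<Rightarrow>\<^sub>L 'x"
    and L :: "(real^'m) \<Rightarrow>\<^sub>L 'x"
  assumes T: "C0_semigroup T" "exp_stable T"
    and lin: "op_sqrt (\<lambda>z. second_moment P M *v z) 0 = 0"
    and f: "sq_integrable halfline f"
  shows "ou_R P M T L K \<phi> (abs_L2_halfline f, 0, 0) = (\<integral>s. T s (L (f s)) \<partial>halfline)"
proof -
  have "(\<integral>s. T s (L (rep_L2_halfline (abs_L2_halfline f) s)) \<partial>halfline) = (\<integral>s. T s (L (f s)) \<partial>halfline)"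
  proof (rule integral_cong_AE)
    show "(\<lambda>s. T s (L (rep_L2_halfline (abs_L2_halfline f) s))) \<in> borel_measurable halfline"
      using sq_integrable_rep_L2_halfline[of "abs_L2_halfline f"]
      by (intro borel_measurable_semigroup_input[OF measurable_orbit_halfline[OF T]]) (simp add: sq_integrable_def)
    show "(\<lambda>s. T s (L (f s))) \<in> borel_measurable halfline"
      using f by (intro borel_measurable_semigroup_input[OF measurable_orbit_halfline[OF T]]) (simp add: sq_integrable_def)
    show "AE s in halfline. T s (L (rep_L2_halfline (abs_L2_halfline f) s)) = T s (L (f s))"
      using rep_abs_L2_halfline[OF f] by eventually_elim simp
  qed
  then show ?thesis by (simp add: ou_R_def lin blinfun.zero_right B_in_zero)
qed

lemma ou_R_noise_initial:
  fixes T :: "real \<Rightarrow> 'x::{real_inner, banach, second_countable_topology} \<Rightarrow>\<^sub>L 'x"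
    and L :: "(real^'m) \<Rightarrow>\<^sub>L 'x"
  assumes T: "C0_semigroup T" "exp_stable T"
  shows "ou_R P M T L K \<phi> (0, w, a) = K (op_sqrt (\<lambda>z. second_moment P M *v z) w) + B_in \<phi> a"
proof -
  have "(\<integral>s. T s (L (rep_L2_halfline 0 s)) \<partial>halfline) = (\<integral>s. (0 :: 'x) \<partial>halfline)"
  proof (rule integral_cong_AE)
    show "(\<lambda>s. T s (L (rep_L2_halfline 0 s))) \<in> borel_measurable halfline"
      using sq_integrable_rep_L2_halfline[of "0 :: (real^'m) L2_halfline"]
      by (intro borel_measurable_semigroup_input[OF measurable_orbit_halfline[OF T]]) (simp add: sq_integrable_def)
    have "AE s in halfline. rep_L2_halfline (0 :: (real^'m) L2_halfline) s = 0"
      using rep_abs_L2_halfline[OF sq_integrable_zero] by (simp only: zero_eq_abs_L2_halfline[symmetric])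
    then show "AE s in halfline. T s (L (rep_L2_halfline 0 s)) = 0"
      by eventually_elim (simp add: blinfun.zero_right)
  qed simp
  then show ?thesis by (simp add: ou_R_def)
qed

text \<open>
  Two exponentially stable semigroups, observed in the same space. All quantities below are
  differences of outputs, hence values of \<open>output_diff\<close>.
\<close>

locale stable_pair =
  fixes T :: "real \<Rightarrow> 'x::{real_inner, banach, second_countable_topology} \<Rightarrow>\<^sub>L 'x"
    and C :: "'x \<Rightarrow>\<^sub>L 'h::{real_inner, banach, second_countable_topology}"
    and T' :: "real \<Rightarrow> 'y::{real_inner, banach, second_countable_topology} \<Rightarrow>\<^sub>L 'y"
    and C' :: "'y \<Rightarrow>\<^sub>L 'h"
  assumes semigroups: "C0_semigroup T" "C0_semigroup T'"
    and stable: "exp_stable T" "exp_stable T'"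
begin

definition output_diff :: "'x \<Rightarrow> 'y \<Rightarrow> real \<Rightarrow> 'h" where
  "output_diff x x' t = C (T t x) - C' (T' t x')"

lemma continuous_on_output: "continuous_on {0..} (\<lambda>t. C (T t x))" "continuous_on {0..} (\<lambda>t. C' (T' t x'))"
  by (rule bounded_linear.continuous_on[OF blinfun.bounded_linear_right continuous_on_orbit[OF semigroups(1) stable(1)]],
      rule bounded_linear.continuous_on[OF blinfun.bounded_linear_right continuous_on_orbit[OF semigroups(2) stable(2)]])

lemma continuous_on_output_diff: "continuous_on {0..} (output_diff x x')"
  unfolding output_diff_def by (intro continuous_on_diff continuous_on_output)

lemma sq_integrable_output_diff: "sq_integrable halfline (output_diff x x')"
  unfolding output_diff_def
  by (rule sq_integrable_diff[OF sq_integrable_orbit[OF semigroups(1) stable(1)] sq_integrable_orbit[OF semigroups(2) stable(2)]])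

lemma ou_W_diff: "ou_W T C x - ou_W T' C' x' = abs_L2_halfline (output_diff x x')"
  unfolding ou_W_def output_diff_def
  by (rule minus_abs_L2_halfline[OF sq_integrable_orbit[OF semigroups(1) stable(1)] sq_integrable_orbit[OF semigroups(2) stable(2)]])

end


section \<open>The impulse response and the trace norm of the Hankel operator\<close>

lemma inner_inv_sqrt:
  assumes "0 < \<epsilon>"
  shows "(x /\<^sub>R sqrt \<epsilon>) \<bullet> (y /\<^sub>R sqrt \<epsilon>) = (x \<bullet> y) / \<epsilon>"
proof -
  have "inverse (sqrt \<epsilon>) * (inverse (sqrt \<epsilon>) * (x \<bullet> y)) = inverse (sqrt \<epsilon> * sqrt \<epsilon>) * (x \<bullet> y)"
    by (simp only: inverse_mult_distrib mult.assoc)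
  then show ?thesis using assms by (simp add: inverse_eq_divide)
qed

text \<open>
  The factor \<open>1 / \<surd>\<epsilon>\<close> normalizes the indicator functions of the intervals of length \<open>\<epsilon>\<close>.
\<close>

lemma bessel_family_blocks:
  fixes b :: "nat \<Rightarrow> 'h::{real_inner, second_countable_topology}"
  assumes \<epsilon>: "0 < \<epsilon>" and b: "\<And>j. norm (b j) \<le> 1"
  shows "bessel_family {..<N} (\<lambda>j. abs_L2_halfline
    (\<lambda>t. indicator {real j * \<epsilon><..real (Suc j) * \<epsilon>} t *\<^sub>R (b j /\<^sub>R sqrt \<epsilon>)))"
proof -
  define I where "I = (\<lambda>j. {real j * \<epsilon><..real (Suc j) * \<epsilon>})"
  let ?f = "\<lambda>j. abs_L2_halfline (\<lambda>t. indicator (I j) t *\<^sub>R (b j /\<^sub>R sqrt \<epsilon>))"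
  have I: "0 \<le> real j * \<epsilon>" "real j * \<epsilon> \<le> real (Suc j) * \<epsilon>" for j
    using \<epsilon> by (auto intro: mult_right_mono)
  have sq: "sq_integrable halfline (\<lambda>t. indicator (I j) t *\<^sub>R (b j /\<^sub>R sqrt \<epsilon>))" for j
    unfolding I_def by (rule sq_integrable_block[OF I])
  have disj: "indicator (I i) t = (0::real) \<or> indicator (I j) t = (0::real)" if "i < j" for i j t
  proof -
    have "real (Suc i) * \<epsilon> \<le> real j * \<epsilon>" using that \<epsilon> by (intro mult_right_mono) linarith+
    then show ?thesis by (auto simp: I_def indicator_def)
  qed
  have orth: "?f i \<bullet> ?f j = 0" if "i \<noteq> j" for i j
  proof -
    have "indicator (I i) t = (0::real) \<or> indicator (I j) t = (0::real)" for t
      using disj[of i j t] disj[of j i t] that by (cases "i < j") auto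
    then have "(indicator (I i) t *\<^sub>R (b i /\<^sub>R sqrt \<epsilon>)) \<bullet> (indicator (I j) t *\<^sub>R (b j /\<^sub>R sqrt \<epsilon>)) = 0" for t
      by (metis inner_zero_left inner_zero_right scaleR_zero_left)
    then show ?thesis unfolding inner_abs_L2_halfline[OF sq sq] by (simp only: Bochner_Integration.integral_zero)
  qed
  have nrm: "norm (?f j) \<le> 1" for j
  proof -
    have "(indicator (I j) t *\<^sub>R (b j /\<^sub>R sqrt \<epsilon>)) \<bullet> (indicator (I j) t *\<^sub>R (b j /\<^sub>R sqrt \<epsilon>))
        = indicator (I j) t * ((norm (b j))\<^sup>2 / \<epsilon>)" for t
    proof (cases "t \<in> I j")
      case True
      then show ?thesis by (simp only: indicator_simps scaleR_one mult_1 inner_inv_sqrt[OF \<epsilon>] power2_norm_eq_inner)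
    qed simp
    then have "?f j \<bullet> ?f j = (\<integral>t. indicator (I j) t * ((norm (b j))\<^sup>2 / \<epsilon>) \<partial>halfline)"
      unfolding inner_abs_L2_halfline[OF sq sq] by (simp only:)
    also have "\<dots> = \<epsilon> * ((norm (b j))\<^sup>2 / \<epsilon>)"
      unfolding I_def integral_mult_left_zero indicator_halfline(2)[OF I] by (simp add: algebra_simps)
    also have "\<dots> = (norm (b j))\<^sup>2" using \<epsilon> by simp
    also have "\<dots> \<le> 1" using b[of j] by (simp add: power_le_one)
    finally show ?thesis by (simp add: norm_eq_sqrt_inner)
  qed
  have "bessel_family {..<N} ?f"
    by (rule bessel_family_orthogonal[OF finite_lessThan]) (erule orth, rule nrm)
  then show ?thesis by (simp only: I_def)
qed

text \<open>
  The two systems of the theorem, when the trace norm \<open>\<tau>\<close> of the difference of their Hankel operators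
  is finite.
\<close>

locale hankel_pair = stable_pair T C T' C' + square_integrable_levy P M
  for T :: "real \<Rightarrow> 'x::{real_inner, banach, second_countable_topology} \<Rightarrow>\<^sub>L 'x"
    and C :: "'x \<Rightarrow>\<^sub>L 'h::{real_inner, banach, second_countable_topology}"
    and T' :: "real \<Rightarrow> 'y::{real_inner, banach, second_countable_topology} \<Rightarrow>\<^sub>L 'y"
    and C' :: "'y \<Rightarrow>\<^sub>L 'h"
    and P :: "'w measure" and M :: "real \<Rightarrow> 'w \<Rightarrow> real^'d" +
  fixes B :: "(real^'m) \<Rightarrow>\<^sub>L 'x" and K :: "(real^'d) \<Rightarrow>\<^sub>L 'x" and \<phi> :: "'k::finite \<Rightarrow> 'x"
    and B' :: "(real^'m) \<Rightarrow>\<^sub>L 'y" and K' :: "(real^'d) \<Rightarrow>\<^sub>L 'y" and \<phi>' :: "'k \<Rightarrow> 'y"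
    and \<tau> :: real
  assumes trace_norm_hankel: "trace_norm (\<lambda>x. ou_hankel P M T B K C \<phi> x - ou_hankel P M T' B' K' C' \<phi>' x) = ennreal \<tau>"
    and \<tau>_nonneg: "0 \<le> \<tau>"
begin

abbreviation hankel_diff :: "(real^'m) L2_halfline \<times> (real^'d) \<times> (real^'k) \<Rightarrow> 'h L2_halfline" where
  "hankel_diff \<equiv> \<lambda>x. ou_hankel P M T B K C \<phi> x - ou_hankel P M T' B' K' C' \<phi>' x"

definition impulse :: "real \<Rightarrow> (real^'m) \<Rightarrow>\<^sub>L 'h" where
  "impulse t = (C o\<^sub>L T t o\<^sub>L B) - (C' o\<^sub>L T' t o\<^sub>L B')"

lemma impulse_apply: "impulse t a = output_diff (B a) (B' a) t"
  by (simp add: impulse_def output_diff_def blinfun.diff_left)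

lemma continuous_on_impulse: "continuous_on {0..} impulse"
  by (rule continuous_on_blinfun_componentwise) (simp add: impulse_apply continuous_on_output_diff)

lemma covariance_sqrt_zero: "covariance_sqrt 0 = 0"
proof -
  interpret bounded_linear covariance_sqrt
    by (rule positive_operatorD(1)[OF op_sqrt(1)[OF positive_operator_second_moment]])
  show ?thesis by (rule zero)
qed

lemma hankel_diff_noise_initial:
  "hankel_diff (0, w, a) = abs_L2_halfline (output_diff (K (covariance_sqrt w) + B_in \<phi> a) (K' (covariance_sqrt w) + B_in \<phi>' a))"
  by (simp only: ou_hankel_def o_def ou_R_noise_initial[OF semigroups(1) stable(1)]
      ou_R_noise_initial[OF semigroups(2) stable(2)] ou_W_diff)

lemma semigroup_add: "0 \<le> t \<Longrightarrow> 0 \<le> s \<Longrightarrow> T (t + s) x = T t (T s x)"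
  "0 \<le> t \<Longrightarrow> 0 \<le> s \<Longrightarrow> T' (t + s) y = T' t (T' s y)"
  using semigroups by (simp_all add: C0_semigroup_def)

text \<open>
  The semigroup law turns \<open>F (1\<^sub>I a, 0, 0)\<close> into \<open>t \<mapsto> \<integral>\<^sub>I h(t + s) a ds\<close> with \<open>h\<close> the impulse response,
  so the pairing is the integral of \<open>\<langle>h(t + s) a, b\<rangle>\<close> over the square of the interval.
\<close>

lemma hankel_diff_block_pairing_ge:
  assumes pq: "0 \<le> p" "p \<le> q"
    and c: "\<And>s t. s \<in> {p<..q} \<Longrightarrow> t \<in> {p<..q} \<Longrightarrow> c \<le> impulse (t + s) a \<bullet> b"
  shows "c * (q - p)\<^sup>2 \<le> hankel_diff (abs_L2_halfline (\<lambda>s. indicator {p<..q} s *\<^sub>R a), 0, 0)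
    \<bullet> abs_L2_halfline (\<lambda>t. indicator {p<..q} t *\<^sub>R b)"
proof -
  let ?i = "\<lambda>s. indicator {p<..q} s :: real"
  let ?Y = "\<lambda>t s. (C o\<^sub>L T t) (T s (B (?i s *\<^sub>R a)))" and ?Y' = "\<lambda>t s. (C' o\<^sub>L T' t) (T' s (B' (?i s *\<^sub>R a)))"
  define x where "x = (\<integral>s. T s (B (?i s *\<^sub>R a)) \<partial>halfline)"
  define x' where "x' = (\<integral>s. T' s (B' (?i s *\<^sub>R a)) \<partial>halfline)"
  note int = integrable_semigroup_block[OF semigroups(1) stable(1) pq, of B a]
  note int' = integrable_semigroup_block[OF semigroups(2) stable(2) pq, of B' a]
  have F: "hankel_diff (abs_L2_halfline (\<lambda>s. ?i s *\<^sub>R a), 0, 0) = abs_L2_halfline (output_diff x x')"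
    by (simp only: ou_hankel_def o_def ou_W_diff x_def x'_def
        ou_R_input[OF semigroups(1) stable(1) covariance_sqrt_zero sq_integrable_block[OF pq]]
        ou_R_input[OF semigroups(2) stable(2) covariance_sqrt_zero sq_integrable_block[OF pq]])
  have out: "c * (q - p) \<le> output_diff x x' t \<bullet> b" if t: "t \<in> {p<..q}" for t
  proof -
    have t0: "0 \<le> t" using t pq by simp
    have i1: "integrable halfline (\<lambda>s. ?Y t s)"
      by (rule integrable_bounded_linear[OF blinfun.bounded_linear_right int])
    have i2: "integrable halfline (\<lambda>s. ?Y' t s)"
      by (rule integrable_bounded_linear[OF blinfun.bounded_linear_right int'])
    have "(C o\<^sub>L T t) x = (\<integral>s. ?Y t s \<partial>halfline)"
      unfolding x_def by (rule integral_bounded_linear[OF blinfun.bounded_linear_right int, symmetric])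
    moreover have "(C' o\<^sub>L T' t) x' = (\<integral>s. ?Y' t s \<partial>halfline)"
      unfolding x'_def by (rule integral_bounded_linear[OF blinfun.bounded_linear_right int', symmetric])
    ultimately have "output_diff x x' t = (\<integral>s. ?Y t s - ?Y' t s \<partial>halfline)"
      using Bochner_Integration.integral_diff[OF i1 i2] by (simp add: output_diff_def)
    then have "output_diff x x' t \<bullet> b
        = (\<integral>s. (?Y t s - ?Y' t s) \<bullet> b \<partial>halfline)"
      using integral_inner_left[OF Bochner_Integration.integrable_diff[OF i1 i2], of b] by simp
    also have "\<dots> \<ge> (\<integral>s. ?i s * c \<partial>halfline)"
    proof (rule integral_mono)
      show "integrable halfline (\<lambda>s. ?i s * c)"
        using indicator_halfline(1)[OF pq] by (rule integrable_mult_left)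
      show "integrable halfline (\<lambda>s. (?Y t s - ?Y' t s) \<bullet> b)"
        by (rule integrable_inner_left[OF Bochner_Integration.integrable_diff[OF i1 i2]])
      fix s assume "s \<in> space (halfline :: real measure)"
      then have s0: "0 \<le> s" by (simp add: space_restrict_space)
      show "?i s * c \<le> (?Y t s - ?Y' t s) \<bullet> b"
        using c[of s t] t semigroup_add[OF t0 s0]
        by (cases "s \<in> {p<..q}") (simp_all add: blinfun.zero_right impulse_apply output_diff_def)
    qed
    also have "(\<integral>s. ?i s * c \<partial>halfline) = c * (q - p)"
      using indicator_halfline(2)[OF pq] by simp
    finally show ?thesis .
  qed
  have sq: "sq_integrable halfline (\<lambda>t. ?i t *\<^sub>R b)" by (rule sq_integrable_block[OF pq])
  have "c * (q - p)\<^sup>2 = (\<integral>t. ?i t * (c * (q - p)) \<partial>halfline)"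
    using indicator_halfline(2)[OF pq] by (simp add: power2_eq_square)
  also have "\<dots> \<le> (\<integral>t. output_diff x x' t \<bullet> (?i t *\<^sub>R b) \<partial>halfline)"
  proof (rule integral_mono)
    show "integrable halfline (\<lambda>t. ?i t * (c * (q - p)))"
      using indicator_halfline(1)[OF pq] by (rule integrable_mult_left)
    show "integrable halfline (\<lambda>t. output_diff x x' t \<bullet> (?i t *\<^sub>R b))"
      by (rule sq_integrable_inner[OF sq_integrable_output_diff sq])
    show "?i t * (c * (q - p)) \<le> output_diff x x' t \<bullet> (?i t *\<^sub>R b)" for t
      using out[of t] by (cases "t \<in> {p<..q}") simp_all
  qed
  also have "\<dots> = abs_L2_halfline (output_diff x x') \<bullet> abs_L2_halfline (\<lambda>t. ?i t *\<^sub>R b)"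
    by (rule inner_abs_L2_halfline[OF sq_integrable_output_diff sq, symmetric])
  finally show ?thesis unfolding F .
qed

text \<open>
  On the square of the interval \<open>(j \<epsilon>, (j + 1) \<epsilon>]\<close> the kernel \<open>h(t + s)\<close> is close to \<open>h(2 j \<epsilon>)\<close>. Pair
  the operator with normalized blocks on these intervals, with vectors \<open>a\<^sub>j\<close> at which \<open>h(2 j \<epsilon>)\<close> nearly
  attains its norm and with the directions \<open>b\<^sub>j\<close> of \<open>h(2 j \<epsilon>) a\<^sub>j\<close>.
\<close>

lemma sum_impulse_le:
  assumes \<epsilon>: "0 < \<epsilon>" and e: "0 < e"
    and close: "\<And>j r. j < N \<Longrightarrow> 2 * (real j * \<epsilon>) < r \<Longrightarrow> r \<le> 2 * (real (Suc j) * \<epsilon>) \<Longrightarrow>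
      norm (impulse r - impulse (2 * (real j * \<epsilon>))) \<le> e"
  shows "(\<Sum>j<N. \<epsilon> * (norm (impulse (2 * (real j * \<epsilon>))) - 2 * e)) \<le> \<tau>"
proof -
  define t where "t = (\<lambda>j. 2 * (real j * \<epsilon>))"
  have "\<exists>a. norm a \<le> 1 \<and> norm (impulse r) - e \<le> norm (impulse r a)" for r
  proof (rule ccontr)
    assume "\<not> ?thesis"
    then have *: "norm a \<le> 1 \<Longrightarrow> norm (impulse r a) < norm (impulse r) - e" for a by force
    have pos: "0 \<le> norm (impulse r) - e" using *[of 0] by (simp add: blinfun.zero_right)
    have "norm (impulse r) \<le> norm (impulse r) - e"
    proof (rule norm_blinfun_bound[OF pos])
      fix x
      show "norm (impulse r x) \<le> (norm (impulse r) - e) * norm x"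
      proof (cases "x = 0")
        case False
        have x: "impulse r x = norm x *\<^sub>R impulse r (sgn x)"
          using False by (simp add: sgn_div_norm blinfun.scaleR_right)
        have "norm (impulse r (sgn x)) \<le> norm (impulse r) - e"
          by (rule less_imp_le[OF *]) (simp add: norm_sgn)
        then have "norm x * norm (impulse r (sgn x)) \<le> norm x * (norm (impulse r) - e)"
          by (rule mult_left_mono) simp
        then show ?thesis unfolding x by (simp add: mult.commute)
      qed (simp add: blinfun.zero_right)
    qed
    then show False using e by simp
  qed
  then obtain \<alpha> where \<alpha>: "\<And>r. norm (\<alpha> r) \<le> 1 \<and> norm (impulse r) - e \<le> norm (impulse r (\<alpha> r))"
    by metis
  define a where "a = (\<lambda>j. \<alpha> (t j))"
  have a: "norm (a j) \<le> 1" "norm (impulse (t j)) - e \<le> norm (impulse (t j) (a j))" for j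
    using \<alpha>[of "t j"] by (simp_all add: a_def)
  define b where "b = (\<lambda>j. sgn (impulse (t j) (a j)))"
  have b: "norm (b j) \<le> 1" for j by (simp add: b_def norm_sgn)
  let ?I = "\<lambda>j. {real j * \<epsilon><..real (Suc j) * \<epsilon>}"
  let ?f = "\<lambda>j. abs_L2_halfline (\<lambda>s. indicator (?I j) s *\<^sub>R (a j /\<^sub>R sqrt \<epsilon>))"
  let ?g = "\<lambda>j. abs_L2_halfline (\<lambda>s. indicator (?I j) s *\<^sub>R (b j /\<^sub>R sqrt \<epsilon>))"
  have pair: "\<epsilon> * (norm (impulse (t j)) - 2 * e) \<le> hankel_diff (?f j, 0, 0) \<bullet> ?g j" if j: "j < N" for j
  proof -
    let ?c = "(norm (impulse (t j)) - 2 * e) / \<epsilon>"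
    have I: "0 \<le> real j * \<epsilon>" "real j * \<epsilon> \<le> real (Suc j) * \<epsilon>"
      using \<epsilon> by (auto intro: mult_right_mono)
    have "?c * (real (Suc j) * \<epsilon> - real j * \<epsilon>)\<^sup>2 \<le> hankel_diff (?f j, 0, 0) \<bullet> ?g j"
    proof (rule hankel_diff_block_pairing_ge[OF I])
      fix s r assume s: "s \<in> ?I j" and r: "r \<in> ?I j"
      have cl: "norm (impulse (r + s) - impulse (t j)) \<le> e"
        unfolding t_def by (rule close[OF j]) (use s r in \<open>auto simp: algebra_simps\<close>)
      let ?d = "impulse (r + s) - impulse (t j)"
      have "\<bar>?d (a j) \<bullet> b j\<bar> \<le> norm (?d (a j)) * norm (b j)" by (rule Cauchy_Schwarz_ineq2)
      also have "\<dots> \<le> (norm ?d * norm (a j)) * 1" by (intro mult_mono norm_blinfun b) auto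
      also have "\<dots> \<le> (e * 1) * 1" using cl a(1)[of j] e by (intro mult_mono) auto
      finally have d: "- e \<le> ?d (a j) \<bullet> b j" by simp
      have "impulse (t j) (a j) \<bullet> b j = norm (impulse (t j) (a j))"
        by (cases "impulse (t j) (a j) = 0")
          (simp_all add: b_def sgn_div_norm power2_norm_eq_inner[symmetric] power2_eq_square)
      then have "norm (impulse (t j)) - 2 * e \<le> impulse (r + s) (a j) \<bullet> b j"
        using d a(2)[of j] by (simp add: blinfun.diff_left inner_diff_left)
      then have "(norm (impulse (t j)) - 2 * e) / \<epsilon> \<le> (impulse (r + s) (a j) \<bullet> b j) / \<epsilon>"
        using \<epsilon> by (intro divide_right_mono) auto
      also have "\<dots> = impulse (r + s) (a j /\<^sub>R sqrt \<epsilon>) \<bullet> (b j /\<^sub>R sqrt \<epsilon>)"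
        by (simp only: blinfun.scaleR_right inner_inv_sqrt[OF \<epsilon>])
      finally show "?c \<le> impulse (r + s) (a j /\<^sub>R sqrt \<epsilon>) \<bullet> (b j /\<^sub>R sqrt \<epsilon>)" .
    qed
    moreover have "?c * (real (Suc j) * \<epsilon> - real j * \<epsilon>)\<^sup>2 = \<epsilon> * (norm (impulse (t j)) - 2 * e)"
    proof -
      have "real (Suc j) * \<epsilon> - real j * \<epsilon> = \<epsilon>" by (simp add: algebra_simps)
      then show ?thesis using \<epsilon> by (simp add: power2_eq_square)
    qed
    ultimately show ?thesis by simp
  qed
  have "(\<Sum>j<N. \<epsilon> * (norm (impulse (t j)) - 2 * e)) \<le> (\<Sum>j<N. hankel_diff (?f j, 0, 0) \<bullet> ?g j)"
    using pair by (intro sum_mono) auto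
  also have "\<dots> \<le> \<tau>"
  proof (rule bessel_pairing_le_trace_norm[OF trace_norm_hankel \<tau>_nonneg])
    show "bessel_family {..<N} ?g" by (rule bessel_family_blocks[OF \<epsilon> b])
    show "bessel_family {..<N} (\<lambda>j. (?f j, 0, 0))"
      unfolding zero_prod_def[symmetric]
      by (rule bessel_family_fst[OF bessel_family_blocks[OF \<epsilon> a(1)]])
  qed
  finally show ?thesis unfolding t_def .
qed

text \<open>
  The sums of \<open>sum_impulse_le\<close> are Riemann sums of the norm of the impulse response with step \<open>2 \<epsilon>\<close>,
  but weighted by \<open>\<epsilon>\<close>. Uniform continuity on the compact interval controls the error.
\<close>

lemma impulse_L1_le:
  assumes "0 < \<T>"
  shows "(\<integral>\<^sup>+t\<in>{0<..<\<T>}. ennreal (norm (impulse t)) \<partial>lborel) \<le> ennreal (2 * \<tau>)"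
proof (rule ennreal_le_epsilon)
  fix \<eta> :: real assume "\<eta> > 0"
  \<comment> \<open>the total error is \<open>3 e \<T>\<close>: twice \<open>2 e\<close> from the test vectors, on length \<open>\<T> / 2\<close>, and \<open>e\<close> from the Riemann sum\<close>
  define e where "e = \<eta> / (3 * \<T>)"
  have e: "e > 0" using \<open>\<eta> > 0\<close> assms by (simp add: e_def)
  have "uniformly_continuous_on {0..\<T>} impulse"
    by (rule compact_uniformly_continuous[OF continuous_on_subset[OF continuous_on_impulse]]) auto
  then obtain d where d: "d > 0"
    "\<And>s t. s \<in> {0..\<T>} \<Longrightarrow> t \<in> {0..\<T>} \<Longrightarrow> dist s t < d \<Longrightarrow> dist (impulse s) (impulse t) < e"
    using e unfolding uniformly_continuous_on_def by metis
  obtain N where N: "\<T> / d < real N" using reals_Archimedean2 by blast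
  then have N0: "real N > 0" using d(1) assms by (smt (verit) divide_pos_pos)
  define \<epsilon> where "\<epsilon> = \<T> / (2 * real N)"
  have \<epsilon>: "\<epsilon> > 0" "2 * \<epsilon> < d" "2 * (real N * \<epsilon>) = \<T>"
    using N N0 d(1) assms by (auto simp: \<epsilon>_def field_simps)
  let ?t = "\<lambda>j. 2 * (real j * \<epsilon>)"
  let ?h = "\<lambda>j t. ennreal (norm (impulse (?t j)) + e) * indicator {?t j<..?t (Suc j)} t"
  have le\<T>: "?t (Suc j) \<le> \<T>" if "j < N" for j
  proof -
    have "real (Suc j) * \<epsilon> \<le> real N * \<epsilon>" using that \<epsilon>(1) by (intro mult_right_mono) auto
    then show ?thesis using \<epsilon>(3) by simp
  qed
  have close: "norm (impulse r - impulse (?t j)) \<le> e" if "j < N" "?t j < r" "r \<le> ?t (Suc j)" for j r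
  proof -
    have t0: "0 \<le> ?t j" using \<epsilon>(1) by simp
    have "?t (Suc j) = ?t j + 2 * \<epsilon>" by (simp add: algebra_simps)
    then have "dist r (?t j) < d" using that \<epsilon>(2) by (simp add: dist_real_def)
    moreover have "r \<in> {0..\<T>}" "?t j \<in> {0..\<T>}"
      using that(2,3) le\<T>[OF that(1)] t0 unfolding atLeastAtMost_iff by (intro conjI; linarith)+
    ultimately have "dist (impulse r) (impulse (?t j)) < e"
      by (intro d(2))
    then show ?thesis by (simp add: dist_norm)
  qed
  have sum: "(\<Sum>j<N. \<epsilon> * (norm (impulse (?t j)) - 2 * e)) \<le> \<tau>"
    by (rule sum_impulse_le[OF \<epsilon>(1) e close])
  have "(\<integral>\<^sup>+t\<in>{0<..<\<T>}. ennreal (norm (impulse t)) \<partial>lborel)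
      \<le> (\<integral>\<^sup>+t. (\<Sum>j<N. ?h j t) \<partial>lborel)"
  proof (rule nn_integral_mono)
    fix t :: real
    show "ennreal (norm (impulse t)) * indicator {0<..<\<T>} t
        \<le> (\<Sum>j<N. ?h j t)"
    proof (cases "t \<in> {0<..<\<T>}")
      case True
      define j where "j = nat (\<lceil>t / (2 * \<epsilon>)\<rceil> - 1)"
      have "0 < t / (2 * \<epsilon>)" using True \<epsilon>(1) by simp
      then have "real j < t / (2 * \<epsilon>)" "t / (2 * \<epsilon>) \<le> real (Suc j)" unfolding j_def by linarith+
      then have j: "?t j < t" "t \<le> ?t (Suc j)" using \<epsilon>(1) by (auto simp: field_simps)
      have "?t j < ?t N" using j(1) True \<epsilon>(3) by simp
      then have jN: "j < N" using \<epsilon>(1) by simp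
      have "norm (impulse t) \<le> norm (impulse (?t j)) + e"
        using close[OF jN j] norm_triangle_sub[of "impulse t" "impulse (?t j)"] by linarith
      then have "ennreal (norm (impulse t)) \<le> ?h j t"
        using j by (simp add: ennreal_leI)
      also have "\<dots> \<le> (\<Sum>j<N. ?h j t)"
        using jN by (intro member_le_sum) auto
      finally show ?thesis using True by simp
    qed simp
  qed
  also have "\<dots> = (\<Sum>j<N. ennreal (norm (impulse (?t j)) + e) * ennreal (2 * \<epsilon>))"
  proof -
    have em: "emeasure lborel {?t j<..?t (Suc j)} = ennreal (2 * \<epsilon>)" for j
      using \<epsilon>(1) by (subst emeasure_lborel_Ioc) (auto simp: algebra_simps)
    have "(\<integral>\<^sup>+t. (\<Sum>j<N. ?h j t) \<partial>lborel)
        = (\<Sum>j<N. \<integral>\<^sup>+t. ?h j t \<partial>lborel)"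
      by (rule nn_integral_sum) measurable
    also have "\<dots> = (\<Sum>j<N. ennreal (norm (impulse (?t j)) + e) * emeasure lborel {?t j<..?t (Suc j)})"
      by (intro sum.cong refl nn_integral_cmult_indicator) simp
    finally show ?thesis unfolding em .
  qed
  also have "\<dots> = ennreal (\<Sum>j<N. (norm (impulse (?t j)) + e) * (2 * \<epsilon>))"
    using e \<epsilon>(1) by (subst sum_ennreal[symmetric]) (auto simp: ennreal_mult)
  also have "(\<Sum>j<N. (norm (impulse (?t j)) + e) * (2 * \<epsilon>))
      = 2 * (\<Sum>j<N. \<epsilon> * (norm (impulse (?t j)) - 2 * e)) + 3 * e * (2 * (real N * \<epsilon>))"
    by (simp add: sum_distrib_left sum.distrib algebra_simps sum_subtractf)
  also have "ennreal \<dots> \<le> ennreal (2 * \<tau> + \<eta>)"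
    using sum assms by (intro ennreal_leI) (simp add: \<epsilon>(3) e_def)
  also have "\<dots> = ennreal (2 * \<tau>) + ennreal \<eta>" using \<tau>_nonneg \<open>\<eta> > 0\<close> by simp
  finally show "(\<integral>\<^sup>+t\<in>{0<..<\<T>}. ennreal (norm (impulse t)) \<partial>lborel) \<le> ennreal (2 * \<tau>) + ennreal \<eta>" .
qed


section \<open>The error of the outputs\<close>

abbreviation noise_response :: "'d \<Rightarrow> real \<Rightarrow> 'h" where
  "noise_response r \<equiv> output_diff (K (covariance_sqrt (axis r 1))) (K' (covariance_sqrt (axis r 1)))"

text \<open>
  The vectors \<open>(0, e\<^sub>r, 0)\<close> are orthonormal, and the operator maps them to the noise responses.
\<close>

lemma noise_response_HS_le:
  "(\<integral>\<^sup>+t. ennreal (\<Sum>r\<in>UNIV. (norm (noise_response r t))\<^sup>2) \<partial>halfline) \<le> ennreal (\<tau>\<^sup>2)"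
proof -
  have [measurable]: "noise_response r \<in> borel_measurable halfline" for r
    using sq_integrable_output_diff by (simp add: sq_integrable_def)
  have "(\<integral>\<^sup>+t. ennreal (\<Sum>r\<in>UNIV. (norm (noise_response r t))\<^sup>2) \<partial>halfline)
      = (\<integral>\<^sup>+t. (\<Sum>r\<in>UNIV. ennreal ((norm (noise_response r t))\<^sup>2)) \<partial>halfline)"
    by (subst sum_ennreal) simp_all
  also have "\<dots> = (\<Sum>r\<in>UNIV. \<integral>\<^sup>+t. ennreal ((norm (noise_response r t))\<^sup>2) \<partial>halfline)"
    by (rule nn_integral_sum) measurable
  also have "\<dots> = (\<Sum>r\<in>UNIV. ennreal ((norm (hankel_diff (0, axis r 1, 0)))\<^sup>2))"
    unfolding hankel_diff_noise_initial B_in_zero add_0_right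
    by (intro sum.cong refl nn_integral_norm_sq_abs_L2_halfline sq_integrable_output_diff)
  also have "\<dots> = ennreal (\<Sum>r\<in>UNIV. (norm (hankel_diff (0, axis r 1, 0)))\<^sup>2)"
    by (rule sum_ennreal) simp
  also have "\<dots> \<le> ennreal (\<tau>\<^sup>2)"
  proof (intro ennreal_leI bessel_sum_norm_sq_le_trace_norm[OF trace_norm_hankel \<tau>_nonneg] bessel_family_orthogonal)
    fix i j :: 'd assume "i \<noteq> j"
    then show "(0 :: (real^'m) L2_halfline, axis i 1 :: real^'d, 0 :: real^'k) \<bullet> (0, axis j 1, 0) = 0"
      by (simp add: inner_prod_def inner_axis_axis)
  qed (simp_all add: norm_Pair)
  finally show ?thesis .
qed

text \<open>
  After the reflection \<open>s \<mapsto> t - s\<close> the integral of the squared Hilbert-Schmidt norm runs over a part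
  of the half-line.
\<close>

lemma stochastic_convolution_diff_le:
  assumes t: "0 \<le> t"
    and I: "has_wiener_integral P M (\<lambda>s. T (t - s) o\<^sub>L K) t I"
    and I': "has_wiener_integral P M (\<lambda>s. T' (t - s) o\<^sub>L K') t I'"
  shows "L2_norm P (\<lambda>w. C (I w) - C' (I' w)) \<le> ennreal \<tau>"
proof -
  define g where "g = (\<lambda>s. ennreal (\<Sum>r\<in>UNIV. (norm (noise_response r s))\<^sup>2) * indicator {0<..} s)"
  have [measurable]: "noise_response r \<in> borel_measurable halfline" for r
    using sq_integrable_output_diff by (simp add: sq_integrable_def)
  have "(\<lambda>s. ennreal (\<Sum>r\<in>UNIV. (norm (noise_response r s))\<^sup>2)) \<in> borel_measurable halfline" by measurable
  then have g: "g \<in> borel_measurable borel"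
    unfolding g_def by (subst (asm) borel_measurable_restrict_space_iff_ennreal) simp_all
  let ?h = "\<lambda>s. indicator {0..t} s * L2_set (\<lambda>r. norm (C ((T (t - s) o\<^sub>L K) (covariance_sqrt (axis r 1)))
      - C' ((T' (t - s) o\<^sub>L K') (covariance_sqrt (axis r 1))))) UNIV"
  have "L2_norm P (\<lambda>w. C (I w) - C' (I' w)) \<le> L2_ennreal lborel (\<lambda>s. ennreal (?h s))"
    by (rule wiener_integral_difference_bound[OF I I'])
  also have "\<dots> \<le> ennreal \<tau>"
    unfolding L2_ennreal_def ennreal_sqrt_le_iff
  proof -
    have "(\<integral>\<^sup>+s. (ennreal (?h s))\<^sup>2 \<partial>lborel) \<le> (\<integral>\<^sup>+s. g (t - s) \<partial>lborel)"
    proof (rule nn_integral_mono_AE)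
      have "AE s in lborel. s \<noteq> t" by (rule AE_lborel_singleton)
      then show "AE s in lborel. (ennreal (?h s))\<^sup>2 \<le> g (t - s)"
      proof eventually_elim
        case (elim s)
        show ?case
        proof (cases "s \<in> {0..t}")
          case True
          then have "(ennreal (?h s))\<^sup>2 = ennreal (\<Sum>r\<in>UNIV. (norm (noise_response r (t - s)))\<^sup>2)"
            by (simp add: L2_set_def sum_nonneg ennreal_power output_diff_def)
          then show ?thesis using True elim by (simp add: g_def)
        qed simp
      qed
    qed
    also have "\<dots> = (\<integral>\<^sup>+s. g s \<partial>lborel)" by (rule nn_integral_reflect[OF g])
    also have "\<dots> = (\<integral>\<^sup>+t. ennreal (\<Sum>r\<in>UNIV. (norm (noise_response r t))\<^sup>2) \<partial>halfline)"
      unfolding g_def by (rule nn_integral_restrict_space[symmetric]) simp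
    also have "\<dots> \<le> ennreal (\<tau>\<^sup>2)" by (rule noise_response_HS_le)
    also have "\<dots> = (ennreal \<tau>)\<^sup>2" using \<tau>_nonneg by (simp add: ennreal_power)
    finally show "(\<integral>\<^sup>+s. (ennreal (?h s))\<^sup>2 \<partial>lborel) \<le> (ennreal \<tau>)\<^sup>2" .
  qed
  finally show ?thesis .
qed

lemma initial_response_L2_le:
  "L2_ennreal halfline (\<lambda>t. ennreal (norm (output_diff (B_in \<phi> v) (B_in \<phi>' v) t))) \<le> ennreal (\<tau> * norm v)"
proof -
  have "hankel_diff (0, 0, v) = abs_L2_halfline (output_diff (B_in \<phi> v) (B_in \<phi>' v))"
    unfolding hankel_diff_noise_initial covariance_sqrt_zero blinfun.zero_right add_0_left ..
  moreover have "norm (hankel_diff (0, 0, v)) \<le> \<tau> * norm (0 :: (real^'m) L2_halfline, 0 :: real^'d, v)"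
    by (rule norm_le_trace_norm[OF trace_norm_hankel \<tau>_nonneg])
  ultimately have "norm (abs_L2_halfline (output_diff (B_in \<phi> v) (B_in \<phi>' v))) \<le> \<tau> * norm v"
    by (simp add: norm_Pair)
  then have "ennreal ((norm (abs_L2_halfline (output_diff (B_in \<phi> v) (B_in \<phi>' v))))\<^sup>2) \<le> ennreal ((\<tau> * norm v)\<^sup>2)"
    by (intro ennreal_leI power_mono) simp_all
  then show ?thesis
    unfolding L2_ennreal_def ennreal_sqrt_le_iff
    using \<tau>_nonneg nn_integral_norm_sq_abs_L2_halfline[OF sq_integrable_output_diff, of "B_in \<phi> v" "B_in \<phi>' v"]
    by (simp add: ennreal_power)
qed

text \<open>
  For fixed \<open>t\<close> the error is, almost surely, at most the free response \<open>c t\<close> plus the norm of the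
  difference of the stochastic convolutions plus \<open>V t w\<close>, the convolution of the norm of the impulse
  response with \<open>\<parallel>u\<parallel>\<close>. Minkowski's inequality is applied first in \<open>w\<close> and then in \<open>t\<close>, because the
  stochastic convolutions are only given separately for each time and need not be jointly measurable.
\<close>

lemma output_error_bound:
  fixes u :: "real \<Rightarrow> 'w \<Rightarrow> real^'m"
  assumes \<T>: "0 < \<T>"
    and u: "sq_integrable (time_product P \<T>) (\<lambda>(w, t). u t w)"
    and Z: "mild_solution P M T B K u (B_in \<phi> v) \<T> Z"
    and Z': "mild_solution P M T' B' K' u (B_in \<phi>' v) \<T> Z'"
  shows "L2_norm (time_product P \<T>) (\<lambda>(w, t). C (Z t w) - C' (Z' t w))
    \<le> ennreal (\<tau> * norm v) + (ennreal \<tau> * ennreal (sqrt \<T>)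
      + ennreal (2 * \<tau>) * L2_norm (time_product P \<T>) (\<lambda>(w, t). u t w))"
proof -
  let ?o = "output_diff (B_in \<phi> v) (B_in \<phi>' v)" and ?u = "L2_norm (time_product P \<T>) (\<lambda>(w, t). u t w)"
  define R where "R = restrict_space (lborel :: real measure) {0<..<\<T>}"
  have spR: "space R = {0<..<\<T>}" by (simp add: R_def space_restrict_space)
  have emR: "emeasure R (space R) = ennreal \<T>"
    using \<T> by (simp add: spR) (simp add: R_def emeasure_restrict_space)
  interpret R: finite_measure R by (rule finite_measureI) (simp add: emR)
  interpret PR: pair_sigma_finite P R ..
  have [measurable]: "(\<lambda>s. s) \<in> borel_measurable R"
    unfolding R_def by (rule measurable_restrict_space1) simp

  define U where "U = (\<lambda>z. ennreal (norm (case z of (w, t) \<Rightarrow> u t w)))"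
  have um: "(\<lambda>(w, t). u t w) \<in> borel_measurable (P \<Otimes>\<^sub>M R)"
    using u by (simp add: sq_integrable_def R_def)
  have U [measurable]: "U \<in> borel_measurable (P \<Otimes>\<^sub>M R)"
    unfolding U_def by (rule measurable_compose[OF measurable_compose[OF um borel_measurable_norm] measurable_ennreal])
  have U2: "(\<integral>\<^sup>+z. (U z)\<^sup>2 \<partial>(P \<Otimes>\<^sub>M R)) = ?u\<^sup>2"
    unfolding L2_norm_eq_L2_ennreal L2_ennreal_power2 by (simp add: U_def R_def)

  have "AE w in P. (\<integral>\<^sup>+s. (U (w, s))\<^sup>2 \<partial>R) \<noteq> \<infinity>"
  proof (rule nn_integral_PInf_AE)
    have "(\<integral>\<^sup>+w. \<integral>\<^sup>+s. (U (w, s))\<^sup>2 \<partial>R \<partial>P) = (\<integral>\<^sup>+z. (U z)\<^sup>2 \<partial>(P \<Otimes>\<^sub>M R))"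
      by (rule R.nn_integral_fst) measurable
    also have "\<dots> = (\<integral>\<^sup>+z. ennreal ((norm (case z of (w, t) \<Rightarrow> u t w))\<^sup>2) \<partial>(time_product P \<T>))"
      by (simp add: U_def R_def ennreal_power)
    also have "\<dots> < \<infinity>"
      using u by (auto simp: sq_integrable_def integrable_iff_bounded)
    finally show "(\<integral>\<^sup>+w. \<integral>\<^sup>+s. (U (w, s))\<^sup>2 \<partial>R \<partial>P) \<noteq> \<infinity>" by simp
  qed measurable
  then have u_int: "AE w in P. integrable R (\<lambda>s. u s w)"
    using AE_space
  proof eventually_elim
    case (elim w)
    have m [measurable]: "(\<lambda>s. u s w) \<in> borel_measurable R"
      using measurable_Pair2[OF um elim(2)] by simp
    have "integrable R (\<lambda>s. (norm (u s w))\<^sup>2)"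
      using elim(1) by (intro integrableI_bounded) (auto simp: U_def ennreal_power less_top)
    then have "integrable R (\<lambda>s. norm (u s w))"
      by (rule R.square_integrable_imp_integrable[rotated]) simp
    then show ?case by (rule integrable_norm_cancel) simp
  qed

  \<comment> \<open>a square root of the kernel, as required by \<open>young_convolution_L2\<close>\<close>
  define \<kappa> where "\<kappa> = (\<lambda>r. ennreal (sqrt (indicator {0<..<\<T>} r *\<^sub>R norm (impulse r))))"
  have [measurable]: "\<kappa> \<in> borel_measurable borel"
  proof -
    have "continuous_on {0<..<\<T>} (\<lambda>r. norm (impulse r))"
      by (intro continuous_on_norm continuous_on_subset[OF continuous_on_impulse]) auto
    then have m: "(\<lambda>r. indicator {0<..<\<T>} r *\<^sub>R norm (impulse r)) \<in> borel_measurable borel"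
      by (intro borel_measurable_continuous_on_indicator) auto
    have "(\<lambda>x. ennreal (sqrt x)) \<in> borel_measurable borel" by measurable
    then show ?thesis unfolding \<kappa>_def by (rule measurable_compose[OF m])
  qed
  have \<kappa>2: "(\<kappa> r)\<^sup>2 = ennreal (norm (impulse r)) * indicator {0<..<\<T>} r" for r
    by (cases "r \<in> {0<..<\<T>}") (simp_all add: \<kappa>_def ennreal_power)
  have \<kappa>_L1: "(\<integral>\<^sup>+r. (\<kappa> r)\<^sup>2 \<partial>lborel) \<le> ennreal (2 * \<tau>)"
    unfolding \<kappa>2 by (rule impulse_L1_le[OF \<T>])
  define V where "V = (\<lambda>t w. \<integral>\<^sup>+s. (\<kappa> (t - s))\<^sup>2 * U (w, s) \<partial>R)"
  have V [measurable]: "V t \<in> borel_measurable P" for t unfolding V_def by measurable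
  have V2 [measurable]: "(\<lambda>t. L2_ennreal P (V t)) \<in> borel_measurable R"
    unfolding V_def L2_ennreal_def by measurable

  define c where "c = (\<lambda>t. ennreal (norm (?o t)))"
  have oh: "output_diff x x' \<in> borel_measurable halfline" for x x'
    using sq_integrable_output_diff by (simp add: sq_integrable_def)
  have oR: "output_diff x x' \<in> borel_measurable R" for x x'
    unfolding R_def by (rule measurable_restrict_mono[OF oh]) auto
  have [measurable]: "c \<in> borel_measurable R"
    unfolding c_def by (rule measurable_compose[OF measurable_compose[OF oR borel_measurable_norm] measurable_ennreal])

  define D where "D = (\<lambda>(w, t). ennreal (norm (C (Z t w) - C' (Z' t w))))"
  have D [measurable]: "D \<in> borel_measurable (P \<Otimes>\<^sub>M R)"
  proof -
    have Zm: "(\<lambda>z. Z (snd z) (fst z)) \<in> borel_measurable (P \<Otimes>\<^sub>M R)"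
      and Zm': "(\<lambda>z. Z' (snd z) (fst z)) \<in> borel_measurable (P \<Otimes>\<^sub>M R)"
      using Z Z' by (simp_all add: mild_solution_def R_def split_def)
    have "(\<lambda>z. C (Z (snd z) (fst z)) - C' (Z' (snd z) (fst z))) \<in> borel_measurable (P \<Otimes>\<^sub>M R)"
      by (intro borel_measurable_diff borel_measurable_blinfun_apply Zm Zm')
    then show ?thesis unfolding D_def split_def
      by (rule measurable_compose[OF measurable_compose[OF _ borel_measurable_norm] measurable_ennreal])
  qed

  have slice: "L2_ennreal P (\<lambda>w. D (w, t)) \<le> c t + (ennreal \<tau> + L2_ennreal P (V t))" if t: "t \<in> {0<..<\<T>}" for t
  proof -
    have tT: "t \<in> {0..\<T>}" and t0: "0 \<le> t" using t by auto
    obtain I where I: "has_wiener_integral P M (\<lambda>s. T (t - s) o\<^sub>L K) t I"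
      "AE w in P. Z t w = T t (B_in \<phi> v) + I w + (LINT s:{0<..<t}|lborel. T (t - s) (B (u s w)))"
      using Z tT unfolding mild_solution_def by blast
    obtain I' where I': "has_wiener_integral P M (\<lambda>s. T' (t - s) o\<^sub>L K') t I'"
      "AE w in P. Z' t w = T' t (B_in \<phi>' v) + I' w + (LINT s:{0<..<t}|lborel. T' (t - s) (B' (u s w)))"
      using Z' tT unfolding mild_solution_def by blast
    define J where "J = (\<lambda>w. C (I w) - C' (I' w))"
    have [measurable]: "I \<in> borel_measurable P" "I' \<in> borel_measurable P"
      using I(1) I'(1) by (auto simp: has_wiener_integral_def)
    have [measurable]: "J \<in> borel_measurable P" unfolding J_def by measurable
    define N where "N = restrict_space (lborel :: real measure) {0<..<t}"
    have set_int: "(LINT s:{0<..<t}|lborel. f s) = (\<integral>s. f s \<partial>N)" for f :: "real \<Rightarrow> 'z::{banach, second_countable_topology}"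
      unfolding N_def set_lebesgue_integral_def by (subst integral_restrict_space) simp_all
    have "AE w in P. D (w, t) \<le> c t + (ennreal (norm (J w)) + V t w)"
      using u_int I(2) I'(2)
    proof eventually_elim
      case (elim w)
      have "set_integrable lborel {0<..<\<T>} (\<lambda>s. u s w)"
        using elim(1) unfolding R_def set_integrable_def by (subst (asm) integrable_restrict_space) simp_all
      then have "set_integrable lborel {0<..<t} (\<lambda>s. u s w)"
        by (rule set_integrable_subset) (use t in auto)
      then have uN: "integrable N (\<lambda>s. u s w)"
        unfolding N_def set_integrable_def by (subst integrable_restrict_space) simp_all
      note i = integrable_convolution[OF semigroups(1) stable(1) uN[unfolded N_def], of B, folded N_def]
      note i' = integrable_convolution[OF semigroups(2) stable(2) uN[unfolded N_def], of B', folded N_def]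
      define X where "X = (\<integral>s. T (t - s) (B (u s w)) \<partial>N)"
      define X' where "X' = (\<integral>s. T' (t - s) (B' (u s w)) \<partial>N)"
      have CX: "C X = (\<integral>s. C (T (t - s) (B (u s w))) \<partial>N)"
        unfolding X_def by (rule integral_bounded_linear[OF blinfun.bounded_linear_right i, symmetric])
      have CX': "C' X' = (\<integral>s. C' (T' (t - s) (B' (u s w))) \<partial>N)"
        unfolding X'_def by (rule integral_bounded_linear[OF blinfun.bounded_linear_right i', symmetric])
      have ii: "integrable N (\<lambda>s. C (T (t - s) (B (u s w))))" "integrable N (\<lambda>s. C' (T' (t - s) (B' (u s w))))"
        by (rule integrable_bounded_linear[OF blinfun.bounded_linear_right i],
            rule integrable_bounded_linear[OF blinfun.bounded_linear_right i'])
      have CXX: "C X - C' X' = (\<integral>s. impulse (t - s) (u s w) \<partial>N)"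
        unfolding CX CX' impulse_apply output_diff_def by (rule Bochner_Integration.integral_diff[OF ii, symmetric])
      have "integrable N (\<lambda>s. impulse (t - s) (u s w))"
        unfolding impulse_apply output_diff_def by (rule Bochner_Integration.integrable_diff[OF ii])
      then have "ennreal (norm (C X - C' X')) \<le> (\<integral>\<^sup>+s. ennreal (norm (impulse (t - s) (u s w))) \<partial>N)"
        unfolding CXX by (rule integral_norm_bound_ennreal)
      also have "\<dots> \<le> V t w"
        unfolding V_def R_def N_def
      proof (subst (1 2) nn_integral_restrict_space, simp, simp, rule nn_integral_mono)
        fix s
        have "ennreal (norm (impulse (t - s) (u s w))) \<le> ennreal (norm (impulse (t - s))) * ennreal (norm (u s w))"
          by (simp add: ennreal_mult[symmetric] ennreal_leI norm_blinfun)
        then show "ennreal (norm (impulse (t - s) (u s w))) * indicator {0<..<t} s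
            \<le> (\<kappa> (t - s))\<^sup>2 * U (w, s) * indicator {0<..<\<T>} s"
          using t by (cases "s \<in> {0<..<t}") (simp_all add: \<kappa>2 U_def)
      qed
      finally have conv: "ennreal (norm (C X - C' X')) \<le> V t w" .
      have "C (Z t w) - C' (Z' t w) = ?o t + (J w + (C X - C' X'))"
        unfolding elim(2,3) set_int X_def[symmetric] X'_def[symmetric] J_def output_diff_def
        by (simp add: blinfun.add_right)
      then have "norm (C (Z t w) - C' (Z' t w)) \<le> norm (?o t) + (norm (J w) + norm (C X - C' X'))"
        using norm_triangle_ineq[of "?o t" "J w + (C X - C' X')"]
          norm_triangle_ineq[of "J w" "C X - C' X'"] by simp
      then have "D (w, t) \<le> ennreal (norm (?o t) + (norm (J w) + norm (C X - C' X')))"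
        unfolding D_def prod.case by (rule ennreal_leI)
      also have "\<dots> = c t + (ennreal (norm (J w)) + ennreal (norm (C X - C' X')))"
        by (simp add: c_def)
      also have "\<dots> \<le> c t + (ennreal (norm (J w)) + V t w)"
        by (intro add_left_mono conv)
      finally show ?case .
    qed
    then have "L2_ennreal P (\<lambda>w. D (w, t)) \<le> L2_ennreal P (\<lambda>w. c t + (ennreal (norm (J w)) + V t w))"
      by (rule L2_ennreal_mono_AE)
    also have "\<dots> \<le> L2_ennreal P (\<lambda>w. c t) + (L2_ennreal P (\<lambda>w. ennreal (norm (J w))) + L2_ennreal P (V t))"
      by (rule order_trans[OF L2_ennreal_triangle add_left_mono[OF L2_ennreal_triangle]]) measurable
    also have "\<dots> \<le> c t + (ennreal \<tau> + L2_ennreal P (V t))"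
      unfolding L2_ennreal_const[OF prob_space_axioms]
      using stochastic_convolution_diff_le[OF t0 I(1) I'(1)]
      by (intro add_left_mono add_right_mono) (simp add: L2_norm_eq_L2_ennreal J_def)
    finally show ?thesis .
  qed

  have "(\<integral>\<^sup>+z. (D z)\<^sup>2 \<partial>(P \<Otimes>\<^sub>M R)) = (\<integral>\<^sup>+t. (\<integral>\<^sup>+w. (D (w, t))\<^sup>2 \<partial>P) \<partial>R)"
    by (rule PR.nn_integral_snd[symmetric]) measurable
  also have "\<dots> \<le> (\<integral>\<^sup>+t. (c t + (ennreal \<tau> + L2_ennreal P (V t)))\<^sup>2 \<partial>R)"
  proof (rule nn_integral_mono)
    fix t assume "t \<in> space R"
    then have "(L2_ennreal P (\<lambda>w. D (w, t)))\<^sup>2 \<le> (c t + (ennreal \<tau> + L2_ennreal P (V t)))\<^sup>2"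
      by (intro power_mono_ennreal slice) (simp add: spR)
    then show "(\<integral>\<^sup>+w. (D (w, t))\<^sup>2 \<partial>P) \<le> (c t + (ennreal \<tau> + L2_ennreal P (V t)))\<^sup>2"
      by (simp only: L2_ennreal_power2)
  qed
  finally have "L2_norm (time_product P \<T>) (\<lambda>(w, t). C (Z t w) - C' (Z' t w))
      \<le> L2_ennreal R (\<lambda>t. c t + (ennreal \<tau> + L2_ennreal P (V t)))"
    unfolding L2_norm_eq_L2_ennreal L2_ennreal_def
    by (intro ennreal_sqrt_mono) (simp add: D_def R_def split_def)
  also have "\<dots> \<le> L2_ennreal R c + (L2_ennreal R (\<lambda>t. ennreal \<tau>) + L2_ennreal R (\<lambda>t. L2_ennreal P (V t)))"
    by (rule order_trans[OF L2_ennreal_triangle add_left_mono[OF L2_ennreal_triangle]]) measurable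
  also have "\<dots> \<le> ennreal (\<tau> * norm v) + (ennreal \<tau> * ennreal (sqrt \<T>)
      + ennreal (2 * \<tau>) * ?u)"
  proof (intro add_mono)
    have "L2_ennreal R c \<le> L2_ennreal halfline c"
      unfolding L2_ennreal_def R_def
      by (subst (1 2) nn_integral_restrict_space, simp, simp)
        (intro ennreal_sqrt_mono nn_integral_mono mult_left_mono, auto simp: indicator_def)
    also have "\<dots> \<le> ennreal (\<tau> * norm v)" unfolding c_def by (rule initial_response_L2_le)
    finally show "L2_ennreal R c \<le> ennreal (\<tau> * norm v)" .
    have "(\<integral>\<^sup>+t. (ennreal \<tau>)\<^sup>2 \<partial>R) = (ennreal \<tau> * ennreal (sqrt \<T>))\<^sup>2"
      using \<T> by (simp add: emR power_mult_distrib ennreal_power)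
    then show "L2_ennreal R (\<lambda>t. ennreal \<tau>) \<le> ennreal \<tau> * ennreal (sqrt \<T>)"
      unfolding L2_ennreal_def by (simp only: ennreal_sqrt_of_power2 order_refl)
    have "(\<integral>\<^sup>+t. (L2_ennreal P (V t))\<^sup>2 \<partial>R) \<le> (\<integral>\<^sup>+r. (\<kappa> r)\<^sup>2 \<partial>lborel)\<^sup>2 * (\<integral>\<^sup>+z. (U z)\<^sup>2 \<partial>(P \<Otimes>\<^sub>M R))"
      unfolding L2_ennreal_power2 V_def R_def
      by (rule young_convolution_L2) (use U in \<open>simp_all add: R_def sigma_finite_measure_axioms\<close>)
    also have "\<dots> \<le> (ennreal (2 * \<tau>))\<^sup>2 * ?u\<^sup>2"
      unfolding U2 by (intro mult_right_mono power_mono_ennreal \<kappa>_L1) simp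
    finally show "L2_ennreal R (\<lambda>t. L2_ennreal P (V t)) \<le> ennreal (2 * \<tau>) * ?u"
      unfolding L2_ennreal_def[of R] ennreal_sqrt_le_iff by (simp add: power_mult_distrib)
  qed
  finally show ?thesis .
qed

end

theorem theorem2:
  fixes P :: "'w measure"
    and M :: "real \<Rightarrow> 'w \<Rightarrow> real^'d"
    and u :: "real \<Rightarrow> 'w \<Rightarrow> real^'m"
    and A :: "('x::{real_inner, banach, second_countable_topology} \<times> 'x) set"
    and T :: "real \<Rightarrow> 'x \<Rightarrow>\<^sub>L 'x"
    and B :: "(real^'m) \<Rightarrow>\<^sub>L 'x" and K :: "(real^'d) \<Rightarrow>\<^sub>L 'x"
    and C :: "'x \<Rightarrow>\<^sub>L 'h::{real_inner, banach, second_countable_topology}"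
    and A' :: "('y::{real_inner, banach, second_countable_topology} \<times> 'y) set"
    and T' :: "real \<Rightarrow> 'y \<Rightarrow>\<^sub>L 'y"
    and B' :: "(real^'m) \<Rightarrow>\<^sub>L 'y" and K' :: "(real^'d) \<Rightarrow>\<^sub>L 'y"
    and C' :: "'y \<Rightarrow>\<^sub>L 'h"
    and \<phi> :: "'k::finite \<Rightarrow> 'x" and \<phi>' :: "'k \<Rightarrow> 'y" and v :: "real^'k"
    and \<xi> :: 'x and \<xi>' :: 'y
    and Z :: "real \<Rightarrow> 'w \<Rightarrow> 'x" and Z' :: "real \<Rightarrow> 'w \<Rightarrow> 'y"
    and \<T> :: real
  assumes "prob_space P" and "0 < \<T>"
    and "levy_process P M"
    and "\<forall>t\<ge>0. sq_integrable P (M t)"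
    and "\<forall>t\<ge>0. (\<integral>w. M t w \<partial>P) = 0"
    and "generates A T" and "exp_stable T"
    and "generates A' T'" and "exp_stable T'"
    and "sq_integrable (time_product P \<T>) (\<lambda>(w, t). u t w)"
    and "\<forall>i j. \<phi> i \<bullet> \<phi> j = of_bool (i = j)"
    and "\<xi> = B_in \<phi> v" and "\<xi>' = B_in \<phi>' v"
    and "mild_solution P M T B K u \<xi> \<T> Z"
    and "mild_solution P M T' B' K' u \<xi>' \<T> Z'"
  shows "L2_norm (time_product P \<T>) (\<lambda>(w, t). C (Z t w) - C' (Z' t w)) / ennreal (sqrt \<T>)
    \<le> trace_norm (\<lambda>x. ou_hankel P M T B K C \<phi> x - ou_hankel P M T' B' K' C' \<phi>' x) *
       (1 + (L2_norm P (\<lambda>_. \<xi>) + 2 * L2_norm (time_product P \<T>) (\<lambda>(w, t). u t w))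
              / ennreal (sqrt \<T>))"
proof -
  let ?F = "\<lambda>x. ou_hankel P M T B K C \<phi> x - ou_hankel P M T' B' K' C' \<phi>' x"
  let ?N = "L2_norm (time_product P \<T>) (\<lambda>(w, t). C (Z t w) - C' (Z' t w))"
  let ?u = "L2_norm (time_product P \<T>) (\<lambda>(w, t). u t w)"
  let ?q = "ennreal (sqrt \<T>)"
  show ?thesis
  proof (cases "trace_norm ?F = \<infinity>")
    case True
    have "1 + (L2_norm P (\<lambda>_. \<xi>) + 2 * ?u) / ?q \<noteq> 0" by simp
    then show ?thesis unfolding True by (simp add: ennreal_top_mult)
  next
    case False
    then obtain \<tau> where \<tau>: "trace_norm ?F = ennreal \<tau>" "0 \<le> \<tau>"
      by (cases "trace_norm ?F" rule: ennreal_cases) auto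
    interpret hankel_pair T C T' C' P M B K \<phi> B' K' \<phi>' \<tau>
    proof (intro hankel_pair.intro stable_pair.intro square_integrable_levy.intro
        square_integrable_levy_axioms.intro hankel_pair_axioms.intro)
      show "C0_semigroup T" "C0_semigroup T'"
        using assms(6,8) by (simp_all add: generates_def)
    qed (use assms(1,3,4,5,7,9) \<tau> in auto)
    have \<xi>: "L2_norm P (\<lambda>_. \<xi>) = ennreal (norm v)"
      using norm_B_in_orthonormal[OF assms(11)] assms(12)
      by (simp add: L2_norm_eq_L2_ennreal L2_ennreal_const[OF assms(1)])
    have q: "?q \<noteq> 0" "?q \<noteq> top" using \<open>0 < \<T>\<close> by auto
    have "?N \<le> ennreal (\<tau> * norm v) + (ennreal \<tau> * ?q + ennreal (2 * \<tau>) * ?u)"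
      using output_error_bound[OF assms(2,10)] assms(12-15) by blast
    also have "\<dots> = ennreal \<tau> * ?q + ennreal \<tau> * (ennreal (norm v) + 2 * ?u)"
      using \<tau>(2) by (simp add: ennreal_mult distrib_left mult_ac add_ac)
    finally have "?N / ?q \<le> (ennreal \<tau> * ?q + ennreal \<tau> * (ennreal (norm v) + 2 * ?u)) / ?q"
      by (rule divide_right_mono_ennreal)
    also have "\<dots> = ennreal \<tau> + ennreal \<tau> * (ennreal (norm v) + 2 * ?u) / ?q"
      using q by (simp add: add_divide_distrib_ennreal ennreal_mult_divide_eq)
    also have "\<dots> = ennreal \<tau> * (1 + (ennreal (norm v) + 2 * ?u) / ?q)"
      by (simp add: distrib_left ennreal_times_divide)
    finally show ?thesis unfolding \<tau>(1) \<xi> .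
  qed
qed

end
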